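(* Let $p$ be a prime, let $N/K$ be an extension of number fields of degree $p$, and let $L$ be a subfield of $N$ with $N=L\cdot K$ such that $[N:L]=q$ is coprime to $p$; put $F:=L\cap K$ (so $[L:F]=p$ and $[K:F]=q$). Let $\overline{N}_{N/L}:\mathcal{I}_{N/K}/\mathcal{I}_K\to\mathcal{I}_{L/F}/\mathcal{I}_F$ be the homomorphism induced by the relative norm $N_{N/L}$. Then there are isomorphisms of finite $\mathbb{F}_p$-vector spaces \[ (\mathcal{I}_{N/K}/\mathcal{I}_K)/\ker(\overline{N}_{N/L})\simeq\mathcal{I}_{L/F}/\mathcal{I}_F,\qquad \mathcal{I}_{N/K}/\mathcal{I}_K\simeq(\mathcal{I}_{L/F}/\mathcal{I}_F)\times\ker(\overline{N}_{N/L}). \]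
   Context: For a number field $E$, $\mathcal{I}_E$ is its group of fractional ideals; ideals of subfields are identified with their extensions. For an extension $E/E_0$ of degree $p$, $\mathcal{I}_{E/E_0}:=\{\mathfrak{A}\in\mathcal{I}_E\mid \mathfrak{A}^p\in\mathcal{I}_{E_0}\}$ (ambiguous ideals); $\mathcal{I}_{E/E_0}/\mathcal{I}_{E_0}$ is an elementary abelian $p$-group (the space of primitive ambiguous ideals).
   Formalization: The degrees [L:F]=p and [K:F]=q are assumed, since they do not follow from the rest: for N/Q with group S4 and K, L fixed by <(12)>, <(234)> one has p=2, q=3, N=LK, F=Q but [L:F]=8, so I_{L/F} is undefined. *)

theory Defs
  imports
    "HOL-Algebra.Algebra"
    "HOL-Algebra.Algebraic_Closure_Type"
    "HOL-Number_Theory.Residues"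
    "Jordan_Normal_Form.Determinant"
    "Jordan_Normal_Form.Missing_VectorSpace"
begin

section \<open>Number fields\<close>

text \<open>All number fields are subfields of one ambient field of characteristic 0, given by a type
  (for instance the complex numbers), so that intersections and composites make sense.\<close>

abbreviation ambient :: "'a::field_char_0 ring"
  where "ambient \<equiv> ring_of_type_algebra"

definition number_field :: "'a::field_char_0 set \<Rightarrow> bool"
  where "number_field E \<longleftrightarrow> subfield E ambient \<and> ring.finite_dimension ambient \<rat> E"

definition has_degree :: "'a::field_char_0 set \<Rightarrow> 'a set \<Rightarrow> nat \<Rightarrow> bool"
  where "has_degree E E0 n \<longleftrightarrow> E0 \<subseteq> E \<and> ring.dimension ambient n E0 E"

definition composite :: "'a::field_char_0 set \<Rightarrow> 'a set \<Rightarrow> 'a set"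
  where "composite L K = generate_field ambient (L \<union> K)"

definition ring_of_integers :: "'a::field_char_0 set \<Rightarrow> 'a set"
  where "ring_of_integers E = {x \<in> E. algebraic_int x}"

text \<open>The norm of \<open>x\<close> is the determinant of multiplication by \<open>x\<close> on the \<open>E0\<close>-vector space \<open>E\<close>,
  computed in any \<open>E0\<close>-basis \<open>bs\<close> of \<open>E\<close> (\<open>A\<close> has the coordinates of \<open>x * bs ! i\<close> as row \<open>i\<close>).\<close>

definition field_norm :: "'a::field_char_0 set \<Rightarrow> 'a set \<Rightarrow> 'a \<Rightarrow> 'a"
  where "field_norm E E0 x =
    (THE d. \<exists>bs A.
       ring.independent ambient E0 bs \<and> ring.Span ambient E0 bs = E \<and>
       A \<in> carrier_mat (length bs) (length bs) \<and> elements_mat A \<subseteq> E0 \<and>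
       (\<forall>i<length bs. x * bs ! i = (\<Sum>j<length bs. A $$ (i, j) * bs ! j)) \<and>
       d = Determinant.det A)"


section \<open>Fractional ideals\<close>

definition int_submodule :: "'a::field_char_0 set \<Rightarrow> 'a set \<Rightarrow> bool"
  where "int_submodule E M \<longleftrightarrow>
    0 \<in> M \<and> (\<forall>x\<in>M. \<forall>y\<in>M. x + y \<in> M) \<and> (\<forall>a\<in>ring_of_integers E. \<forall>x\<in>M. a * x \<in> M)"

definition fractional_ideal :: "'a::field_char_0 set \<Rightarrow> 'a set \<Rightarrow> bool"
  where "fractional_ideal E A \<longleftrightarrow>
    A \<subseteq> E \<and> int_submodule E A \<and> A \<noteq> {0} \<and>
    (\<exists>d\<in>ring_of_integers E. d \<noteq> 0 \<and> (\<forall>x\<in>A. d * x \<in> ring_of_integers E))"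

definition ideal_mult :: "'a::field_char_0 set \<Rightarrow> 'a set \<Rightarrow> 'a set \<Rightarrow> 'a set"
  where "ideal_mult E A B = int_submodule E hull {a * b | a b. a \<in> A \<and> b \<in> B}"

definition ideal_group :: "'a::field_char_0 set \<Rightarrow> 'a set monoid"
  where "ideal_group E =
    \<lparr>carrier = {A. fractional_ideal E A}, monoid.mult = ideal_mult E, one = ring_of_integers E\<rparr>"

definition ideal_extension :: "'a::field_char_0 set \<Rightarrow> 'a set \<Rightarrow> 'a set"
  where "ideal_extension E A = int_submodule E hull A"

text \<open>The copy of the ideal group of \<open>E0\<close> inside the ideal group of \<open>E\<close>; this is how ideals
  of a subfield are identified with their extensions.\<close>

definition extended_ideals :: "'a::field_char_0 set \<Rightarrow> 'a set \<Rightarrow> 'a set set"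
  where "extended_ideals E E0 = ideal_extension E ` carrier (ideal_group E0)"

definition relative_norm :: "'a::field_char_0 set \<Rightarrow> 'a set \<Rightarrow> 'a set \<Rightarrow> 'a set"
  where "relative_norm E E0 A = int_submodule E0 hull (field_norm E E0 ` A)"


section \<open>Ambiguous ideals\<close>

text \<open>Here \<open>p\<close> is meant to be the degree of \<open>E\<close> over \<open>E0\<close>.\<close>

definition ambiguous_group :: "nat \<Rightarrow> 'a::field_char_0 set \<Rightarrow> 'a set \<Rightarrow> 'a set monoid"
  where "ambiguous_group p E E0 =
    (ideal_group E)
      \<lparr>carrier := {A \<in> carrier (ideal_group E). A [^]\<^bsub>ideal_group E\<^esub> p \<in> extended_ideals E E0}\<rparr>"

definition primitive_ambiguous :: "nat \<Rightarrow> 'a::field_char_0 set \<Rightarrow> 'a set \<Rightarrow> 'a set set monoid"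
  where "primitive_ambiguous p E E0 = ambiguous_group p E E0 Mod extended_ideals E E0"

text \<open>The map on cosets induced by the relative norm of ideals from \<open>N\<close> to \<open>L\<close>. Its value on a
  coset \<open>C\<close> is the common class of the norms of the members of \<open>C\<close>.\<close>

definition induced_norm ::
  "nat \<Rightarrow> 'a::field_char_0 set \<Rightarrow> 'a set \<Rightarrow> 'a set \<Rightarrow> 'a set \<Rightarrow> 'a set set \<Rightarrow> 'a set set"
  where "induced_norm p N K L F C =
    the_elem ((\<lambda>A. extended_ideals L F #>\<^bsub>ambiguous_group p L F\<^esub> relative_norm N L A) ` C)"


section \<open>Vector spaces over the prime field\<close>

text \<open>An elementary abelian \<open>p\<close>-group, written multiplicatively, viewed as a vector space over
  \<open>residue_ring p\<close>: the residue \<open>k\<close> in \<open>{0..p - 1}\<close> acts as \<open>k\<close>-th power.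
  The ring multiplication slots of a module record are irrelevant.\<close>

definition exponent_space :: "('b, 'm) monoid_scheme \<Rightarrow> (int, 'b) module"
  where "exponent_space G =
    \<lparr>carrier = carrier G, monoid.mult = undefined, one = undefined,
     ring.zero = \<one>\<^bsub>G\<^esub>, add = monoid.mult G, module.smult = (\<lambda>k x. x [^]\<^bsub>G\<^esub> k)\<rparr>"

definition vs_isomorphic ::
  "('k, 'l) ring_scheme \<Rightarrow> ('k, 'b, 'm) module_scheme \<Rightarrow> ('k, 'c, 'n) module_scheme \<Rightarrow> bool"
  where "vs_isomorphic k V W \<longleftrightarrow>
    (\<exists>T. linear_map k V W T \<and> bij_betw T (carrier V) (carrier W))"

end

theory Submission
  imports Defs "Jordan_Normal_Form.Char_Poly"
begin

text \<open>The argument never uses prime factorization of ideals. A fractional ideal \<open>A\<close> is principal up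
  to an integer prime to any prescribed modulus \<open>m\<close>: there are \<open>z \<in> A\<close> and \<open>s \<equiv> 1 (mod m)\<close> with
  \<open>s A \<subseteq> z \<O>\<close>. Since a submodule contains \<open>x\<close> as soon as it contains multiples \<open>s x\<close> with \<open>s\<close>
  prime to every given integer, this yields invertibility of ideals, multiplicativity of the
  relative norm, \<open>N (B \<O>) = B\<^sup>q\<close> for \<open>B\<close> from \<open>L\<close>, and the compatibility of \<open>N\<^bsub>N/L\<^esub>\<close> on ideals of
  \<open>K\<close> with \<open>N\<^bsub>K/F\<^esub>\<close>. So norm and extension induce maps between the two spaces whose composite is
  the \<open>q\<close>-th power map on \<open>\<I>\<^bsub>L/F\<^esub>/\<I>\<^bsub>F\<^esub>\<close>; it is invertible because \<open>q\<close> is prime to \<open>p\<close>, which splits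
  the induced norm. Finiteness holds because every class has a representative between \<open>\<O>\<close> and
  the inverse different.\<close>

section \<open>Algebraic integers\<close>

text \<open>The extensions need not be normal and the ambient field need not contain the conjugates,
  so no Galois action on ideals is available. Conjugates are replaced by the eigenvalues, in the
  algebraic closure reached by \<open>to_ac\<close>, of the matrix of multiplication by an element:
  a polynomial equation over the base field passes from the element to every eigenvalue, and with it
  integrality passes to norms and traces. A norm ideal is generated by norms of elements, but the
  norm is not additive, so inclusions between norm ideals cannot be checked on generators of the
  ideal. Multipliers \<open>s = 1 (mod m)\<close> for every \<open>m\<close> take the place of
  localization at all primes: the condition survives products and powers, in particular the passage
  from \<open>s\<close> to its norm. Finiteness of the integers modulo \<open>m\<close> replaces the
  Chinese remainder theorem for the primes over \<open>m\<close>. The degrees of \<open>N\<close>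
  over \<open>L\<close> and of \<open>K\<close> over \<open>F\<close> being equal, an
  \<open>F\<close>-basis of \<open>K\<close> is an \<open>L\<close>-basis of \<open>N\<close>; hence
  elements of \<open>K\<close> have the same norm in both extensions.\<close>

lemma algebraic_int_iff_power:
  fixes x :: "'a::field"
  shows "algebraic_int x \<longleftrightarrow> (\<exists>m (c :: nat \<Rightarrow> int). x ^ m = (\<Sum>k<m. of_int (c k) * x ^ k))"
    (is "_ \<longleftrightarrow> ?R")
proof
  assume "algebraic_int x"
  then obtain p where p: "Polynomial.lead_coeff p = 1" "\<forall>i. poly.coeff p i \<in> \<int>" "poly p x = 0"
    by (auto simp: algebraic_int.simps)
  have "\<forall>i. \<exists>k. poly.coeff p i = of_int k" using p(2) by (blast elim: Ints_cases)
  then obtain c where c: "\<And>i. poly.coeff p i = of_int (c i)" by metis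
  let ?m = "Polynomial.degree p"
  have "0 = (\<Sum>i\<le>?m. poly.coeff p i * x ^ i)"
    using p(3) by (simp add: poly_altdef)
  also have "\<dots> = (\<Sum>i<?m. of_int (c i) * x ^ i) + x ^ ?m"
    using p(1) by (simp add: lessThan_Suc_atMost[symmetric] c)
  finally have "x ^ ?m = (\<Sum>i<?m. of_int (- c i) * x ^ i)"
    by (simp add: sum_negf eq_neg_iff_add_eq_0 add.commute)
  then show ?R by (intro exI[of _ ?m] exI[of _ "\<lambda>i. - c i"])
next
  assume ?R
  then obtain m c where mc: "x ^ m = (\<Sum>k<m. of_int (c k :: int) * x ^ k)" by blast
  define q where "q = (\<Sum>k<m. Polynomial.monom (of_int (c k) :: 'a) k)"
  define p where "p = Polynomial.monom 1 m - q"
  have cq: "poly.coeff q i = (if i < m then of_int (c i) else 0)" for i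
    by (simp add: q_def coeff_sum coeff_monom if_distrib[where f = "\<lambda>x. x = _"] sum.delta
        cong: if_cong)
  have cp: "poly.coeff p i = (if i = m then 1 else if i < m then - of_int (c i) else 0)" for i
    by (auto simp: p_def cq)
  have "Polynomial.degree p = m"
    by (rule antisym) (auto intro!: degree_le le_degree simp: cp)
  then have "Polynomial.lead_coeff p = 1" by (simp add: cp)
  moreover have "\<forall>i. poly.coeff p i \<in> \<int>" by (auto simp: cp)
  moreover have "poly p x = 0"
    by (simp add: p_def q_def poly_sum poly_monom mc)
  ultimately show "algebraic_int x" by (auto intro: algebraic_int.intros)
qed

text \<open>Lets the integrality of a trace or norm be checked on eigenvalues, which lie in the
  algebraic closure.\<close>

lemma algebraic_int_to_ac_iff [simp]: "algebraic_int (to_ac x) \<longleftrightarrow> algebraic_int x"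
proof -
  have "to_ac x ^ m = (\<Sum>k<m. of_int (c k) * to_ac x ^ k) \<longleftrightarrow>
        x ^ m = (\<Sum>k<m. of_int (c k :: int) * x ^ k)" for m c
    by (simp only: to_ac_power[symmetric] to_ac_of_int[symmetric] to_ac_mult[symmetric]
        to_ac_sum[symmetric] to_ac_eq_iff)
  then show ?thesis by (simp add: algebraic_int_iff_power)
qed

text \<open>The characteristic polynomial of the integer matrix \<open>A\<close> vanishes at \<open>x\<close>.\<close>

lemma algebraic_int_if_int_matrix:
  fixes x :: "'a::field" and A :: "nat \<Rightarrow> nat \<Rightarrow> int"
  assumes ev: "\<And>i. i < n \<Longrightarrow> x * v i = (\<Sum>j<n. of_int (A i j) * v j)"
    and nz: "i0 < n" "v i0 \<noteq> 0"
  shows "algebraic_int x"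
proof -
  define M where "M = mat n n (\<lambda>(i, j). A i j)"
  define B :: "'a mat" where "B = map_mat of_int M"
  have M: "M \<in> carrier_mat n n" and B: "B \<in> carrier_mat n n" by (auto simp: M_def B_def)
  have "B *\<^sub>v vec n v = x \<cdot>\<^sub>v vec n v"
    by (intro eq_vecI) (use B in \<open>auto simp: B_def M_def ev scalar_prod_def lessThan_atLeast0\<close>)
  moreover have "vec n v \<noteq> 0\<^sub>v n" using nz by (metis index_vec index_zero_vec(1))
  ultimately have "eigenvalue B x"
    unfolding eigenvalue_def eigenvector_def using B by (intro exI[of _ "vec n v"]) auto
  then have "poly (char_poly B) x = 0" by (simp add: eigenvalue_root_char_poly[OF B])
  moreover have cp: "char_poly B = map_poly of_int (char_poly M)"
    unfolding B_def by (rule of_int_hom.char_poly_hom[OF M])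
  moreover have "Polynomial.lead_coeff (char_poly B) = 1"
    using degree_monic_char_poly[OF B] by simp
  moreover have "\<forall>i. poly.coeff (char_poly B) i \<in> \<int>"
    unfolding cp by (simp add: coeff_map_poly)
  ultimately show ?thesis by (metis algebraic_int.intros)
qed

section \<open>Integrality through finitely generated Z-modules\<close>

lemma int_scale_left_commute: "x * (of_int k * y) = of_int k * (x * y :: 'a::field)"
  by (rule mult.left_commute)

interpretation int_mod: Modules.module "\<lambda>(k::int) (x::'a::field). of_int k * x"
  by standard (auto simp: algebra_simps)

text \<open>A subring that is finitely generated as a Z-module, recorded by generators because the
  determinant trick writes its integer matrix over them.\<close>

definition int_order :: "'a::field set \<Rightarrow> bool"
  where "int_order B \<longleftrightarrow> finite B \<and> 1 \<in> int_mod.span B \<and>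
    (\<forall>x\<in>int_mod.span B. \<forall>y\<in>int_mod.span B. x * y \<in> int_mod.span B)"

text \<open>Determinant trick: \<open>x\<close> maps each generator to an integer combination of
  generators, and some generator is nonzero because their span contains 1.\<close>

lemma int_order_algebraic_int:
  assumes B: "int_order B" and x: "x \<in> int_mod.span B"
  shows "algebraic_int x"
proof -
  have fin: "finite B" and one: "1 \<in> int_mod.span B"
    and mult: "\<And>x y. x \<in> int_mod.span B \<Longrightarrow> y \<in> int_mod.span B \<Longrightarrow> x * y \<in> int_mod.span B"
    using B by (auto simp: int_order_def)
  obtain v where v: "bij_betw v {..<card B} B"
    using ex_bij_betw_nat_finite[OF fin] by (auto simp: lessThan_atLeast0)
  have span: "\<exists>c. y = (\<Sum>j<card B. of_int (c j) * v j)" if "y \<in> int_mod.span B" for y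
  proof -
    from that obtain u where "y = (\<Sum>b\<in>B. of_int (u b) * b)"
      using int_mod.span_finite[OF fin] by auto
    also have "\<dots> = (\<Sum>j<card B. of_int (u (v j)) * v j)"
      by (rule sum.reindex_bij_betw[OF v, symmetric])
    finally show ?thesis by (intro exI[of _ "\<lambda>j. u (v j)"])
  qed
  have "v i \<in> B" if "i < card B" for i using v that by (auto simp: bij_betw_def)
  then have "\<exists>c. x * v i = (\<Sum>j<card B. of_int (c j) * v j)" if "i < card B" for i
    using span[OF mult[OF x int_mod.span_base]] that by blast
  then obtain A where A: "\<And>i. i < card B \<Longrightarrow> x * v i = (\<Sum>j<card B. of_int (A i j) * v j)"
    by metis
  obtain c where c: "1 = (\<Sum>j<card B. of_int (c j) * v j)" using span[OF one] by blast
  have "\<exists>i<card B. v i \<noteq> 0"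
  proof (rule ccontr)
    assume "\<not> ?thesis"
    then have "(\<Sum>j<card B. of_int (c j) * v j) = 0" by (intro sum.neutral) auto
    with c show False by simp
  qed
  then show ?thesis using algebraic_int_if_int_matrix[OF A] by blast
qed

text \<open>The products \<open>b * x ^ k\<close> with \<open>k < m\<close> span a ring: multiplying
  by \<open>x\<close> leaves the family only at \<open>k = m - 1\<close>, where the equation for
  \<open>x ^ m\<close> leads back. Coefficients from the span of \<open>B\<close>, rather than
  integers, make integrality transitive.\<close>

lemma int_order_adjoin:
  fixes x :: "'a::field"
  assumes B: "int_order B" and x: "x ^ m = (\<Sum>k<m. c k * x ^ k)"
    and c: "\<And>k. k < m \<Longrightarrow> c k \<in> int_mod.span B"
  shows "\<exists>B'. int_order B' \<and> int_mod.span B \<subseteq> int_mod.span B' \<and> x \<in> int_mod.span B'"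
proof -
  have fin: "finite B" and one: "1 \<in> int_mod.span B"
    and mult: "\<And>x y. x \<in> int_mod.span B \<Longrightarrow> y \<in> int_mod.span B \<Longrightarrow> x * y \<in> int_mod.span B"
    using B by (auto simp: int_order_def)
  have m: "m > 0" using x by (cases m) auto
  define G where "G = (\<lambda>(b, k). b * x ^ k) ` (B \<times> {..<m})"
  let ?S = "int_mod.span G"
  have 1: "r * x ^ k \<in> ?S" if "r \<in> int_mod.span B" "k < m" for r k
    using that(1)
  proof (induction rule: int_mod.span_induct)
    show "int_mod.subspace {r. r * x ^ k \<in> ?S}"
      by (auto simp: int_mod.subspace_def int_mod.span_zero int_mod.span_add distrib_right
          int_mod.span_scale mult.assoc)
    show "b * x ^ k \<in> ?S" if "b \<in> B" for b
      using that \<open>k < m\<close> by (intro int_mod.span_base) (auto simp: G_def)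
  qed
  have 2: "x * y \<in> ?S" if "y \<in> ?S" for y
    using that
  proof (induction rule: int_mod.span_induct)
    show "int_mod.subspace {y. x * y \<in> ?S}"
      by (auto simp: int_mod.subspace_def int_mod.span_zero int_mod.span_add distrib_left
          int_mod.span_scale int_scale_left_commute)
    fix y assume "y \<in> G"
    then obtain b k where bk: "b \<in> B" "k < m" "y = b * x ^ k" by (auto simp: G_def)
    have b: "b \<in> int_mod.span B" using bk by (intro int_mod.span_base)
    show "x * y \<in> ?S"
    proof (cases "Suc k < m")
      case True
      then show ?thesis using 1[OF b True] by (simp add: bk mult.left_commute)
    next
      case False
      then have "m = Suc k" using bk by simp
      then have "x * y = b * x ^ m" by (simp add: bk mult.left_commute)
      also have "\<dots> = (\<Sum>k<m. (b * c k) * x ^ k)"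
        unfolding x by (simp add: sum_distrib_left mult.assoc)
      also have "\<dots> \<in> ?S" by (intro int_mod.span_sum 1 mult b c) auto
      finally show ?thesis .
    qed
  qed
  have 3: "r * y \<in> ?S" if r: "r \<in> int_mod.span B" and "y \<in> ?S" for r y
    using that(2)
  proof (induction rule: int_mod.span_induct)
    show "int_mod.subspace {y. r * y \<in> ?S}"
      by (auto simp: int_mod.subspace_def int_mod.span_zero int_mod.span_add distrib_left
          int_mod.span_scale int_scale_left_commute)
    fix y assume "y \<in> G"
    then obtain b k where bk: "b \<in> B" "k < m" "y = b * x ^ k" by (auto simp: G_def)
    then show "r * y \<in> ?S"
      using 1[OF mult[OF r int_mod.span_base], of b k] by (simp add: mult.assoc)
  qed
  have 4: "x ^ k * y \<in> ?S" if "y \<in> ?S" for y k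
    using that 2 by (induction k) (auto simp: mult.assoc)
  have 5: "z * y \<in> ?S" if y: "y \<in> ?S" and "z \<in> ?S" for y z
    using that(2)
  proof (induction rule: int_mod.span_induct)
    show "int_mod.subspace {z. z * y \<in> ?S}"
      by (auto simp: int_mod.subspace_def int_mod.span_zero int_mod.span_add distrib_right
          int_mod.span_scale mult.assoc)
    fix z assume "z \<in> G"
    then obtain b k where bk: "b \<in> B" "k < m" "z = b * x ^ k" by (auto simp: G_def)
    then show "z * y \<in> ?S" using 3[OF int_mod.span_base 4[OF y]] by (simp add: mult.assoc)
  qed
  have 6: "int_mod.span B \<subseteq> ?S" using 1[of _ 0] m by auto
  have "x \<in> ?S" using 2[of 1] 6 one by auto
  moreover have "int_order G"
    unfolding int_order_def using 5 6 one fin by (auto simp: G_def)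
  ultimately show ?thesis using 6 by blast
qed

lemma int_order_one: "int_order {1 :: 'a::field}"
proof -
  have "int_mod.span {1 :: 'a} = \<int>"
    using int_mod.span_finite[of "{1 :: 'a}"] by (auto simp: Ints_def)
  then show ?thesis by (auto simp: int_order_def)
qed

lemma algebraic_ints_in_int_order:
  fixes C :: "'a::field set"
  assumes "finite C" "\<forall>x\<in>C. algebraic_int x"
  shows "\<exists>B. int_order B \<and> C \<subseteq> int_mod.span B"
  using assms
proof (induction C rule: finite_induct)
  case empty
  then show ?case using int_order_one by blast
next
  case (insert x C)
  then obtain B where B: "int_order B" "C \<subseteq> int_mod.span B" by auto
  from insert.prems obtain m c where "x ^ m = (\<Sum>k<m. of_int (c k :: int) * x ^ k)"
    by (auto simp: algebraic_int_iff_power)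
  moreover have "of_int k \<in> int_mod.span B" for k
    using int_mod.span_scale[of 1 B k] B by (simp add: int_order_def)
  ultimately obtain B' where "int_order B'" "int_mod.span B \<subseteq> int_mod.span B'" "x \<in> int_mod.span B'"
    using int_order_adjoin[OF B(1), of x m "\<lambda>k. of_int (c k)"] by blast
  then show ?case using B by blast
qed

lemma algebraic_int_if_integral:
  fixes x :: "'a::field"
  assumes x: "x ^ m = (\<Sum>k<m. c k * x ^ k)" and c: "\<And>k. k < m \<Longrightarrow> algebraic_int (c k)"
  shows "algebraic_int x"
proof -
  obtain B where "int_order B" "c ` {..<m} \<subseteq> int_mod.span B"
    using algebraic_ints_in_int_order[of "c ` {..<m}"] c by auto
  then show ?thesis using int_order_adjoin[OF _ x] int_order_algebraic_int by blast
qed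

lemma
  fixes x y :: "'a::field"
  assumes "algebraic_int x" "algebraic_int y"
  shows algebraic_int_add: "algebraic_int (x + y)"
    and algebraic_int_mult: "algebraic_int (x * y)"
proof -
  obtain B where B: "int_order B" "{x, y} \<subseteq> int_mod.span B"
    using algebraic_ints_in_int_order[of "{x, y}"] assms by auto
  then have "x + y \<in> int_mod.span B" "x * y \<in> int_mod.span B"
    by (auto simp: int_order_def int_mod.span_add)
  then show "algebraic_int (x + y)" "algebraic_int (x * y)"
    using int_order_algebraic_int[OF B(1)] by auto
qed

lemma algebraic_int_of_int' [simp]: "algebraic_int (of_int k :: 'a::field)"
  by (simp add: int_imp_algebraic_int)

lemma algebraic_int_uminus: "algebraic_int x \<Longrightarrow> algebraic_int (- x :: 'a::field)"
proof -
  assume "algebraic_int x"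
  then have "algebraic_int (of_int (- 1) * x)" by (rule algebraic_int_mult[OF algebraic_int_of_int'])
  then show ?thesis by simp
qed

lemma algebraic_int_sub:
  "algebraic_int x \<Longrightarrow> algebraic_int y \<Longrightarrow> algebraic_int (x - y :: 'a::field)"
  unfolding diff_conv_add_uminus by (intro algebraic_int_add algebraic_int_uminus)

lemma algebraic_int_pow: "algebraic_int x \<Longrightarrow> algebraic_int (x ^ n :: 'a::field)"
  by (induction n) (simp_all add: algebraic_int_mult)

lemma algebraic_int_sum:
  "(\<And>i. i \<in> I \<Longrightarrow> algebraic_int (f i)) \<Longrightarrow> algebraic_int (\<Sum>i\<in>I. f i :: 'a::field)"
  by (induction I rule: infinite_finite_induct) (simp_all add: algebraic_int_add)

lemma algebraic_int_prod_list:
  "(\<And>x. x \<in> set xs \<Longrightarrow> algebraic_int x) \<Longrightarrow> algebraic_int (prod_list xs :: 'a::field)"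
  by (induction xs) (simp_all add: algebraic_int_mult)

lemma algebraic_int_root':
  assumes "algebraic_int (x ^ n :: 'a::field)" "n > 0"
  shows "algebraic_int x"
proof (rule algebraic_int_if_integral[where m = n and c = "\<lambda>k. if k = 0 then x ^ n else 0"])
  show "x ^ n = (\<Sum>k<n. (if k = 0 then x ^ n else 0) * x ^ k)"
    using assms(2) by (simp add: if_distrib[where f = "\<lambda>y. y * _"] sum.delta cong: if_cong)
qed (use assms in auto)

text \<open>Multiplying the equation by \<open>u ^ (m - 1)\<close> makes it monic in
  \<open>u * x\<close>, with coefficients \<open>c k * u ^ (m - 1 - k)\<close>. For
  \<open>m = 0\<close> the equation reads \<open>u = 0\<close>.\<close>

lemma algebraic_int_leading_coeff_times:
  fixes x :: "'a::field"
  assumes eq: "u * x ^ m = (\<Sum>k<m. c k * x ^ k)"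
    and u: "algebraic_int u" and c: "\<And>k. k < m \<Longrightarrow> algebraic_int (c k)"
  shows "algebraic_int (u * x)"
proof (cases m)
  case 0
  then show ?thesis using eq by simp
next
  case (Suc l)
  show ?thesis
  proof (rule algebraic_int_if_integral)
    have "(u * x) ^ m = u ^ l * (u * x ^ m)"
      by (simp add: Suc power_mult_distrib)
    also have "\<dots> = (\<Sum>k<m. u ^ l * (c k * x ^ k))"
      unfolding eq by (simp add: sum_distrib_left)
    also have "\<dots> = (\<Sum>k<m. (c k * u ^ (l - k)) * (u * x) ^ k)"
    proof (rule sum.cong[OF refl])
      fix k assume "k \<in> {..<m}"
      then have "u ^ l = u ^ (l - k) * u ^ k" by (simp add: Suc power_add[symmetric])
      then show "u ^ l * (c k * x ^ k) = (c k * u ^ (l - k)) * (u * x) ^ k"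
        by (simp add: power_mult_distrib)
    qed
    finally show "(u * x) ^ m = (\<Sum>k<m. (c k * u ^ (l - k)) * (u * x) ^ k)" .
  qed (auto intro!: algebraic_int_mult algebraic_int_pow u c)
qed

text \<open>The coefficients of \<open>f / (X - x)\<close>, for a primitive integer polynomial \<open>f\<close> with root \<open>x\<close>,
  generate an ideal that is inverse to \<open>(1, x)\<close>.\<close>

lemma coprime_integral_multiplier:
  fixes x :: "'a::field_char_0"
  assumes S: "\<And>a b. a \<in> S \<Longrightarrow> b \<in> S \<Longrightarrow> a + b \<in> S" "\<And>a b. a \<in> S \<Longrightarrow> b \<in> S \<Longrightarrow> a * b \<in> S"
    "\<And>k. of_int k \<in> S" "x \<in> S" and x: "algebraic x"
  shows "\<exists>b\<in>S. \<exists>c\<in>S. algebraic_int b \<and> algebraic_int (b * x) \<and>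
    algebraic_int c \<and> algebraic_int (c * x) \<and> b + c * x = 1"
proof -
  obtain f :: "int poly" where f: "f \<noteq> 0" "poly (map_poly of_int f) x = 0"
    using x by (erule algebraicE')
  define p where "p = primitive_part f"
  have cont: "content p = 1" using f(1) by (simp add: p_def)
  have "f = Polynomial.smult (content f) p" by (simp add: p_def)
  then have "map_poly of_int f = Polynomial.smult (of_int (content f) :: 'a) (map_poly of_int p)"
    by (metis of_int_hom.map_poly_hom_smult)
  then have root: "poly (map_poly of_int p) x = 0" using f by auto
  define n where "n = Polynomial.degree p"
  define a where "a j = (of_int (poly.coeff p j) :: 'a)" for j
  have sum0: "(\<Sum>j\<le>n. a j * x ^ j) = 0"
    using root by (simp add: poly_altdef n_def a_def coeff_map_poly)
  \<comment> \<open>\<open>Q k\<close> is the coefficient of \<open>X ^ k\<close> in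
    \<open>p / (X - x)\<close>; in particular \<open>Q n = 0\<close>, where the descent in
    \<open>int\<close> starts.\<close>
  define Q where "Q k = (\<Sum>j\<in>{k<..n}. a j * x ^ (j - Suc k))" for k
  have pw: "y ^ i \<in> S" if "y \<in> S" for y i
    using that S(2) S(3)[of 1] by (induction i) auto
  have sm: "(\<Sum>i\<in>I. g i) \<in> S" if "\<And>i. i \<in> I \<Longrightarrow> g i \<in> S" for g :: "nat \<Rightarrow> 'a" and I
    using that S(1) S(3)[of 0] by (induction I rule: infinite_finite_induct) auto
  have QS: "Q k \<in> S" for k
    unfolding Q_def a_def by (intro sm S pw)
  have rec: "Q k = a (Suc k) + x * Q (Suc k)" if "k < n" for k
  proof -
    have "{k<..n} = insert (Suc k) {Suc k<..n}" using that by auto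
    then have "Q k = a (Suc k) + (\<Sum>j\<in>{Suc k<..n}. a j * x ^ (j - Suc k))"
      by (simp add: Q_def)
    also have "(\<Sum>j\<in>{Suc k<..n}. a j * x ^ (j - Suc k)) = x * Q (Suc k)"
      unfolding Q_def sum_distrib_left
    proof (rule sum.cong[OF refl])
      fix j assume "j \<in> {Suc k<..n}"
      then have "j - Suc k = Suc (j - Suc (Suc k))" by auto
      then show "a j * x ^ (j - Suc k) = x * (a j * x ^ (j - Suc (Suc k)))" by simp
    qed
    finally show ?thesis .
  qed
  \<comment> \<open>The full sum vanishes at the root, so \<open>x\<close> satisfies a relation of
    degree \<open>k + 1\<close> with leading coefficient \<open>Q k\<close> and integers as the
    other coefficients. Hence \<open>Q k * x\<close> is integral as soon as \<open>Q k\<close>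
    is.\<close>
  have low: "Q k * x ^ Suc k = - (\<Sum>j\<le>k. a j * x ^ j)" if "k \<le> n" for k
  proof -
    have "Q k * x ^ Suc k = (\<Sum>j\<in>{k<..n}. a j * x ^ j)"
      unfolding Q_def sum_distrib_right
    proof (rule sum.cong[OF refl])
      fix j assume "j \<in> {k<..n}"
      then have "x ^ j = x ^ (j - Suc k) * x ^ Suc k"
        by (subst power_add[symmetric]) auto
      then show "a j * x ^ (j - Suc k) * x ^ Suc k = a j * x ^ j" by simp
    qed
    also have "(\<Sum>j\<le>k. a j * x ^ j) + (\<Sum>j\<in>{k<..n}. a j * x ^ j) = (\<Sum>j\<le>n. a j * x ^ j)"
      using that by (subst sum.union_disjoint[symmetric]) (auto intro!: sum.cong)
    then have "(\<Sum>j\<in>{k<..n}. a j * x ^ j) = - (\<Sum>j\<le>k. a j * x ^ j)"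
      using sum0 by (simp add: eq_neg_iff_add_eq_0 add.commute)
    finally show ?thesis .
  qed
  have step: "algebraic_int (Q k * x)" if "k \<le> n" "algebraic_int (Q k)" for k
  proof (rule algebraic_int_leading_coeff_times)
    show "Q k * x ^ Suc k = (\<Sum>j<Suc k. (- a j) * x ^ j)"
      using low[OF that(1)] by (simp only: lessThan_Suc_atMost sum_negf mult_minus_left)
  qed (use that in \<open>auto simp: a_def\<close>)
  have int: "algebraic_int (Q k)" if "k \<le> n" for k
    using that
  proof (induction k rule: inc_induct)
    case base
    then show ?case by (simp add: Q_def)
  next
    case (step k)
    then show ?case
      using rec[of k] \<open>\<And>k. k \<le> n \<Longrightarrow> algebraic_int (Q k) \<Longrightarrow> algebraic_int (Q k * x)\<close>[of "Suc k"]
      by (auto simp: a_def mult.commute[of x] intro: algebraic_int_add)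
  qed
  define T where "T = {b \<in> S. algebraic_int b \<and> algebraic_int (b * x)}"
  have T_add: "b + c \<in> T" if "b \<in> T" "c \<in> T" for b c
    using that by (auto simp: T_def distrib_right intro: algebraic_int_add S)
  have T_scale: "of_int e * b \<in> T" if "b \<in> T" for b e
    using that by (auto simp: T_def mult.assoc intro: algebraic_int_mult S)
  have T_uminus: "- b \<in> T" if "b \<in> T" for b using T_scale[OF that, of "- 1"] by simp
  have T_0: "0 \<in> T" using S(3)[of 0] by (simp add: T_def)
  have T_Q: "Q k \<in> T" if "k \<le> n" for k using QS int[OF that] step[OF that] by (simp add: T_def)
  \<comment> \<open>\<open>J\<close> is an ideal of the integers. It contains every coefficient of
    \<open>p\<close>, as \<open>Q (j - 1) - Q j * x\<close> with the first term absent for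
    \<open>j = 0\<close>, and hence the content 1.\<close>
  define J where "J = {d::int. \<exists>b\<in>T. \<exists>c\<in>T. b + c * x = of_int d}"
  have J_add: "d + e \<in> J" if de: "d \<in> J" "e \<in> J" for d e
  proof -
    from de obtain b c b' c' where *: "b \<in> T" "c \<in> T" "b + c * x = of_int d"
      "b' \<in> T" "c' \<in> T" "b' + c' * x = of_int e" unfolding J_def by blast
    have "(b + b') + (c + c') * x = (b + c * x) + (b' + c' * x)" by (simp add: algebra_simps)
    also have "\<dots> = of_int (d + e)" using * by simp
    finally show ?thesis unfolding J_def using T_add * by blast
  qed
  have J_mult: "e * d \<in> J" if "d \<in> J" for d e
  proof -
    from that obtain b c where *: "b \<in> T" "c \<in> T" "b + c * x = of_int d" unfolding J_def by blast
    have "of_int e * b + (of_int e * c) * x = of_int e * (b + c * x)" by (simp add: algebra_simps)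
    also have "\<dots> = of_int (e * d)" using * by simp
    finally show ?thesis unfolding J_def using T_scale * by blast
  qed
  have J_0: "0 \<in> J" unfolding J_def using T_0 by force
  have coeff_J: "poly.coeff p j \<in> J" for j
  proof (cases "j \<le> n")
    case False
    then show ?thesis using J_0 by (simp add: n_def coeff_eq_0)
  next
    case True
    have "\<exists>b\<in>T. \<exists>c\<in>T. b + c * x = a j"
    proof (cases j)
      case 0
      have "0 + (- Q 0) * x = a 0" using low[of 0] by simp
      then show ?thesis unfolding 0 using T_0 T_uminus[OF T_Q[of 0]] by blast
    next
      case (Suc k)
      then have "Q k + (- Q j) * x = a j" using rec[of k] True by simp
      then show ?thesis using T_Q[of k] T_uminus[OF T_Q[OF True]] True Suc by force
    qed
    then show ?thesis by (simp add: J_def a_def)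
  qed
  have J_gcd: "gcd d e \<in> J" if "d \<in> J" "e \<in> J" for d e
    using J_add[OF J_mult[OF that(1)] J_mult[OF that(2)]] bezout_int[of d e] by metis
  have "Gcd (set xs) \<in> J" if "set xs \<subseteq> J" for xs
    using that J_gcd J_0 by (induction xs) auto
  moreover have "set (coeffs p) \<subseteq> J"
    using coeff_J by (auto simp: coeffs_def)
  moreover have "Gcd (set (coeffs p)) = content p"
    by (simp add: content_def Gcd_fin_eq_Gcd)
  ultimately have "content p \<in> J" by metis
  then obtain b c where "b \<in> T" "c \<in> T" "b + c * x = 1" unfolding cont J_def by auto
  then show ?thesis by (auto simp: T_def)
qed

section \<open>Number fields and bases\<close>

interpretation amb: cring "ring_of_type_algebra :: 'a::field_char_0 ring"
  by (rule cring_from_type_algebra)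

lemma ambient_simps [simp]:
  "carrier (ambient :: 'a::field_char_0 ring) = UNIV"
  "monoid.mult (ambient :: 'a ring) x y = x * y"
  "one (ambient :: 'a ring) = 1"
  "ring.zero (ambient :: 'a ring) = 0"
  "add (ambient :: 'a ring) x y = x + y"
  by (simp_all add: ring_of_type_algebra_def)

lemma ambient_a_inv [simp]: "a_inv (ambient :: 'a::field_char_0 ring) x = - x"
  using amb.r_neg[of x] by (simp add: eq_neg_iff_add_eq_0 add.commute)

lemma ambient_m_inv [simp]: "x \<noteq> 0 \<Longrightarrow> m_inv (ambient :: 'a::field_char_0 ring) x = inverse x"
  by (rule amb.comm_inv_char) auto

lemma subfield_ambient_iff:
  "subfield (E :: 'a::field_char_0 set) ambient \<longleftrightarrow> 0 \<in> E \<and> 1 \<in> E \<and> (\<forall>x\<in>E. - x \<in> E) \<and>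
    (\<forall>x\<in>E. \<forall>y\<in>E. x + y \<in> E) \<and> (\<forall>x\<in>E. \<forall>y\<in>E. x * y \<in> E) \<and> (\<forall>x\<in>E. inverse x \<in> E)"
  (is "?L \<longleftrightarrow> ?R")
proof
  assume L: ?L
  note * = subringE[OF subfieldE(1)[OF L]]
  have "inverse x \<in> E" if "x \<in> E" for x
    using amb.subfield_m_inv(1)[OF L, of x] that *(2) by (cases "x = 0") auto
  then show ?R using * by simp
next
  assume R: ?R
  show ?L
  proof (rule field.subfieldI'[OF field_from_type_algebra])
    show "subring E ambient" using R by (intro amb.subringI) auto
  qed (use R in auto)
qed

locale subfld =
  fixes E :: "'a::field_char_0 set"
  assumes subfield: "subfield E ambient"
begin

lemma zero [simp, intro]: "0 \<in> E" and one [simp, intro]: "1 \<in> E"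
  and uminus [intro]: "x \<in> E \<Longrightarrow> - x \<in> E"
  and add [intro]: "x \<in> E \<Longrightarrow> y \<in> E \<Longrightarrow> x + y \<in> E"
  and mult [intro]: "x \<in> E \<Longrightarrow> y \<in> E \<Longrightarrow> x * y \<in> E"
  and inverse [intro]: "x \<in> E \<Longrightarrow> inverse x \<in> E"
  using subfield by (auto simp: subfield_ambient_iff)

lemma diff [intro]: "x \<in> E \<Longrightarrow> y \<in> E \<Longrightarrow> x - y \<in> E"
  using add[of x "- y"] uminus[of y] by simp

lemma divide [intro]: "x \<in> E \<Longrightarrow> y \<in> E \<Longrightarrow> x / y \<in> E"
  unfolding divide_inverse by (intro mult inverse)

lemma sum [intro]: "(\<And>i. i \<in> I \<Longrightarrow> f i \<in> E) \<Longrightarrow> (\<Sum>i\<in>I. f i) \<in> E"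
  by (induction I rule: infinite_finite_induct) auto

lemma power [intro]: "x \<in> E \<Longrightarrow> x ^ n \<in> E"
  by (induction n) auto

lemma of_nat [simp, intro]: "of_nat n \<in> E"
  by (induction n) auto

lemma of_int [simp, intro]: "of_int k \<in> E"
  by (cases k rule: int_cases2) auto

lemma Rats: "\<rat> \<subseteq> E"
  by (auto elim!: Rats_cases' intro!: divide)

end

text \<open>Coordinates are indexed by list position, ready to be entered in matrices.
  \<open>is_basis_if_independent\<close> connects this form with the one in
  \<open>field_norm\<close>.\<close>

definition is_basis :: "'a::field_char_0 set \<Rightarrow> 'a set \<Rightarrow> 'a list \<Rightarrow> bool"
  where "is_basis K E bs \<longleftrightarrow> set bs \<subseteq> E \<and>
    (\<forall>x\<in>E. \<exists>c. (\<forall>j<length bs. c j \<in> K) \<and> x = (\<Sum>j<length bs. c j * bs ! j)) \<and>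
    (\<forall>c. (\<forall>j<length bs. c j \<in> K) \<longrightarrow> (\<Sum>j<length bs. c j * bs ! j) = 0 \<longrightarrow>
      (\<forall>j<length bs. c j = 0))"

lemma ambient_combine:
  "length ks = length us \<Longrightarrow> amb.combine ks us = (\<Sum>j<length us. ks ! j * us ! j)"
proof (induction ks us rule: list_induct2)
  case (Cons k ks u us)
  then show ?case by (simp add: sum.lessThan_Suc_shift del: sum.lessThan_Suc)
qed simp

lemma is_basis_if_independent:
  fixes K :: "'a::field_char_0 set"
  assumes K: "subfield K ambient" and ind: "amb.independent K bs" and span: "amb.Span K bs = E"
  shows "is_basis K E bs"
proof -
  have 1: "set bs \<subseteq> E" using amb.Span_base_incl[OF K, of bs] span by simp
  have 2: "\<exists>c. (\<forall>j<length bs. c j \<in> K) \<and> x = (\<Sum>j<length bs. c j * bs ! j)" if "x \<in> E" for x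
  proof -
    have "x \<in> amb.Span K bs" using that span by simp
    then obtain ks where "length ks = length bs" "set ks \<subseteq> K" "x = amb.combine ks bs"
      using amb.Span_eq_combine_set_length_version[OF K, of bs] by auto
    then show ?thesis by (intro exI[of _ "\<lambda>j. ks ! j"]) (auto simp: ambient_combine)
  qed
  have 3: "c j = 0" if c: "\<And>j. j < length bs \<Longrightarrow> c j \<in> K" "(\<Sum>j<length bs. c j * bs ! j) = 0"
    and j: "j < length bs" for c j
  proof -
    let ?ks = "map c [0..<length bs]"
    have "amb.combine ?ks bs = 0" using c by (simp add: ambient_combine)
    moreover have "set ?ks \<subseteq> K" using c(1) by auto
    ultimately have "set (take (length bs) ?ks) \<subseteq> {ring.zero ambient}"
      by (intro amb.independent_imp_trivial_combine[OF K ind]) simp_all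
    then have "set ?ks \<subseteq> {0}" by (simp del: set_map)
    moreover have "c j \<in> set ?ks" using j by simp
    ultimately show ?thesis by blast
  qed
  show ?thesis unfolding is_basis_def using 1 2 3 by blast
qed

lemma exists_basis:
  fixes K :: "'a::field_char_0 set"
  assumes K: "subfield K ambient" and dim: "amb.dimension n K E"
  obtains bs where "length bs = n" "is_basis K E bs"
    "amb.independent K bs" "amb.Span K bs = E"
  using amb.exists_base[OF K dim] is_basis_if_independent[OF K] by blast

locale numfld = subfld +
  assumes finite_dimension: "amb.finite_dimension \<rat> E"

lemma number_field_iff: "number_field E \<longleftrightarrow> numfld E"
  by (auto simp: number_field_def numfld_def numfld_axioms_def subfld_def)

lemma subfld_Rats: "subfld (\<rat> :: 'a::field_char_0 set)"
  unfolding subfld_def by (auto simp: subfield_ambient_iff)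

section \<open>Clearing denominators in a number field\<close>

lemma common_int_denominator:
  assumes "finite S" "S \<subseteq> \<rat>"
  shows "\<exists>d::int. d > 0 \<and> (\<forall>x\<in>S. of_int d * x \<in> (\<int> :: 'a::field_char_0 set))"
  using assms
proof (induction S rule: finite_induct)
  case empty
  then show ?case by (auto intro: exI[of _ 1])
next
  case (insert x S)
  then obtain d where d: "d > 0" "\<forall>x\<in>S. of_int d * x \<in> (\<int> :: 'a set)" by auto
  from insert.prems obtain a b where ab: "b > 0" "x = of_int a / of_int b"
    by (auto elim!: Rats_cases')
  have "of_int (d * b) * x = of_int (d * a)" using ab by simp
  moreover have "of_int (d * b) * y \<in> \<int>" if "y \<in> S" for y
  proof -
    have "of_int (d * b) * y = of_int b * (of_int d * y)" by simp
    then show ?thesis using d that by (metis Ints_mult Ints_of_int)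
  qed
  ultimately show ?case
    using d ab by (intro exI[of _ "d * b"]) (auto simp del: of_int_mult)
qed

text \<open>The determinant trick for the matrix of multiplication by \<open>x\<close> on a rational basis, with
  denominators cleared.\<close>

lemma (in numfld) int_multiple:
  assumes x: "x \<in> E"
  shows "\<exists>d::int. d > 0 \<and> algebraic_int (of_int d * x)"
proof -
  obtain n where "amb.dimension n \<rat> E" using finite_dimension by (auto simp: amb.finite_dimension_def)
  then obtain bs where len: "length bs = n" and bs: "is_basis \<rat> E bs"
    using exists_basis[OF subfld.subfield[OF subfld_Rats]] by metis
  have "x * bs ! i \<in> E" if "i < n" for i
    using bs that x nth_mem[of i bs] unfolding is_basis_def len by blast
  then have "\<exists>c. (\<forall>j<n. c j \<in> \<rat>) \<and> x * bs ! i = (\<Sum>j<n. c j * bs ! j)" if "i < n" for i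
    using bs that unfolding is_basis_def len by blast
  then obtain c where c: "\<And>i j. i < n \<Longrightarrow> j < n \<Longrightarrow> c i j \<in> \<rat>"
    "\<And>i. i < n \<Longrightarrow> x * bs ! i = (\<Sum>j<n. c i j * bs ! j)" by metis
  have "(\<lambda>(i, j). c i j) ` ({..<n} \<times> {..<n}) \<subseteq> \<rat>" using c by auto
  then obtain d :: int where d: "d > 0"
    "\<And>i j. i < n \<Longrightarrow> j < n \<Longrightarrow> of_int d * c i j \<in> (\<int> :: 'a set)"
    using common_int_denominator[of "(\<lambda>(i, j). c i j) ` ({..<n} \<times> {..<n})"] by force
  have "\<exists>k. of_int d * c i j = of_int k" if "i < n" "j < n" for i j
    using d(2)[OF that] by (auto elim: Ints_cases)
  then obtain A where A: "\<And>i j. i < n \<Longrightarrow> j < n \<Longrightarrow> of_int d * c i j = of_int (A i j)" by metis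
  have ev: "(of_int d * x) * bs ! i = (\<Sum>j<n. of_int (A i j) * bs ! j)" if "i < n" for i
  proof -
    have "(of_int d * x) * bs ! i = of_int d * (\<Sum>j<n. c i j * bs ! j)"
      using c(2)[OF that] by (simp add: mult.assoc)
    also have "\<dots> = (\<Sum>j<n. of_int (A i j) * bs ! j)"
      unfolding sum_distrib_left
      by (rule sum.cong[OF refl]) (use A[OF that, symmetric] in \<open>simp add: mult.assoc\<close>)
    finally show ?thesis .
  qed
  have "\<exists>i<n. bs ! i \<noteq> 0"
  proof (rule ccontr)
    assume no: "\<not> ?thesis"
    obtain c where "1 = (\<Sum>j<n. c j * bs ! j)"
      using bs one unfolding is_basis_def len by blast
    also have "\<dots> = 0" using no by (intro sum.neutral) auto
    finally show False by simp
  qed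
  then show ?thesis using algebraic_int_if_int_matrix[OF ev] d(1) by blast
qed

text \<open>If \<open>p\<close> annihilates \<open>d * x\<close>, then substituting
  \<open>d * X\<close> in \<open>p\<close> gives a polynomial that annihilates
  \<open>x\<close>.\<close>

lemma (in numfld) algebraic:
  assumes x: "x \<in> E"
  shows "algebraic x"
proof -
  obtain d where d: "d > 0" "algebraic_int (of_int d * x)" using int_multiple[OF x] by blast
  then have "algebraic (of_int d * x)" by blast
  then obtain p where p: "\<And>i. poly.coeff p i \<in> \<int>" "p \<noteq> 0" "poly p (of_int d * x) = 0"
    unfolding algebraic_def by blast
  have "pcompose p [:0, of_int d:] \<noteq> 0"
    using d(1) p(2) by (simp add: pcompose_eq_0_iff)
  moreover have "poly (pcompose p [:0, of_int d:]) x = 0" using p(3) by (simp add: poly_pcompose mult.commute)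
  moreover have "poly.coeff (pcompose p [:0, of_int d:]) i \<in> \<int>" for i
    using p(1) by (simp add: coeff_pcompose_linear Ints_mult Ints_power)
  ultimately show ?thesis by (metis algebraicI)
qed

section \<open>Rings of integers\<close>

notation ring_of_integers ("\<O>")

context subfld
begin

lemma O_sub: "\<O> E \<subseteq> E" by (auto simp: ring_of_integers_def)

lemma O_zero [simp, intro]: "0 \<in> \<O> E" and O_one [simp, intro]: "1 \<in> \<O> E"
  and O_of_int [simp, intro]: "of_int k \<in> \<O> E"
  by (auto simp: ring_of_integers_def)

lemma O_add [intro]: "x \<in> \<O> E \<Longrightarrow> y \<in> \<O> E \<Longrightarrow> x + y \<in> \<O> E"
  by (auto simp: ring_of_integers_def algebraic_int_add)

lemma O_uminus [intro]: "x \<in> \<O> E \<Longrightarrow> - x \<in> \<O> E"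
  by (auto simp: ring_of_integers_def algebraic_int_uminus)

lemma O_diff [intro]: "x \<in> \<O> E \<Longrightarrow> y \<in> \<O> E \<Longrightarrow> x - y \<in> \<O> E"
  by (auto simp: ring_of_integers_def algebraic_int_sub)

lemma O_mult [intro]: "x \<in> \<O> E \<Longrightarrow> y \<in> \<O> E \<Longrightarrow> x * y \<in> \<O> E"
  by (auto simp: ring_of_integers_def algebraic_int_mult)

lemma O_power [intro]: "x \<in> \<O> E \<Longrightarrow> x ^ n \<in> \<O> E"
  by (induction n) auto

lemma O_sum [intro]: "(\<And>i. i \<in> I \<Longrightarrow> f i \<in> \<O> E) \<Longrightarrow> (\<Sum>i\<in>I. f i) \<in> \<O> E"
  by (induction I rule: infinite_finite_induct) auto

end

lemma (in numfld) int_multiple_O: "x \<in> E \<Longrightarrow> \<exists>d::int. d > 0 \<and> of_int d * x \<in> \<O> E"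
  using int_multiple[of x] by (auto simp: ring_of_integers_def)

lemma O_Rats: "\<O> \<rat> = (\<int> :: 'a::field_char_0 set)"
  by (auto simp: ring_of_integers_def rational_algebraic_int_is_int int_imp_algebraic_int
      elim!: Ints_cases)

lemma numfld_Rats: "numfld (\<rat> :: 'a::field_char_0 set)"
  using amb.dimension_one[OF subfld.subfield[OF subfld_Rats]]
  by (auto simp: numfld_def numfld_axioms_def subfld_Rats amb.finite_dimension_def)

lemma numfld_subfield:
  assumes N: "numfld N" and L: "subfld L" and sub: "L \<subseteq> N"
  shows "numfld L"
proof -
  interpret L: subfld L by (rule L)
  have "subalgebra \<rat> L ambient"
    by (intro subalgebra.intro subalgebra_axioms.intro
        subring.axioms(1)[OF subfieldE(1)[OF L.subfield]]) (use L.Rats in auto)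
  then have "amb.finite_dimension \<rat> L"
    using amb.subalbegra_incl_imp_finite_dimension[OF subfld.subfield[OF subfld_Rats]
        numfld.finite_dimension[OF N] _ sub] by blast
  then show ?thesis by (simp add: numfld_def numfld_axioms_def L)
qed

section \<open>Multiplication matrices and independence of the norm from the basis\<close>

lemma det_in_subring:
  fixes A :: "'a::comm_ring_1 mat"
  assumes A: "A \<in> carrier_mat n n" and el: "\<And>i j. i < n \<Longrightarrow> j < n \<Longrightarrow> A $$ (i, j) \<in> R"
    and R: "0 \<in> R" "1 \<in> R" "- 1 \<in> R" "\<And>x y. x \<in> R \<Longrightarrow> y \<in> R \<Longrightarrow> x + y \<in> R"
      "\<And>x y. x \<in> R \<Longrightarrow> y \<in> R \<Longrightarrow> x * y \<in> R"
  shows "det A \<in> R"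
proof -
  have sum: "(\<Sum>i\<in>I. f i) \<in> R" if "\<And>i. i \<in> I \<Longrightarrow> f i \<in> R" for I :: "(nat \<Rightarrow> nat) set" and f
    using that R by (induction I rule: infinite_finite_induct) auto
  have prod: "(\<Prod>i\<in>I. f i) \<in> R" if "\<And>i. i \<in> I \<Longrightarrow> f i \<in> R" for I :: "nat set" and f
    using that R by (induction I rule: infinite_finite_induct) auto
  show ?thesis
    unfolding det_def'[OF A]
  proof (rule sum, rule R(5))
    fix p assume "p \<in> {p. p permutes {0..<n}}"
    then have p: "p permutes {0..<n}" by simp
    show "signof p \<in> R" using R by (simp add: sign_def)
    show "(\<Prod>i = 0..<n. A $$ (i, p i)) \<in> R"
      using permutes_in_image[OF p] by (intro prod el) auto
  qed
qed

definition mult_matrix :: "'a::field_char_0 set \<Rightarrow> 'a list \<Rightarrow> 'a \<Rightarrow> 'a mat \<Rightarrow> bool"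
  where "mult_matrix K bs x A \<longleftrightarrow> A \<in> carrier_mat (length bs) (length bs) \<and> elements_mat A \<subseteq> K \<and>
    (\<forall>i<length bs. x * bs ! i = (\<Sum>j<length bs. A $$ (i, j) * bs ! j))"

text \<open>Substituting one family of linear combinations into another multiplies the matrices; the
  changes of basis below reduce to this.\<close>

lemma mult_mat_comb:
  assumes A: "A \<in> carrier_mat m n" and B: "B \<in> carrier_mat n k" and i: "i < m"
  shows "(\<Sum>j<n. A $$ (i, j) * (\<Sum>l<k. B $$ (j, l) * v l)) =
    (\<Sum>l<k. (A * B) $$ (i, l) * (v l :: 'a::comm_ring_1))"
proof -
  have "(\<Sum>j<n. A $$ (i, j) * (\<Sum>l<k. B $$ (j, l) * v l)) =
    (\<Sum>l<k. \<Sum>j<n. A $$ (i, j) * (B $$ (j, l) * v l))"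
    by (simp add: sum_distrib_left) (rule sum.swap)
  also have "\<dots> = (\<Sum>l<k. (A * B) $$ (i, l) * v l)"
  proof (rule sum.cong[OF refl])
    fix l assume "l \<in> {..<k}"
    then have "(A * B) $$ (i, l) = (\<Sum>j<n. A $$ (i, j) * B $$ (j, l))"
      using A B i by (auto simp: scalar_prod_def lessThan_atLeast0)
    then show "(\<Sum>j<n. A $$ (i, j) * (B $$ (j, l) * v l)) = (A * B) $$ (i, l) * v l"
      by (simp add: sum_distrib_right mult.assoc)
  qed
  finally show ?thesis .
qed

lemma is_basis_unique:
  assumes K: "subfld K" and bs: "is_basis K E bs"
    and c: "\<And>j. j < length bs \<Longrightarrow> c j \<in> K" and d: "\<And>j. j < length bs \<Longrightarrow> d j \<in> K"
    and eq: "(\<Sum>j<length bs. c j * bs ! j) = (\<Sum>j<length bs. d j * bs ! j)" and j: "j < length bs"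
  shows "c j = d j"
proof -
  interpret subfld K by (rule K)
  have "(\<Sum>j<length bs. (c j - d j) * bs ! j) = 0"
    using eq by (simp add: left_diff_distrib sum_subtractf)
  moreover have "\<forall>j<length bs. c j - d j \<in> K" using c d by auto
  ultimately have "c j - d j = 0"
    using bs j unfolding is_basis_def by (elim conjE allE[of _ "\<lambda>j. c j - d j"]) blast
  then show ?thesis by simp
qed

lemma elements_mat_subset_iff:
  "A \<in> carrier_mat m n \<Longrightarrow> elements_mat A \<subseteq> K \<longleftrightarrow> (\<forall>i<m. \<forall>j<n. A $$ (i, j) \<in> K)"
  by (auto intro!: elements_matI)

lemma subfld_mat_mult:
  assumes "subfld K" "A \<in> carrier_mat m n" "B \<in> carrier_mat n k"
    "elements_mat A \<subseteq> K" "elements_mat B \<subseteq> K"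
  shows "elements_mat (A * B) \<subseteq> K"
proof -
  interpret subfld K by fact
  have "(A * B) $$ (i, l) \<in> K" if "i < m" "l < k" for i l
  proof -
    have "(A * B) $$ (i, l) = (\<Sum>j<n. A $$ (i, j) * B $$ (j, l))"
      using assms that by (auto simp: scalar_prod_def lessThan_atLeast0)
    also have "\<dots> \<in> K"
      using assms that by (intro sum mult) (auto simp: elements_mat_subset_iff)
    finally show ?thesis .
  qed
  then show ?thesis using assms(2,3) by (subst elements_mat_subset_iff[of _ m k]) auto
qed

lemma basis_mat_unique:
  assumes K: "subfld K" and bs: "is_basis K E bs"
    and A: "A \<in> carrier_mat m (length bs)" "elements_mat A \<subseteq> K"
    and B: "B \<in> carrier_mat m (length bs)" "elements_mat B \<subseteq> K"
    and eq: "\<And>i. i < m \<Longrightarrow>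
      (\<Sum>j<length bs. A $$ (i, j) * bs ! j) = (\<Sum>j<length bs. B $$ (i, j) * bs ! j)"
  shows "A = B"
proof (rule eq_matI)
  fix i j assume "i < dim_row B" "j < dim_col B"
  then have ij: "i < m" "j < length bs" using B by auto
  show "A $$ (i, j) = B $$ (i, j)"
    by (rule is_basis_unique[OF K bs _ _ eq[OF ij(1)] ij(2)])
      (use A B ij in \<open>auto simp: elements_mat_subset_iff\<close>)
qed (use A B in auto)

lemma is_basis_spanning:
  "is_basis K E bs \<Longrightarrow> \<forall>x\<in>E. \<exists>c. (\<forall>j<length bs. c j \<in> K) \<and> x = (\<Sum>j<length bs. c j * bs ! j)"
  by (simp add: is_basis_def)

lemma exists_spanning_matrix:
  assumes span: "\<forall>x\<in>E. \<exists>c. (\<forall>j<length bs. c j \<in> K) \<and> x = (\<Sum>j<length bs. c j * bs ! j)"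
    and v: "\<And>i. i < m \<Longrightarrow> v i \<in> E"
  shows "\<exists>A \<in> carrier_mat m (length bs). elements_mat A \<subseteq> K \<and>
    (\<forall>i<m. v i = (\<Sum>j<length bs. A $$ (i, j) * bs ! j))"
proof -
  have "\<exists>c. (\<forall>j<length bs. c j \<in> K) \<and> v i = (\<Sum>j<length bs. c j * bs ! j)" if "i < m" for i
    by (rule bspec[OF span v[OF that]])
  then obtain c where c: "\<And>i j. i < m \<Longrightarrow> j < length bs \<Longrightarrow> c i j \<in> K"
    "\<And>i. i < m \<Longrightarrow> v i = (\<Sum>j<length bs. c i j * bs ! j)" by metis
  let ?A = "mat m (length bs) (\<lambda>(i, j). c i j)"
  have "?A \<in> carrier_mat m (length bs)" by simp
  moreover from this have "elements_mat ?A \<subseteq> K"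
    by (subst elements_mat_subset_iff) (auto simp: c(1))
  moreover have "\<forall>i<m. v i = (\<Sum>j<length bs. ?A $$ (i, j) * bs ! j)"
    using c(2) by (auto intro!: sum.cong)
  ultimately show ?thesis by blast
qed

lemma is_basis_nth: "is_basis K E bs \<Longrightarrow> i < length bs \<Longrightarrow> bs ! i \<in> E"
  by (auto simp: is_basis_def)

text \<open>\<open>P\<close> writes the basis in terms of the spanning list and \<open>Q\<close> the
  list in terms of the basis, so \<open>P * Q = 1\<close> by uniqueness of coordinates over
  \<open>cs\<close>. With \<open>bs\<close> merely spanning, this also serves to recognize a basis
  by counting.\<close>

lemma spanning_change:
  assumes K: "subfld K" and cs: "is_basis K E cs" and len: "length cs = length bs" and bsE: "set bs \<subseteq> E"
    and span: "\<forall>x\<in>E. \<exists>c. (\<forall>j<length bs. c j \<in> K) \<and> x = (\<Sum>j<length bs. c j * bs ! j)"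
  shows "\<exists>P Q. P \<in> carrier_mat (length bs) (length bs) \<and> Q \<in> carrier_mat (length bs) (length bs) \<and>
    elements_mat P \<subseteq> K \<and> elements_mat Q \<subseteq> K \<and> P * Q = 1\<^sub>m (length bs) \<and>
    (\<forall>i<length bs. cs ! i = (\<Sum>j<length bs. P $$ (i, j) * bs ! j)) \<and>
    (\<forall>i<length bs. bs ! i = (\<Sum>j<length bs. Q $$ (i, j) * cs ! j))"
proof -
  let ?n = "length bs"
  obtain P where P: "P \<in> carrier_mat ?n ?n" "elements_mat P \<subseteq> K"
    "\<And>i. i < ?n \<Longrightarrow> cs ! i = (\<Sum>j<?n. P $$ (i, j) * bs ! j)"
    using exists_spanning_matrix[OF span, where m = ?n and v = "\<lambda>i. cs ! i"] is_basis_nth[OF cs] len by auto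
  have "bs ! i \<in> E" if "i < ?n" for i using bsE nth_mem[OF that] by blast
  then obtain Q where Q: "Q \<in> carrier_mat ?n ?n" "elements_mat Q \<subseteq> K"
    "\<And>i. i < ?n \<Longrightarrow> bs ! i = (\<Sum>j<?n. Q $$ (i, j) * cs ! j)"
    using exists_spanning_matrix[OF is_basis_spanning[OF cs], where m = ?n and v = "\<lambda>i. bs ! i"] len by auto
  interpret subfld K by (rule K)
  have "P * Q = 1\<^sub>m ?n"
  proof (rule basis_mat_unique[OF K cs])
    show "elements_mat (P * Q) \<subseteq> K" by (rule subfld_mat_mult[OF K P(1) Q(1) P(2) Q(2)])
    show "elements_mat (1\<^sub>m ?n :: 'a mat) \<subseteq> K" by (subst elements_mat_subset_iff[of _ ?n ?n]) auto
    fix i assume i: "i < ?n"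
    have "(\<Sum>l<?n. (P * Q) $$ (i, l) * cs ! l) = cs ! i"
      using mult_mat_comb[OF P(1) Q(1) i, of "\<lambda>l. cs ! l"] P(3)[OF i] Q(3)
      by (metis (no_types, lifting) lessThan_iff sum.cong)
    moreover have "(\<Sum>l<?n. 1\<^sub>m ?n $$ (i, l) * cs ! l) = cs ! i"
      using i by (simp add: if_distrib[where f = "\<lambda>y. y * _"] sum.delta cong: if_cong)
    ultimately show "(\<Sum>l<length cs. (P * Q) $$ (i, l) * cs ! l) =
      (\<Sum>l<length cs. 1\<^sub>m ?n $$ (i, l) * cs ! l)" by (simp add: len)
  qed (use P Q len in auto)
  then show ?thesis by (intro exI[of _ P] exI[of _ Q] conjI allI impI P Q)
qed

text \<open>Base change gives \<open>B * P = P * A\<close>, and \<open>det P\<close> is nonzero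
  since \<open>P * Q = 1\<close>.\<close>

lemma det_mult_matrix_unique:
  assumes K: "subfld K" and bs: "is_basis K E bs" and cs: "is_basis K E cs"
    and len: "length cs = length bs"
    and A: "mult_matrix K bs x A" and B: "mult_matrix K cs x B"
  shows "det A = det B"
proof -
  let ?n = "length bs"
  have bsE: "set bs \<subseteq> E" using bs by (simp add: is_basis_def)
  obtain P Q where P: "P \<in> carrier_mat ?n ?n" and Q: "Q \<in> carrier_mat ?n ?n" and PK: "elements_mat P \<subseteq> K"
    and PQ: "P * Q = 1\<^sub>m ?n" and "\<forall>i<?n. cs ! i = (\<Sum>j<?n. P $$ (i, j) * bs ! j)"
    using spanning_change[OF K cs len bsE is_basis_spanning[OF bs]] by (elim exE conjE)
  then have c: "\<And>i. i < ?n \<Longrightarrow> cs ! i = (\<Sum>j<?n. P $$ (i, j) * bs ! j)" by simp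
  have A': "A \<in> carrier_mat ?n ?n" "elements_mat A \<subseteq> K" and B': "B \<in> carrier_mat ?n ?n" "elements_mat B \<subseteq> K"
    using A B len by (auto simp: mult_matrix_def)
  have "B * P = P * A"
  proof (rule basis_mat_unique[OF K bs])
    show "elements_mat (B * P) \<subseteq> K" "elements_mat (P * A) \<subseteq> K"
      using subfld_mat_mult[OF K B'(1) P B'(2) PK] subfld_mat_mult[OF K P A'(1) PK A'(2)] by auto
    fix i assume i: "i < ?n"
    have "(\<Sum>l<?n. (B * P) $$ (i, l) * bs ! l) = (\<Sum>j<?n. B $$ (i, j) * cs ! j)"
      unfolding mult_mat_comb[OF B'(1) P i, symmetric] by (rule sum.cong) (simp_all add: c)
    also have "\<dots> = x * cs ! i" using B i len by (simp add: mult_matrix_def)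
    also have "\<dots> = (\<Sum>j<?n. P $$ (i, j) * (x * bs ! j))"
      by (simp add: c i sum_distrib_left mult.left_commute)
    also have "\<dots> = (\<Sum>j<?n. P $$ (i, j) * (\<Sum>l<?n. A $$ (j, l) * bs ! l))"
      using A by (intro sum.cong) (auto simp: mult_matrix_def)
    also have "\<dots> = (\<Sum>l<?n. (P * A) $$ (i, l) * bs ! l)" by (rule mult_mat_comb[OF P A'(1) i])
    finally show "(\<Sum>l<?n. (B * P) $$ (i, l) * bs ! l) = (\<Sum>l<?n. (P * A) $$ (i, l) * bs ! l)" .
  qed (use P A' B' in auto)
  then have "det B * det P = det P * det A"
    using det_mult[OF B'(1) P] det_mult[OF P A'(1)] by metis
  moreover have "det P * det Q = 1" using det_mult[OF P Q] PQ by simp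
  ultimately show ?thesis by (metis mult.commute mult_cancel_left mult_zero_left zero_neq_one)
qed

text \<open>Discharges the definite description in \<open>field_norm\<close>: admissible bases have
  the same length by dimension, so base change makes their determinants equal.\<close>

lemma field_norm_eq:
  assumes K: "subfield K ambient" and dim: "has_degree E K n"
    and bs: "is_basis K E bs" and len: "length bs = n" and A: "mult_matrix K bs x A"
    and x: "\<And>y. y \<in> E \<Longrightarrow> x * y \<in> E"
  shows "field_norm E K x = det A"
proof -
  have K': "subfld K" using K by (simp add: subfld_def)
  let ?P = "\<lambda>d bs A. amb.independent K bs \<and> amb.Span K bs = E \<and>
       A \<in> carrier_mat (length bs) (length bs) \<and> elements_mat A \<subseteq> K \<and>
       (\<forall>i<length bs. x * bs ! i = (\<Sum>j<length bs. A $$ (i, j) * bs ! j)) \<and>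
       d = det A"
  have dim': "amb.dimension n K E" using dim by (simp add: has_degree_def)
  have uniq: "d = det A" if "?P d cs B" for d cs B
  proof -
    have cs: "is_basis K E cs" using is_basis_if_independent[OF K] that by blast
    have "amb.dimension (length cs) K E" using that by (intro amb.dimensionI[OF K]) auto
    then have "length cs = length bs" using amb.dimension_is_inj[OF K dim'] len by auto
    moreover have "mult_matrix K cs x B" using that by (simp add: mult_matrix_def)
    ultimately have "det A = det B"
      by (intro det_mult_matrix_unique[OF K' bs cs _ A])
    then show ?thesis using that by simp
  qed
  \<comment> \<open>\<open>bs\<close> is known to be a basis only in coordinate form, so the
    existence witness is another basis \<open>cs\<close>, whose determinant \<open>uniq\<close>
    identifies with that of \<open>A\<close>.\<close>
  obtain cs where cs: "length cs = n" "is_basis K E cs" "amb.independent K cs" "amb.Span K cs = E"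
    by (rule exists_basis[OF K dim'])
  have "x * cs ! i \<in> E" if "i < n" for i
    using is_basis_nth[OF cs(2)] x cs(1) that by simp
  then have "\<exists>B\<in>carrier_mat n n. elements_mat B \<subseteq> K \<and>
      (\<forall>i<n. x * cs ! i = (\<Sum>j<n. B $$ (i, j) * cs ! j))"
    using exists_spanning_matrix[OF is_basis_spanning[OF cs(2)], where m = n and v = "\<lambda>i. x * cs ! i"] cs(1) by simp
  then obtain B where B: "B \<in> carrier_mat n n" "elements_mat B \<subseteq> K"
    "\<forall>i<n. x * cs ! i = (\<Sum>j<n. B $$ (i, j) * cs ! j)" by (elim bexE conjE)
  then have P: "?P (det B) cs B" using cs by simp
  then have "det B = det A" by (rule uniq)
  then have "?P (det A) cs B" using P by simp
  then have "\<exists>cs B. ?P (det A) cs B" by (intro exI)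
  then show ?thesis
    unfolding field_norm_def
  proof (rule the_equality)
    fix d assume "\<exists>cs B. ?P d cs B"
    then obtain cs B where "?P d cs B" by (elim exE)
    then show "d = det A" by (rule uniq)
  qed
qed

section \<open>Norm and trace\<close>

text \<open>The roots, listed with multiplicity, stand in for the conjugates of an element once
  \<open>A\<close> is its multiplication matrix.\<close>

lemma char_poly_to_ac_roots:
  fixes A :: "'a::field mat"
  assumes A: "A \<in> carrier_mat n n"
  obtains ls where "char_poly (map_mat to_ac A) = (\<Prod>a\<leftarrow>ls. [:- a, 1:])" "length ls = n"
    "\<And>a. a \<in> set ls \<Longrightarrow> eigenvalue (map_mat to_ac A) a"
proof -
  let ?B = "map_mat to_ac A" and ?p = "char_poly (map_mat to_ac A)"
  have B: "?B \<in> carrier_mat n n" using A by simp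
  have deg: "Polynomial.degree ?p = n" "Polynomial.lead_coeff ?p = 1"
    using degree_monic_char_poly[OF B] by auto
  then have "?p \<noteq> 0" by auto
  then obtain M where M: "size M = n" "?p = (\<Prod>a\<in>#M. [:- a, 1:])"
    using alg_closed_imp_factorization[of ?p] deg by auto
  obtain ls where ls: "mset ls = M" using ex_mset by blast
  have "?p = (\<Prod>a\<leftarrow>ls. [:- a, 1:])"
    using M(2) unfolding ls[symmetric] by (metis mset_map prod_mset_prod_list)
  moreover have "length ls = n" using M(1) by (simp flip: ls)
  moreover have "eigenvalue ?B a" if "a \<in> set ls" for a
  proof -
    have "poly (\<Prod>a\<leftarrow>ls. [:- a, 1:]) a = 0"
      using that by (induction ls) auto
    then show ?thesis using calculation(1) by (simp add: eigenvalue_root_char_poly[OF B])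
  qed
  ultimately show ?thesis by (rule that)
qed

text \<open>The derivative of the characteristic polynomial is the sum of those of the principal
  submatrices with one index deleted. By induction index \<open>i\<close> contributes
  \<open>A $$ (i, i)\<close> minus the trace; for size \<open>n + 2\<close> the sum is
  \<open>- (n + 1)\<close> times the trace, and \<open>n + 1\<close> is cancelled in characteristic
  0.\<close>

lemma coeff_char_poly_trace:
  fixes A :: "'a::field_char_0 mat"
  assumes "A \<in> carrier_mat (Suc n) (Suc n)"
  shows "poly.coeff (char_poly A) n = - (\<Sum>i<Suc n. A $$ (i, i))"
  using assms
proof (induction n arbitrary: A)
  case 0
  then have "char_poly A = [:- (A $$ (0, 0)), 1:]"
    unfolding char_poly_defs by (subst det_single) auto
  then show ?case by simp
next
  case (Suc n)
  let ?N = "Suc (Suc n)"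
  have IH: "poly.coeff (char_poly (mat_delete A i i)) n = A $$ (i, i) - (\<Sum>k<?N. A $$ (k, k))"
    if "i < ?N" for i
  proof -
    have "mat_delete A i i \<in> carrier_mat (Suc n) (Suc n)" using Suc.prems by auto
    from Suc.IH[OF this] have "poly.coeff (char_poly (mat_delete A i i)) n =
      - (\<Sum>k<Suc n. mat_delete A i i $$ (k, k))" .
    also have "(\<Sum>k<Suc n. mat_delete A i i $$ (k, k)) = (\<Sum>k\<in>{..<?N} - {i}. A $$ (k, k))"
    proof -
      have "bij_betw (insert_index i) {..<Suc n} ({..<?N} - {i})"
        unfolding bij_betw_def lessThan_atLeast0
        using insert_index_image[of i "Suc n"] insert_index_inj_on[of i "{0..<Suc n}"] that by auto
      then have "(\<Sum>k\<in>{..<?N} - {i}. A $$ (k, k)) =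
          (\<Sum>k<Suc n. A $$ (insert_index i k, insert_index i k))"
        by (rule sum.reindex_bij_betw[symmetric])
      also have "\<dots> = (\<Sum>k<Suc n. mat_delete A i i $$ (k, k))"
        using that by (intro sum.cong refl mat_delete_index[OF Suc.prems]) auto
      finally show ?thesis by simp
    qed
    also have "(\<Sum>k\<in>{..<?N} - {i}. A $$ (k, k)) = (\<Sum>k<?N. A $$ (k, k)) - A $$ (i, i)"
      using that by (simp add: sum_diff1)
    finally show ?thesis by simp
  qed
  have "of_nat (Suc n) * poly.coeff (char_poly A) (Suc n) = poly.coeff (pderiv (char_poly A)) n"
    by (simp only: coeff_pderiv)
  also have "\<dots> = (\<Sum>i<?N. poly.coeff (char_poly (mat_delete A i i)) n)"
    using pderiv_char_poly[OF Suc.prems] by (simp only: coeff_sum)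
  also have "\<dots> = (\<Sum>i<?N. A $$ (i, i) - (\<Sum>k<?N. A $$ (k, k)))"
    by (rule sum.cong) (simp_all only: IH lessThan_iff)
  also have "\<dots> = (\<Sum>i<?N. A $$ (i, i)) - of_nat ?N * (\<Sum>k<?N. A $$ (k, k))"
    by (simp only: sum_subtractf sum_constant card_lessThan)
  also have "\<dots> = of_nat (Suc n) * (- (\<Sum>k<?N. A $$ (k, k)))"
    by (simp only: of_nat_Suc) (simp add: algebra_simps)
  finally show ?case using of_nat_neq_0 by (metis mult_left_cancel)
qed

text \<open>Vieta for the two top coefficients; the induction for the second uses the first.\<close>

lemma coeff_prod_linear_factors:
  "poly.coeff (\<Prod>a\<leftarrow>ls. [:- a, 1:]) (length ls) = (1 :: 'a::comm_ring_1) \<and>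
   (\<forall>n. length ls = Suc n \<longrightarrow> poly.coeff (\<Prod>a\<leftarrow>ls. [:- a, 1:]) n = - sum_list ls)"
proof (induction ls)
  case (Cons a ls)
  let ?q = "\<Prod>a\<leftarrow>ls. [:- a, 1:]"
  have 0: "poly.coeff ?q (Suc (length ls)) = 0"
  proof -
    have "Polynomial.degree ?q \<le> length ls"
    proof (induction ls)
      case (Cons b ls)
      then show ?case
        using degree_mult_le[of "[:- b, 1:]" "\<Prod>a\<leftarrow>ls. [:- a, 1:]"] degree_pCons_le[of "- b" "[:1:]"]
        by simp
    qed simp
    then show ?thesis by (intro coeff_eq_0) simp
  qed
  have c: "poly.coeff (\<Prod>a\<leftarrow>a # ls. [:- a, 1:]) (Suc m) =
      poly.coeff ?q m - a * poly.coeff ?q (Suc m)" for m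
    by (simp add: mult_pCons_left)
  show ?case
  proof (intro conjI allI impI)
    show "poly.coeff (\<Prod>a\<leftarrow>a # ls. [:- a, 1:]) (length (a # ls)) = 1"
      using c[of "length ls"] 0 Cons by simp
    fix n assume n: "length (a # ls) = Suc n"
    show "poly.coeff (\<Prod>a\<leftarrow>a # ls. [:- a, 1:]) n = - sum_list (a # ls)"
    proof (cases n)
      case 0
      then show ?thesis using n by simp
    next
      case (Suc m)
      then show ?thesis using c[of m] n Cons by (simp add: algebra_simps)
    qed
  qed
qed simp

lemma to_ac_Ints: "x \<in> \<int> \<Longrightarrow> to_ac x \<in> \<int>"
  by (auto elim!: Ints_cases)

section \<open>Coordinates, eigenvalues and trace in a fixed basis\<close>

locale basis_ext = K: subfld K + E: subfld E for K E :: "'a::field_char_0 set" +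
  fixes bs :: "'a list"
  assumes sub: "K \<subseteq> E" and basis: "is_basis K E bs"
begin

abbreviation "n \<equiv> length bs"

definition coord :: "'a \<Rightarrow> nat \<Rightarrow> 'a"
  where "coord y = (SOME c. (\<forall>j<n. c j \<in> K) \<and> y = (\<Sum>j<n. c j * bs ! j))"

lemma
  assumes "y \<in> E"
  shows coord_in: "\<And>j. j < n \<Longrightarrow> coord y j \<in> K" and coord_sum: "y = (\<Sum>j<n. coord y j * bs ! j)"
proof -
  have "\<exists>c. (\<forall>j<n. c j \<in> K) \<and> y = (\<Sum>j<n. c j * bs ! j)"
    using basis assms unfolding is_basis_def by blast
  from someI_ex[OF this, folded coord_def]
  show "\<And>j. j < n \<Longrightarrow> coord y j \<in> K" "y = (\<Sum>j<n. coord y j * bs ! j)" by auto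
qed

lemma nth_in [simp]: "j < n \<Longrightarrow> bs ! j \<in> E"
  by (rule is_basis_nth[OF basis])

lemma comb_in: "(\<And>j. j < n \<Longrightarrow> c j \<in> K) \<Longrightarrow> (\<Sum>j<n. c j * bs ! j) \<in> E"
  using sub by (intro E.sum E.mult) auto

lemma coord_unique:
  assumes c: "\<And>j. j < n \<Longrightarrow> c j \<in> K" and y: "y = (\<Sum>j<n. c j * bs ! j)" and j: "j < n"
  shows "coord y j = c j"
proof -
  have "y \<in> E" unfolding y by (rule comb_in[OF c])
  then show ?thesis
    using is_basis_unique[OF K.subfld_axioms basis, of "coord y" c j] coord_in coord_sum c y j by metis
qed

lemma coord_add:
  assumes "x \<in> E" "y \<in> E" "j < n"
  shows "coord (x + y) j = coord x j + coord y j"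
proof (rule coord_unique[OF _ _ assms(3)])
  show "x + y = (\<Sum>j<n. (coord x j + coord y j) * bs ! j)"
    by (subst coord_sum[OF assms(1)], subst coord_sum[OF assms(2)])
      (simp add: distrib_right sum.distrib)
qed (use assms coord_in in auto)

lemma coord_mult:
  assumes "k \<in> K" "y \<in> E" "j < n"
  shows "coord (k * y) j = k * coord y j"
proof (rule coord_unique[OF _ _ assms(3)])
  show "k * y = (\<Sum>j<n. (k * coord y j) * bs ! j)"
    by (subst coord_sum[OF assms(2)]) (simp add: sum_distrib_left mult.assoc)
qed (use assms coord_in in auto)

lemma coord_zero: "j < n \<Longrightarrow> coord 0 j = 0"
  by (rule coord_unique) auto

lemma coord_nth:
  assumes "i < n" "j < n"
  shows "coord (bs ! i) j = (if j = i then 1 else 0)"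
  by (rule coord_unique[OF _ _ assms(2)])
    (use assms(1) in \<open>auto simp: if_distrib[where f = "\<lambda>y. y * _"] sum.delta cong: if_cong\<close>)

definition mmat :: "'a \<Rightarrow> 'a mat"
  where "mmat x = mat n n (\<lambda>(i, j). coord (x * bs ! i) j)"

lemma mmat_carrier [simp]: "mmat x \<in> carrier_mat n n"
  by (simp add: mmat_def)

lemma mult_matrix_mmat:
  assumes "x \<in> E"
  shows "mult_matrix K bs x (mmat x)"
  unfolding mult_matrix_def
proof (intro conjI allI impI)
  show "elements_mat (mmat x) \<subseteq> K"
    using assms by (subst elements_mat_subset_iff[OF mmat_carrier]) (auto simp: mmat_def coord_in E.mult)
  show "x * bs ! i = (\<Sum>j<n. mmat x $$ (i, j) * bs ! j)" if "i < n" for i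
    using coord_sum[of "x * bs ! i"] that assms by (simp add: mmat_def E.mult)
qed simp

text \<open>An eigenvector \<open>v\<close> of the multiplication matrix of \<open>x\<close> is the same thing as a nonzero
  \<open>K\<close>-linear map \<open>\<phi>\<close> on \<open>E\<close> with \<open>\<phi> (x * y) = \<lambda> * \<phi> y\<close>.\<close>

lemma eigenvalue_mmat_root:
  assumes x: "x \<in> E" and ev: "eigenvalue (map_mat to_ac (mmat x)) l"
    and g: "\<And>k. poly.coeff g k \<in> K" and root: "poly g x = 0"
  shows "poly (map_poly to_ac g) l = 0"
proof -
  from ev obtain v where v: "v \<in> carrier_vec n" "v \<noteq> 0\<^sub>v n"
    "map_mat to_ac (mmat x) *\<^sub>v v = l \<cdot>\<^sub>v v"
    by (auto simp: eigenvalue_def eigenvector_def mmat_def)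
  define \<phi> where "\<phi> y = (\<Sum>j<n. to_ac (coord y j) * v $ j)" for y
  have \<phi>_add: "\<phi> (y + z) = \<phi> y + \<phi> z" if "y \<in> E" "z \<in> E" for y z
    unfolding \<phi>_def sum.distrib[symmetric]
    by (rule sum.cong) (use that in \<open>auto simp: coord_add distrib_right\<close>)
  have \<phi>_mult: "\<phi> (k * y) = to_ac k * \<phi> y" if "k \<in> K" "y \<in> E" for k y
    unfolding \<phi>_def sum_distrib_left
    by (rule sum.cong) (use that in \<open>auto simp: coord_mult mult.assoc\<close>)
  have \<phi>_0: "\<phi> 0 = 0" by (simp add: \<phi>_def coord_zero)
  have \<phi>_sum: "\<phi> (\<Sum>i\<in>I. f i) = (\<Sum>i\<in>I. \<phi> (f i))" if "\<And>i. i \<in> I \<Longrightarrow> f i \<in> E" for I :: "nat set" and f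
    using that by (induction I rule: infinite_finite_induct) (auto simp: \<phi>_0 \<phi>_add E.sum)
  have \<phi>_nth: "\<phi> (bs ! i) = v $ i" if "i < n" for i
  proof -
    have "\<phi> (bs ! i) = (\<Sum>j<n. if j = i then v $ j else 0)"
      unfolding \<phi>_def by (rule sum.cong) (use that in \<open>auto simp: coord_nth\<close>)
    then show ?thesis using that by simp
  qed
  have \<phi>_x_nth: "\<phi> (x * bs ! i) = l * v $ i" if "i < n" for i
  proof -
    have "\<phi> (x * bs ! i) = (map_mat to_ac (mmat x) *\<^sub>v v) $ i"
      using that v(1) by (auto simp: \<phi>_def mmat_def scalar_prod_def lessThan_atLeast0)
    then show ?thesis using v(1,3) that by simp
  qed
  have \<phi>_x: "\<phi> (x * y) = l * \<phi> y" if y: "y \<in> E" for y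
  proof -
    have "x * y = (\<Sum>i<n. coord y i * (x * bs ! i))"
      by (subst coord_sum[OF y]) (simp add: sum_distrib_left mult.left_commute)
    also have "\<phi> \<dots> = (\<Sum>i<n. \<phi> (coord y i * (x * bs ! i)))"
      by (rule \<phi>_sum) (use y x sub coord_in in \<open>auto intro!: E.mult\<close>)
    also have "\<dots> = (\<Sum>i<n. to_ac (coord y i) * (l * \<phi> (bs ! i)))"
      by (rule sum.cong) (use y x coord_in in \<open>auto simp: \<phi>_mult \<phi>_x_nth \<phi>_nth E.mult\<close>)
    also have "\<dots> = l * (\<Sum>i<n. \<phi> (coord y i * bs ! i))"
      unfolding sum_distrib_left
      by (rule sum.cong) (use y coord_in in \<open>auto simp: \<phi>_mult mult.left_commute\<close>)
    also have "(\<Sum>i<n. \<phi> (coord y i * bs ! i)) = \<phi> (\<Sum>i<n. coord y i * bs ! i)"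
      by (rule \<phi>_sum[symmetric]) (use y sub coord_in in \<open>auto intro!: E.mult\<close>)
    also have "(\<Sum>i<n. coord y i * bs ! i) = y" using coord_sum[OF y] by simp
    finally show ?thesis .
  qed
  have \<phi>_pow: "\<phi> (x ^ k * y) = l ^ k * \<phi> y" if "y \<in> E" for k y
    using that x by (induction k) (auto simp: \<phi>_x mult.assoc E.mult E.power)
  from v(1,2) obtain i where i: "i < n" "v $ i \<noteq> 0"
    by (metis carrier_vecD eq_vecI index_zero_vec(1) index_zero_vec(2))
  let ?d = "Polynomial.degree g"
  \<comment> \<open>Apply \<open>\<phi>\<close> to \<open>g(x) * bs ! i = 0\<close>: powers of
    \<open>x\<close> become powers of \<open>l\<close>, and \<open>\<phi>\<close> takes the basis
    vector to the nonzero entry \<open>v $ i\<close>.\<close>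
  have "0 = \<phi> (poly g x * bs ! i)" by (simp add: root \<phi>_0)
  also have "poly g x * bs ! i = (\<Sum>k\<le>?d. poly.coeff g k * (x ^ k * bs ! i))"
    by (simp add: poly_altdef sum_distrib_right mult.assoc)
  also have "\<phi> \<dots> = (\<Sum>k\<le>?d. \<phi> (poly.coeff g k * (x ^ k * bs ! i)))"
    by (rule \<phi>_sum) (use g sub x i in \<open>auto intro!: E.mult E.power\<close>)
  also have "\<dots> = (\<Sum>k\<le>?d. to_ac (poly.coeff g k) * l ^ k) * v $ i"
    unfolding sum_distrib_right
    by (rule sum.cong) (use g x i in \<open>auto simp: \<phi>_mult \<phi>_pow \<phi>_nth mult.assoc E.mult E.power\<close>)
  also have "(\<Sum>k\<le>?d. to_ac (poly.coeff g k) * l ^ k) = poly (map_poly to_ac g) l"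
    by (simp add: poly_altdef degree_map_poly coeff_map_poly)
  finally show ?thesis using i by simp
qed

lemma n_pos: "n > 0"
  using coord_sum[of 1] by (cases n) auto

definition trace :: "'a \<Rightarrow> 'a"
  where "trace x = (\<Sum>i<n. coord (x * bs ! i) i)"

text \<open>A monic integer polynomial for \<open>x\<close> has coefficients in every subfield, so
  it annihilates each eigenvalue as well.\<close>

lemma eigenvalue_mmat_algebraic_int:
  assumes x: "x \<in> \<O> E" and ev: "eigenvalue (map_mat to_ac (mmat x)) l"
  shows "algebraic_int l"
proof -
  obtain g where g: "Polynomial.lead_coeff g = 1" "\<forall>i. poly.coeff g i \<in> \<int>" "poly g x = 0"
    using x by (auto simp: ring_of_integers_def algebraic_int.simps)
  have gK: "poly.coeff g k \<in> K" for k using g(2) K.of_int by (metis Ints_cases)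
  show ?thesis
  proof (rule algebraic_int.intros)
    show "poly (map_poly to_ac g) l = 0"
      by (rule eigenvalue_mmat_root[OF subsetD[OF E.O_sub x] ev gK g(3)])
    show "Polynomial.lead_coeff (map_poly to_ac g) = 1"
      using g(1) degree_map_poly[of to_ac g] by (cases "g = 0") (auto simp: coeff_map_poly)
    show "\<forall>i. poly.coeff (map_poly to_ac g) i \<in> \<int>"
      using g(2) by (auto simp: coeff_map_poly intro: to_ac_Ints)
  qed
qed

text \<open>The trace and the sum of the roots are both read off the coefficient of the
  characteristic polynomial next to the leading one.\<close>

lemma trace_eigenvalues:
  obtains ls where "to_ac (trace x) = sum_list ls"
    "\<And>l. l \<in> set ls \<Longrightarrow> eigenvalue (map_mat to_ac (mmat x)) l"
proof -
  obtain ls where ls: "char_poly (map_mat to_ac (mmat x)) = (\<Prod>a\<leftarrow>ls. [:- a, 1:])" "length ls = n"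
    "\<And>a. a \<in> set ls \<Longrightarrow> eigenvalue (map_mat to_ac (mmat x)) a"
    using char_poly_to_ac_roots[OF mmat_carrier[of x]] by blast
  obtain m where m: "n = Suc m" using n_pos by (cases n) auto
  interpret ac: comm_ring_hom "to_ac :: 'a \<Rightarrow> _" by standard auto
  have "- sum_list ls = poly.coeff (char_poly (map_mat to_ac (mmat x))) m"
    using coeff_prod_linear_factors[of ls] ls m by simp
  also have "\<dots> = to_ac (poly.coeff (char_poly (mmat x)) m)"
    by (simp add: ac.char_poly_hom[OF mmat_carrier] coeff_map_poly)
  also have "poly.coeff (char_poly (mmat x)) m = - (\<Sum>i<n. mmat x $$ (i, i))"
    using coeff_char_poly_trace[of "mmat x" m] m mmat_carrier[of x] by simp
  also have "(\<Sum>i<n. mmat x $$ (i, i)) = trace x" by (simp add: mmat_def trace_def)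
  finally have "to_ac (trace x) = sum_list ls" by simp
  then show ?thesis using that ls(3) by blast
qed

lemma trace_add: "x \<in> E \<Longrightarrow> y \<in> E \<Longrightarrow> trace (x + y) = trace x + trace y"
  by (simp add: trace_def distrib_right coord_add E.mult sum.distrib)

lemma trace_mult: "k \<in> K \<Longrightarrow> x \<in> E \<Longrightarrow> trace (k * x) = k * trace x"
  by (simp add: trace_def mult.assoc coord_mult E.mult sum_distrib_left)

lemma trace_one: "trace 1 = of_nat n"
  by (simp add: trace_def coord_nth)

lemma trace_in: "x \<in> E \<Longrightarrow> trace x \<in> K"
  unfolding trace_def by (intro K.sum coord_in) auto

lemma trace_zero: "trace 0 = 0"
  by (simp add: trace_def coord_zero)

lemma trace_sum: "(\<And>i. i \<in> I \<Longrightarrow> f i \<in> E) \<Longrightarrow> trace (\<Sum>i\<in>I. f i) = (\<Sum>i\<in>I. trace (f i))"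
  by (induction I rule: infinite_finite_induct) (auto simp: trace_zero trace_add E.sum)

lemma trace_algebraic_int:
  assumes x: "x \<in> \<O> E"
  shows "trace x \<in> \<O> K"
proof -
  obtain ls where ls: "to_ac (trace x) = sum_list ls"
    "\<And>l. l \<in> set ls \<Longrightarrow> eigenvalue (map_mat to_ac (mmat x)) l"
    using trace_eigenvalues[of x] by blast
  have "\<forall>l\<in>set ls. algebraic_int l" using eigenvalue_mmat_algebraic_int[OF x] ls(2) by blast
  then have "algebraic_int (sum_list ls)"
    by (induction ls) (auto simp: algebraic_int_add)
  then have "algebraic_int (trace x)" using ls(1) by (metis algebraic_int_to_ac_iff)
  then show ?thesis using trace_in[OF subsetD[OF E.O_sub x]] by (simp add: ring_of_integers_def)
qed

text \<open>\<open>det A\<close> is the value at \<open>0\<close> of the characteristic polynomial of \<open>- A\<close>, the matrix of \<open>- x\<close>.\<close>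

lemma det_mmat_algebraic_int:
  assumes x: "x \<in> \<O> E"
  shows "algebraic_int (det (mmat x))"
proof -
  have x': "- x \<in> \<O> E" by (rule E.O_uminus[OF x])
  have xE: "x \<in> E" by (rule subsetD[OF E.O_sub x])
  obtain ls where ls: "char_poly (map_mat to_ac (mmat (- x))) = (\<Prod>a\<leftarrow>ls. [:- a, 1:])" "length ls = n"
    "\<And>a. a \<in> set ls \<Longrightarrow> eigenvalue (map_mat to_ac (mmat (- x))) a"
    using char_poly_to_ac_roots[OF mmat_carrier[of "- x"]] by blast
  interpret ac: comm_ring_hom "to_ac :: 'a \<Rightarrow> _" by standard auto
  have neg: "coord (- (x * y)) j = - coord (x * y) j" if "y \<in> E" "j < n" for y j
    using coord_mult[of "- 1" "x * y" j] that xE by (simp add: E.mult K.uminus)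
  have "- char_matrix (mmat (- x)) 0 = mmat x"
    by (rule eq_matI) (auto simp: char_matrix_def mmat_def neg)
  then have "to_ac (det (mmat x)) = to_ac (poly (char_poly (mmat (- x))) 0)"
    by (simp add: char_poly_matrix[OF mmat_carrier])
  also have "\<dots> = poly (char_poly (map_mat to_ac (mmat (- x)))) 0"
    by (simp add: ac.char_poly_hom[OF mmat_carrier] poly_0_coeff_0 coeff_map_poly)
  also have "\<dots> = prod_list (map uminus ls)"
    unfolding ls(1) by (induction ls) auto
  finally have det: "to_ac (det (mmat x)) = prod_list (map uminus ls)" .
  have "algebraic_int l" if "l \<in> set (map uminus ls)" for l
    using that eigenvalue_mmat_algebraic_int[OF x' ls(3)] algebraic_int_uminus by auto
  then have "algebraic_int (prod_list (map uminus ls))" by (rule algebraic_int_prod_list)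
  then show ?thesis using det by (metis algebraic_int_to_ac_iff)
qed

end

section \<open>The trace form and bounded denominators\<close>

text \<open>The components of a kernel vector span a finite-dimensional space over the subfield; its
  coordinate vectors lie in the kernel as well.\<close>

lemma singular_kernel_in_subfield:
  fixes T :: "'a::field_char_0 mat"
  assumes K: "subfld K" and T: "T \<in> carrier_mat n n"
    and TK: "\<And>i j. i < n \<Longrightarrow> j < n \<Longrightarrow> T $$ (i, j) \<in> K" and det: "det T = 0"
  shows "\<exists>w. (\<forall>j<n. w j \<in> K) \<and> (\<exists>j<n. w j \<noteq> 0) \<and> (\<forall>i<n. (\<Sum>j<n. T $$ (i, j) * w j) = 0)"
proof -
  interpret K: subfld K by (rule K)
  \<comment> \<open>This kernel vector has entries in the ambient field, not yet in
    \<open>K\<close>.\<close>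
  obtain v where v: "v \<in> carrier_vec n" "v \<noteq> 0\<^sub>v n" "T *\<^sub>v v = 0\<^sub>v n"
    using det_0_iff_vec_prod_zero_field[OF T] det by blast
  let ?vs = "map (\<lambda>j. v $ j) [0..<n]"
  obtain us where us: "amb.independent K us" "amb.Span K us = amb.Span K ?vs"
    using amb.filter_base[OF K.subfield, of ?vs] by auto
  have bas: "is_basis K (amb.Span K ?vs) us" by (rule is_basis_if_independent[OF K.subfield us])
  have "v $ j \<in> amb.Span K ?vs" if "j < n" for j
  proof -
    have "set ?vs \<subseteq> amb.Span K ?vs" by (rule amb.Span_base_incl[OF K.subfield]) simp
    moreover have "v $ j \<in> set ?vs" using that by auto
    ultimately show ?thesis by blast
  qed
  then obtain W where W: "W \<in> carrier_mat n (length us)" "elements_mat W \<subseteq> K"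
    "\<And>j. j < n \<Longrightarrow> v $ j = (\<Sum>l<length us. W $$ (j, l) * us ! l)"
    using exists_spanning_matrix[OF is_basis_spanning[OF bas], where m = n and v = "\<lambda>j. v $ j"] by blast
  have WK: "W $$ (j, l) \<in> K" if "j < n" "l < length us" for j l
    using W(1,2) that by (auto simp: elements_mat_subset_iff)
  obtain j where j: "j < n" "v $ j \<noteq> 0"
    using v(1,2) by (metis carrier_vecD eq_vecI index_zero_vec(1) index_zero_vec(2))
  then obtain l where l: "l < length us" "W $$ (j, l) \<noteq> 0"
    using W(3)[OF j(1)] by (metis (no_types, lifting) lessThan_iff mult_zero_left sum.neutral)
  have "(\<Sum>j<n. T $$ (i, j) * W $$ (j, l)) = 0" if i: "i < n" for i
  proof -
    have "(\<Sum>l<length us. (T * W) $$ (i, l) * us ! l) = (\<Sum>j<n. T $$ (i, j) * v $ j)"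
      unfolding mult_mat_comb[OF T W(1) i, symmetric] by (rule sum.cong) (simp_all add: W(3))
    also have "\<dots> = (T *\<^sub>v v) $ i"
      using T v(1) i by (auto simp: scalar_prod_def lessThan_atLeast0)
    also have "\<dots> = 0" using v(3) i by simp
    finally have *: "(\<Sum>l<length us. (T * W) $$ (i, l) * us ! l) = 0" .
    have TW: "(T * W) $$ (i, l) = (\<Sum>j<n. T $$ (i, j) * W $$ (j, l))" if "l < length us" for l
      using T W(1) i that by (auto simp: scalar_prod_def lessThan_atLeast0)
    have "\<forall>l<length us. (T * W) $$ (i, l) \<in> K"
      using TW TK[OF i] WK by (auto intro!: K.sum K.mult)
    with * have "\<forall>l<length us. (T * W) $$ (i, l) = 0"
      using bas unfolding is_basis_def by (elim conjE allE[of _ "\<lambda>l. (T * W) $$ (i, l)"]) blast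
    then show ?thesis using TW l(1) by simp
  qed
  then show ?thesis using WK l j(1) by (intro exI[of _ "\<lambda>j. W $$ (j, l)"]) auto
qed

text \<open>The Gram determinant \<open>\<delta>\<close> of the trace form on an integral basis clears all denominators, by
  Cramer's rule.\<close>

lemma (in basis_ext) integral_coordinates:
  assumes numK: "numfld K" and bsO: "set bs \<subseteq> \<O> E"
  shows "\<exists>d::int. d > 0 \<and> (\<forall>x\<in>E. (\<forall>y\<in>\<O> E. trace (x * y) \<in> \<O> K) \<longrightarrow>
    (\<exists>c. (\<forall>j<n. c j \<in> \<O> K) \<and> of_int d * x = (\<Sum>j<n. c j * bs ! j)))"
proof -
  define T where "T = mat n n (\<lambda>(i, j). trace (bs ! j * bs ! i))"
  have T: "T \<in> carrier_mat n n" by (simp add: T_def)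
  have bsO': "bs ! i \<in> \<O> E" if "i < n" for i using bsO that by auto
  have TO: "T $$ (i, j) \<in> \<O> K" if "i < n" "j < n" for i j
    using that bsO' by (auto simp: T_def intro!: trace_algebraic_int E.O_mult)
  let ?d = "det T"
  have dO: "?d \<in> \<O> K"
    using TO K.O_uminus[OF K.O_one] by (intro det_in_subring[OF T]) auto
  have adj: "adj_mat T \<in> carrier_mat n n" "adj_mat T * T = ?d \<cdot>\<^sub>m 1\<^sub>m n"
    using adj_mat[OF T] by auto
  have adjO: "adj_mat T $$ (i, j) \<in> \<O> K" if ij: "i < n" "j < n" for i j
  proof -
    have "det (mat_delete T j i) \<in> \<O> K"
    proof (rule det_in_subring)
      show "mat_delete T j i \<in> carrier_mat (n - 1) (n - 1)" using T by auto
      fix k l assume kl: "k < n - 1" "l < n - 1"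
      obtain m where m: "n = Suc m" using n_pos by (cases n) auto
      show "mat_delete T j i $$ (k, l) \<in> \<O> K"
        using mat_delete_index[of T m j i k l, symmetric] T ij kl m TO by (auto simp: insert_index_def)
    qed (use K.O_uminus[OF K.O_one] in auto)
    moreover have "(- 1) ^ (j + i) \<in> \<O> K" by (intro K.O_power) (use K.O_uminus[OF K.O_one] in auto)
    ultimately show ?thesis using T ij by (auto simp: adj_mat_def cofactor_def)
  qed
  have sys: "(T *\<^sub>v vec n (coord x)) $ i = trace (x * bs ! i)" if x: "x \<in> E" and i: "i < n" for x i
  proof -
    have "trace (x * bs ! i) = trace (\<Sum>j<n. coord x j * (bs ! j * bs ! i))"
      by (subst coord_sum[OF x]) (simp add: sum_distrib_right mult.assoc)
    also have "\<dots> = (\<Sum>j<n. trace (coord x j * (bs ! j * bs ! i)))"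
      using x i coord_in sub by (intro trace_sum) (auto intro!: E.mult)
    also have "\<dots> = (\<Sum>j<n. trace (bs ! j * bs ! i) * coord x j)"
      using x i coord_in by (intro sum.cong) (auto simp: trace_mult E.mult mult.commute)
    also have "\<dots> = (T *\<^sub>v vec n (coord x)) $ i"
      using i by (auto simp: T_def scalar_prod_def lessThan_atLeast0)
    finally show ?thesis by simp
  qed
  have cramer: "?d * coord x j = (\<Sum>i<n. adj_mat T $$ (j, i) * trace (x * bs ! i))"
    if x: "x \<in> E" and j: "j < n" for x j
  proof -
    let ?v = "vec n (coord x)"
    have "adj_mat T *\<^sub>v (T *\<^sub>v ?v) = (?d \<cdot>\<^sub>m 1\<^sub>m n) *\<^sub>v ?v"
      using assoc_mult_mat_vec[OF adj(1) T, of ?v] adj(2) by simp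
    then have "(adj_mat T *\<^sub>v (T *\<^sub>v ?v)) $ j = ((?d \<cdot>\<^sub>m 1\<^sub>m n) *\<^sub>v ?v) $ j" by simp
    moreover have "(adj_mat T *\<^sub>v (T *\<^sub>v ?v)) $ j = (\<Sum>i<n. adj_mat T $$ (j, i) * trace (x * bs ! i))"
    proof -
      have "(adj_mat T *\<^sub>v (T *\<^sub>v ?v)) $ j = (\<Sum>i<n. adj_mat T $$ (j, i) * (T *\<^sub>v ?v) $ i)"
        using j adj(1) T by (simp add: scalar_prod_def lessThan_atLeast0 del: index_mult_mat_vec(1))
           (subst index_mult_mat_vec, auto simp: scalar_prod_def lessThan_atLeast0)
      then show ?thesis using sys[OF x] by simp
    qed
    moreover have "((?d \<cdot>\<^sub>m 1\<^sub>m n) *\<^sub>v ?v) $ j = ?d * coord x j"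
    proof -
      have "((?d \<cdot>\<^sub>m 1\<^sub>m n) *\<^sub>v ?v) $ j = (\<Sum>i<n. (if i = j then ?d else 0) * coord x i)"
        using j by (auto simp: scalar_prod_def lessThan_atLeast0 intro!: sum.cong)
      also have "\<dots> = ?d * coord x j" using j by (simp add: if_distrib[where f = "\<lambda>y. y * _"] cong: if_cong)
      finally show ?thesis .
    qed
    ultimately show ?thesis by simp
  qed
  \<comment> \<open>Nondegeneracy of the trace form: a kernel vector of \<open>T\<close> gives
    \<open>x \<noteq> 0\<close> with \<open>trace (x * bs ! i) = 0\<close> for all \<open>i\<close>.
    Expanding \<open>inverse x\<close> in the basis then yields \<open>trace 1 = 0\<close>, against
    \<open>trace 1 = n\<close> in characteristic 0.\<close>
  have d0: "?d \<noteq> 0"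
  proof
    assume "?d = 0"
    then obtain w where w: "\<And>j. j < n \<Longrightarrow> w j \<in> K" "\<exists>j<n. w j \<noteq> 0"
      "\<And>i. i < n \<Longrightarrow> (\<Sum>j<n. T $$ (i, j) * w j) = 0"
      using singular_kernel_in_subfield[OF K.subfld_axioms T] TO K.O_sub by blast
    define x where "x = (\<Sum>j<n. w j * bs ! j)"
    have x: "x \<in> E" unfolding x_def by (rule comb_in[OF w(1)])
    have cx: "coord x j = w j" if "j < n" for j using coord_unique[OF w(1) x_def that] .
    have "x \<noteq> 0" using w(2) cx coord_zero by metis
    have tr: "trace (x * bs ! i) = 0" if "i < n" for i
    proof -
      have "trace (x * bs ! i) = (\<Sum>j<n. T $$ (i, j) * coord x j)"
        using sys[OF x that] T that by (simp add: scalar_prod_def lessThan_atLeast0)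
      then show ?thesis using w(3)[OF that] cx by simp
    qed
    have ix: "inverse x \<in> E" using x by auto
    have "1 = (\<Sum>i<n. coord (inverse x) i * (x * bs ! i))"
      using coord_sum[OF ix] \<open>x \<noteq> 0\<close>
      by (metis (no_types, lifting) mult.left_commute right_inverse sum.cong sum_distrib_left)
    then have "trace 1 = trace (\<Sum>i<n. coord (inverse x) i * (x * bs ! i))" by simp
    also have "\<dots> = (\<Sum>i<n. trace (coord (inverse x) i * (x * bs ! i)))"
      using x coord_in[OF ix] sub by (intro trace_sum E.mult) auto
    also have "\<dots> = 0"
      using x coord_in[OF ix] tr by (intro sum.neutral) (auto simp: trace_mult E.mult)
    finally show False using n_pos by (simp add: trace_one)
  qed
  interpret nK: numfld K by (rule numK)
  have "inverse ?d \<in> K" using dO K.O_sub by auto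
  \<comment> \<open>With \<open>m / det T\<close> integral, the integer \<open>m\<close> clears
    denominators just as the determinant, an element of \<open>\<O> K\<close>, does.\<close>
  then obtain m :: int where m: "m > 0" "of_int m * inverse ?d \<in> \<O> K" using nK.int_multiple_O by blast
  show ?thesis
  proof (intro exI[of _ m] conjI ballI impI m(1))
    fix x assume x: "x \<in> E" and tr: "\<forall>y\<in>\<O> E. trace (x * y) \<in> \<O> K"
    let ?c = "\<lambda>j. of_int m * coord x j"
    have "?c j \<in> \<O> K" if "j < n" for j
    proof -
      have "?c j = (of_int m * inverse ?d) * (?d * coord x j)" using d0 by simp
      also have "\<dots> = (of_int m * inverse ?d) * (\<Sum>i<n. adj_mat T $$ (j, i) * trace (x * bs ! i))"
        by (simp only: cramer[OF x that])
      also have "\<dots> \<in> \<O> K"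
        using adjO[OF that] tr bsO' by (intro K.O_mult K.O_sum m) auto
      finally show ?thesis .
    qed
    moreover have "of_int m * x = (\<Sum>j<n. ?c j * bs ! j)"
      by (subst coord_sum[OF x]) (simp add: sum_distrib_left mult.assoc)
    ultimately show "\<exists>c. (\<forall>j<n. c j \<in> \<O> K) \<and> of_int m * x = (\<Sum>j<n. c j * bs ! j)"
      by (intro exI[of _ ?c]) auto
  qed
qed

lemma integral_basis_scale:
  assumes K: "subfld K" and E: "numfld E" and sub: "K \<subseteq> E" and bs: "is_basis K E bs"
  shows "\<exists>cs. is_basis K E cs \<and> length cs = length bs \<and> set cs \<subseteq> \<O> E"
proof -
  interpret K: subfld K by (rule K)
  interpret E: numfld E by (rule E)
  let ?n = "length bs"
  have "\<exists>d::int. d > 0 \<and> of_int d * bs ! i \<in> \<O> E" if "i < ?n" for i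
    using E.int_multiple_O is_basis_nth[OF bs that] by blast
  then obtain d :: "nat \<Rightarrow> int" where d: "\<And>i. i < ?n \<Longrightarrow> d i > 0" "\<And>i. i < ?n \<Longrightarrow> of_int (d i) * bs ! i \<in> \<O> E"
    by metis
  let ?cs = "map (\<lambda>i. of_int (d i) * bs ! i) [0..<?n]"
  have "is_basis K E ?cs"
    unfolding is_basis_def
  proof (intro conjI ballI allI impI)
    show "set ?cs \<subseteq> E" using d(2) E.O_sub by auto
    fix x assume "x \<in> E"
    then obtain c where c: "\<And>j. j < ?n \<Longrightarrow> c j \<in> K" "x = (\<Sum>j<?n. c j * bs ! j)"
      using bs unfolding is_basis_def by blast
    have "x = (\<Sum>j<?n. (c j / of_int (d j)) * (of_int (d j) * bs ! j))"
      unfolding c(2) using d(1) by (intro sum.cong) (auto simp: order_less_imp_not_eq2)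
    then show "\<exists>c. (\<forall>j<length ?cs. c j \<in> K) \<and> x = (\<Sum>j<length ?cs. c j * ?cs ! j)"
      using c(1) by (intro exI[of _ "\<lambda>j. c j / of_int (d j)"]) (auto intro!: K.divide)
  next
    fix c j assume c: "\<forall>j<length ?cs. c j \<in> K" "(\<Sum>j<length ?cs. c j * ?cs ! j) = 0" "j < length ?cs"
    have "\<forall>j<?n. c j * of_int (d j) \<in> K" using c(1) by auto
    moreover have "(\<Sum>j<?n. (c j * of_int (d j)) * bs ! j) = 0"
      using c(2) by (simp add: mult.assoc)
    ultimately have "\<forall>j<?n. c j * of_int (d j) = 0"
      using bs unfolding is_basis_def by (elim conjE allE[of _ "\<lambda>j. c j * of_int (d j)"]) blast
    then show "c j = 0" using c(3) d(1)[of j] by auto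
  qed
  moreover have "set ?cs \<subseteq> \<O> E" using d(2) by auto
  ultimately show ?thesis by (intro exI[of _ ?cs]) auto
qed

section \<open>Field norms in an extension of number fields\<close>

locale numfld_ext = K: numfld K + E: numfld E for K E :: "'a::field_char_0 set" +
  fixes deg :: nat
  assumes degree: "has_degree E K deg"
begin

lemma sub: "K \<subseteq> E" using degree by (simp add: has_degree_def)

lemma basis_extI: "is_basis K E bs \<Longrightarrow> basis_ext K E bs"
  by (simp add: basis_ext_def basis_ext_axioms_def K.subfld_axioms E.subfld_axioms sub)

lemma integral_basis:
  obtains bs where "is_basis K E bs" "length bs = deg" "set bs \<subseteq> \<O> E" "basis_ext K E bs"
proof -
  obtain bs where "length bs = deg" "is_basis K E bs"
    using exists_basis[OF K.subfield] degree by (metis has_degree_def)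
  then show ?thesis
    using integral_basis_scale[OF K.subfld_axioms E.numfld_axioms sub] basis_extI that by metis
qed

lemma norm_eq_det:
  assumes "is_basis K E bs" "length bs = deg" "mult_matrix K bs x A" "x \<in> E"
  shows "field_norm E K x = det A"
  using assms by (intro field_norm_eq[OF K.subfield degree]) auto

lemma norm_in:
  assumes "x \<in> E"
  shows "field_norm E K x \<in> K"
proof -
  obtain bs where bs: "is_basis K E bs" "length bs = deg" "basis_ext K E bs"
    using integral_basis by blast
  interpret basis_ext K E bs by (rule bs)
  have M: "mult_matrix K bs x (mmat x)" by (rule mult_matrix_mmat[OF assms])
  have "mmat x $$ (i, j) \<in> K" if "i < n" "j < n" for i j
    using M that elements_mat_subset_iff[OF mmat_carrier[of x]] by (auto simp: mult_matrix_def)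
  then have "det (mmat x) \<in> K"
    by (intro det_in_subring[OF mmat_carrier]) auto
  then show ?thesis using norm_eq_det[OF bs(1,2) M assms] by simp
qed

lemma norm_O:
  assumes "x \<in> \<O> E"
  shows "field_norm E K x \<in> \<O> K"
proof -
  obtain bs where bs: "is_basis K E bs" "length bs = deg" "basis_ext K E bs"
    using integral_basis by blast
  interpret basis_ext K E bs by (rule bs)
  have x: "x \<in> E" using assms E.O_sub by auto
  then show ?thesis
    using norm_eq_det[OF bs(1,2) mult_matrix_mmat[OF x] x] det_mmat_algebraic_int[OF assms] norm_in[OF x]
    by (simp add: ring_of_integers_def)
qed

lemma norm_mult:
  assumes x: "x \<in> E" and y: "y \<in> E"
  shows "field_norm E K (x * y) = field_norm E K x * field_norm E K y"
proof -
  obtain bs where bs: "is_basis K E bs" "length bs = deg" "basis_ext K E bs"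
    using integral_basis by blast
  interpret basis_ext K E bs by (rule bs)
  have Mx: "mult_matrix K bs x (mmat x)" and My: "mult_matrix K bs y (mmat y)"
    using mult_matrix_mmat x y by auto
  \<comment> \<open>Rows hold coordinates, so the matrices are multiplied in reversed order; the
    determinant does not see this.\<close>
  have "mult_matrix K bs (x * y) (mmat y * mmat x)"
    unfolding mult_matrix_def
  proof (intro conjI allI impI)
    show "elements_mat (mmat y * mmat x) \<subseteq> K"
      using Mx My by (intro subfld_mat_mult[OF K.subfld_axioms mmat_carrier mmat_carrier])
        (auto simp: mult_matrix_def)
    fix i assume i: "i < n"
    have "x * y * bs ! i = (\<Sum>j<n. mmat y $$ (i, j) * (x * bs ! j))"
      using My i by (simp add: mult_matrix_def sum_distrib_left mult.assoc mult.left_commute)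
    also have "\<dots> = (\<Sum>j<n. mmat y $$ (i, j) * (\<Sum>l<n. mmat x $$ (j, l) * bs ! l))"
      using Mx by (intro sum.cong) (auto simp: mult_matrix_def)
    also have "\<dots> = (\<Sum>j<n. (mmat y * mmat x) $$ (i, j) * bs ! j)"
      by (rule mult_mat_comb[OF mmat_carrier mmat_carrier i])
    finally show "x * y * bs ! i = (\<Sum>j<n. (mmat y * mmat x) $$ (i, j) * bs ! j)" .
  qed (rule mult_carrier_mat[OF mmat_carrier mmat_carrier])
  then have "field_norm E K (x * y) = det (mmat y * mmat x)"
    using x y by (intro norm_eq_det[OF bs(1,2)]) auto
  then show ?thesis
    using norm_eq_det[OF bs(1,2) Mx x] norm_eq_det[OF bs(1,2) My y]
    by (simp add: det_mult[OF mmat_carrier mmat_carrier])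
qed

lemma norm_base:
  assumes x: "x \<in> K"
  shows "field_norm E K x = x ^ deg"
proof -
  obtain bs where bs: "is_basis K E bs" "length bs = deg"
    using integral_basis by blast
  have "mult_matrix K bs x (x \<cdot>\<^sub>m 1\<^sub>m deg)"
    unfolding mult_matrix_def bs(2)
  proof (intro conjI allI impI)
    show "elements_mat (x \<cdot>\<^sub>m 1\<^sub>m deg) \<subseteq> K" using x by (subst elements_mat_subset_iff[of _ deg deg]) auto
    fix i assume i: "i < deg"
    have "(\<Sum>j<deg. (x \<cdot>\<^sub>m 1\<^sub>m deg) $$ (i, j) * bs ! j) = (\<Sum>j<deg. if j = i then x * bs ! j else 0)"
      using i by (intro sum.cong) auto
    then show "x * bs ! i = (\<Sum>j<deg. (x \<cdot>\<^sub>m 1\<^sub>m deg) $$ (i, j) * bs ! j)" using i by simp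
  qed auto
  then show ?thesis using norm_eq_det[OF bs, of x] x sub by auto
qed

lemma norm_one [simp]: "field_norm E K 1 = 1"
  using norm_base[of 1] by simp

lemma norm_nonzero:
  assumes "x \<in> E" "x \<noteq> 0"
  shows "field_norm E K x \<noteq> 0"
proof -
  have "field_norm E K x * field_norm E K (inverse x) = 1"
    using norm_mult[OF assms(1) E.inverse[OF assms(1)]] assms(2) by simp
  then show ?thesis by auto
qed

end

section \<open>Fractional ideals\<close>

lemma int_submodule_Inter: "(\<And>M. M \<in> F \<Longrightarrow> int_submodule E M) \<Longrightarrow> int_submodule E (\<Inter> F)"
  unfolding int_submodule_def by blast

lemma int_submodule_hull [simp, intro]: "int_submodule E (int_submodule E hull S)"
  by (rule hull_in) (auto intro: int_submodule_Inter)

lemma hull_induct_submodule: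
  assumes "x \<in> int_submodule E hull S" "int_submodule E M" "S \<subseteq> M"
  shows "x \<in> M"
  using hull_minimal[of S M "int_submodule E"] assms by blast

lemma
  assumes "int_submodule E M"
  shows submodule_zero: "0 \<in> M" and submodule_add: "x \<in> M \<Longrightarrow> y \<in> M \<Longrightarrow> x + y \<in> M"
    and submodule_mult: "a \<in> \<O> E \<Longrightarrow> x \<in> M \<Longrightarrow> a * x \<in> M"
  using assms by (auto simp: int_submodule_def)

section \<open>Submodules over the ring of integers and local membership\<close>

context subfld
begin

lemma submodule_diff: "int_submodule E M \<Longrightarrow> x \<in> M \<Longrightarrow> y \<in> M \<Longrightarrow> x - y \<in> M"
  using submodule_add[of E M x "- 1 * y"] submodule_mult[of E M "- 1" y] O_uminus[OF O_one] by simp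

lemma submodule_of_int: "int_submodule E M \<Longrightarrow> x \<in> M \<Longrightarrow> of_int k * x \<in> M"
  by (rule submodule_mult) auto

lemma submodule_field: "int_submodule E E"
  using O_sub by (auto simp: int_submodule_def)

lemma submodule_O: "int_submodule E (\<O> E)"
  by (auto simp: int_submodule_def)

lemma submodule_scaled: "int_submodule E M \<Longrightarrow> int_submodule E {x. z * x \<in> M}"
  by (auto simp: int_submodule_def distrib_left mult.left_commute)

lemma submodule_principal: "int_submodule E ((*) z ` \<O> E)"
  unfolding int_submodule_def
proof (intro conjI ballI)
  show "0 \<in> (*) z ` \<O> E" by (auto intro: image_eqI[of _ _ 0])
  show "x + y \<in> (*) z ` \<O> E" if "x \<in> (*) z ` \<O> E" "y \<in> (*) z ` \<O> E" for x y
    using that by (auto simp: distrib_left[symmetric])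
  show "a * x \<in> (*) z ` \<O> E" if "a \<in> \<O> E" "x \<in> (*) z ` \<O> E" for a x
    using that by (auto simp: mult.left_commute)
qed

text \<open>Take \<open>s\<close> with \<open>s * x\<close> in \<open>M\<close>, then
  \<open>t = 1 (mod s)\<close> with \<open>t * x\<close> in \<open>M\<close>; some
  \<open>t - s * k\<close> equals 1, so \<open>x\<close> itself lies in \<open>M\<close>. The
  hypothesis for all \<open>m\<close> acts like membership at every prime.\<close>

lemma submodule_member_if_local:
  assumes M: "int_submodule E M" and loc: "\<And>m::int. m > 0 \<Longrightarrow> \<exists>s. [s = 1] (mod m) \<and> of_int s * x \<in> M"
  shows "x \<in> M"
proof -
  \<comment> \<open>Modulus 2 makes \<open>s\<close> odd, hence nonzero, so that its absolute value
    is an admissible second modulus.\<close>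
  obtain s where s: "[s = 1] (mod 2)" "of_int s * x \<in> M" using loc[of 2] by auto
  then have "s \<noteq> 0" by (auto simp: cong_def)
  then obtain t where t: "[t = 1] (mod \<bar>s\<bar>)" "of_int t * x \<in> M" using loc[of "\<bar>s\<bar>"] by auto
  then have "s dvd t - 1" by (simp add: cong_iff_dvd_diff)
  then obtain k where k: "t - 1 = s * k" by (rule dvdE)
  have "t - s * k = 1" using k by linarith
  then have "x = of_int (t - s * k) * x" by simp
  also have "\<dots> = of_int t * x - of_int k * (of_int s * x)" by (simp add: algebra_simps)
  also have "\<dots> \<in> M" by (rule submodule_diff[OF M t(2) submodule_of_int[OF M s(2)]])
  finally show ?thesis .
qed

text \<open>The nontrivial inclusions between norms, products and powers of ideals come in this
  form: the bound on \<open>A\<close> is carried by a single element \<open>w\<close>, and only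
  \<open>w\<close> has to be shown to lie in \<open>M\<close>.\<close>

lemma submodule_subset_if_local:
  assumes M: "int_submodule E M" and loc: "\<And>m::int. m > 0 \<Longrightarrow>
    \<exists>s. \<exists>w\<in>M. [s = 1] (mod m) \<and> (\<forall>x\<in>A. of_int s * x \<in> (*) w ` \<O> E)"
  shows "A \<subseteq> M"
proof
  fix x assume x: "x \<in> A"
  show "x \<in> M"
  proof (rule submodule_member_if_local[OF M])
    fix m :: int assume "m > 0"
    then obtain s w where sw: "w \<in> M" "[s = 1] (mod m)" "\<forall>x\<in>A. of_int s * x \<in> (*) w ` \<O> E"
      using loc by blast
    then obtain c where "c \<in> \<O> E" "of_int s * x = c * w" using x by (auto simp: mult.commute)
    then have "of_int s * x \<in> M" using submodule_mult[OF M _ sw(1)] by simp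
    then show "\<exists>s. [s = 1] (mod m) \<and> of_int s * x \<in> M" using sw(2) by blast
  qed
qed

end

text \<open>\<open>d * \<O> E\<close> lies in a lattice spanned by a rational basis.\<close>

lemma O_mod_finite:
  assumes E: "numfld E" and m: "(m::int) > 0"
  shows "\<exists>\<kappa> :: 'a::field_char_0 \<Rightarrow> int list. finite (\<kappa> ` \<O> E) \<and>
    (\<forall>x\<in>\<O> E. \<forall>y\<in>\<O> E. \<kappa> x = \<kappa> y \<longrightarrow> (\<exists>z\<in>\<O> E. x - y = of_int m * z))"
proof -
  obtain n where "amb.dimension n \<rat> E"
    using numfld.finite_dimension[OF E] by (auto simp: amb.finite_dimension_def)
  then have deg: "has_degree E \<rat> n"
    unfolding has_degree_def by (rule conjI[OF subfld.Rats[OF numfld.axioms(1)[OF E]]])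
  interpret numfld_ext \<rat> E n
    by (rule numfld_ext.intro[OF numfld_Rats E numfld_ext_axioms.intro[OF deg]])
  obtain bs where bs: "is_basis \<rat> E bs" "set bs \<subseteq> \<O> E" "basis_ext \<rat> E bs"
    by (rule integral_basis)
  interpret basis_ext \<rat> E bs by (rule bs)
  let ?n = "length bs"
  obtain d :: int where d: "d > 0" "\<And>x. x \<in> E \<Longrightarrow> (\<forall>y\<in>\<O> E. trace (x * y) \<in> \<O> \<rat>) \<Longrightarrow>
    \<exists>c. (\<forall>j<?n. c j \<in> \<O> \<rat>) \<and> of_int d * x = (\<Sum>j<?n. c j * bs ! j)"
    using integral_coordinates[OF numfld_Rats bs(2)] by blast
  have "\<exists>a. of_int d * x = (\<Sum>j<?n. of_int (a j :: int) * bs ! j)" if "x \<in> \<O> E" for x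
  proof -
    have "x \<in> E" by (rule subsetD[OF E.O_sub that])
    moreover have "\<forall>y\<in>\<O> E. trace (x * y) \<in> \<int>"
      unfolding O_Rats[symmetric] by (intro ballI trace_algebraic_int E.O_mult that)
    ultimately have "\<exists>c. (\<forall>j<?n. c j \<in> \<int>) \<and> of_int d * x = (\<Sum>j<?n. c j * bs ! j)"
      by (rule d(2)[unfolded O_Rats])
    then obtain c where c: "\<And>j. j < ?n \<Longrightarrow> c j \<in> \<int>" "of_int d * x = (\<Sum>j<?n. c j * bs ! j)"
      by blast
    have "\<exists>k. c j = of_int k" if "j < ?n" for j using c(1)[OF that] by (auto elim: Ints_cases)
    then obtain a where "\<And>j. j < ?n \<Longrightarrow> c j = of_int (a j)" by metis
    then have "of_int d * x = (\<Sum>j<?n. of_int (a j) * bs ! j)" unfolding c(2) by simp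
    then show ?thesis by (rule exI[of _ a])
  qed
  then obtain a :: "'a \<Rightarrow> nat \<Rightarrow> int"
    where a: "\<And>x. x \<in> \<O> E \<Longrightarrow> of_int d * x = (\<Sum>j<?n. of_int (a x j) * bs ! j)" by metis
  \<comment> \<open>Residues modulo \<open>d * m\<close>, not \<open>m\<close>: the factor
    \<open>d\<close> is lost when \<open>d * (x - y)\<close> is divided by \<open>d\<close>. Equal
    values of \<open>\<kappa>\<close> force congruence modulo \<open>m\<close>; the converse is not
    claimed.\<close>
  define \<kappa> where "\<kappa> x = map (\<lambda>j. a x j mod (d * m)) [0..<?n]" for x
  have dm: "d * m > 0" using d m by simp
  have "\<kappa> ` \<O> E \<subseteq> {xs. set xs \<subseteq> {0..<d * m} \<and> length xs = ?n}"
    using dm by (auto simp: \<kappa>_def)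
  then have fin: "finite (\<kappa> ` \<O> E)" 
    by (rule finite_subset[OF _ finite_lists_length_eq[OF finite_atLeastLessThan_int]])
  have "\<exists>z\<in>\<O> E. x - y = of_int m * z" if x: "x \<in> \<O> E" and y: "y \<in> \<O> E" and eq: "\<kappa> x = \<kappa> y" for x y
  proof -
    have "d * m dvd a x j - a y j" if "j < ?n" for j
    proof -
      have "\<kappa> x ! j = \<kappa> y ! j" using eq by simp
      then have "a x j mod (d * m) = a y j mod (d * m)" using that by (simp add: \<kappa>_def)
      then show ?thesis by (simp add: mod_eq_dvd_iff)
    qed
    then obtain e where e: "\<And>j. j < ?n \<Longrightarrow> a x j - a y j = d * m * e j" unfolding dvd_def by metis
    let ?z = "\<Sum>j<?n. of_int (e j) * bs ! j"
    have "of_int d * (x - y) = (\<Sum>j<?n. of_int (a x j - a y j) * bs ! j)"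
      by (simp only: right_diff_distrib a[OF x] a[OF y] of_int_diff left_diff_distrib sum_subtractf)
    also have "\<dots> = (\<Sum>j<?n. of_int d * (of_int m * (of_int (e j) * bs ! j)))"
    proof (rule sum.cong[OF refl])
      fix j assume "j \<in> {..<?n}"
      then show "of_int (a x j - a y j) * bs ! j = of_int d * (of_int m * (of_int (e j) * bs ! j))"
        by (simp only: e lessThan_iff of_int_mult mult.assoc)
    qed
    also have "\<dots> = of_int d * (of_int m * ?z)" by (simp only: sum_distrib_left)
    finally have "x - y = of_int m * ?z" using d(1) by simp
    moreover have "?z \<in> \<O> E" using bs(2) by (intro E.O_sum E.O_mult) auto
    ultimately show ?thesis by blast
  qed
  with fin show ?thesis by blast
qed

section \<open>Semilocal principal generators\<close>

context numfld
begin

text \<open>The powers of \<open>b\<close> have finitely many residues, so from some exponent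
  \<open>i\<close> on they repeat with some period \<open>r\<close>. The exponent
  \<open>i * r\<close> is at least \<open>i\<close> and a multiple of the period, so doubling it
  does not change the residue.\<close>

lemma power_idempotent_mod:
  assumes m: "(m::int) > 0" and b: "b \<in> \<O> E"
  shows "\<exists>k>0. \<exists>w\<in>\<O> E. b ^ k - (b ^ k) ^ 2 = of_int m * w"
proof -
  obtain \<kappa> :: "'a \<Rightarrow> int list" where fin: "finite (\<kappa> ` \<O> E)"
    and \<kappa>: "\<And>x y. x \<in> \<O> E \<Longrightarrow> y \<in> \<O> E \<Longrightarrow> \<kappa> x = \<kappa> y \<Longrightarrow> \<exists>z\<in>\<O> E. x - y = of_int m * z"
    using O_mod_finite[OF numfld_axioms m] by blast
  have "range (\<lambda>i. \<kappa> (b ^ Suc i)) \<subseteq> \<kappa> ` \<O> E" using b by auto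
  then have "finite (range (\<lambda>i. \<kappa> (b ^ Suc i)))" using fin finite_subset by blast
  then have "\<not> inj (\<lambda>i. \<kappa> (b ^ Suc i))" using range_inj_infinite by blast
  then obtain i' j' where "i' \<noteq> j'" "\<kappa> (b ^ Suc i') = \<kappa> (b ^ Suc j')" by (auto simp: inj_def)
  then obtain i j where ij: "0 < i" "i < j" "\<kappa> (b ^ i) = \<kappa> (b ^ j)"
    by (metis Suc_less_eq linorder_neqE_nat zero_less_Suc)
  define r where "r = j - i"
  obtain z where z: "z \<in> \<O> E" "b ^ i - b ^ (i + r) = of_int m * z"
    using \<kappa>[OF _ _ ij(3)] b ij by (auto simp: r_def)
  have per: "\<exists>w\<in>\<O> E. b ^ (i + l) - b ^ (i + l + r * t) = of_int m * w" for l t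
  proof (induction t)
    case 0
    show ?case by (intro bexI[of _ 0]) auto
  next
    case (Suc t)
    then obtain w where w: "w \<in> \<O> E" "b ^ (i + l) - b ^ (i + l + r * t) = of_int m * w" by blast
    have "b ^ (i + l) - b ^ (i + l + r * Suc t) =
        (b ^ (i + l) - b ^ (i + l + r * t)) + b ^ (l + r * t) * (b ^ i - b ^ (i + r))"
      by (simp add: power_add algebra_simps)
    also have "\<dots> = of_int m * (w + b ^ (l + r * t) * z)"
      unfolding w z by (simp add: algebra_simps)
    finally show ?case using w z b by (intro bexI[of _ "w + b ^ (l + r * t) * z"]) auto
  qed
  have "r > 0" using ij by (simp add: r_def)
  define k where "k = i * r"
  have k: "k > 0" "k \<ge> i" using ij \<open>r > 0\<close> by (auto simp: k_def)
  have "\<exists>w\<in>\<O> E. b ^ k - b ^ (k + k) = of_int m * w"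
    using per[of "k - i" i] k by (simp add: k_def mult.commute)
  then show ?thesis using k(1) by (auto simp: power2_eq_square power_add)
qed

text \<open>With \<open>c = 1 + m * w\<close>, the product \<open>m * w\<close> is
  \<open>- 1\<close> modulo \<open>c\<close>. Putting this in the integral equation of
  \<open>w\<close>, scaled by \<open>m ^ l\<close>, shows that \<open>c\<close> divides an integer
  congruent to \<open>(- 1) ^ l\<close> modulo \<open>m\<close>, because each lower term keeps a
  factor \<open>m\<close>. The sign is then removed.\<close>

lemma divides_int_cong_one:
  assumes w: "w \<in> \<O> E"
  shows "\<exists>s c. [s = 1] (mod m) \<and> c \<in> \<O> E \<and> of_int s = (1 + of_int m * w) * c"
proof -
  obtain l a where la: "w ^ l = (\<Sum>k<l. of_int (a k :: int) * w ^ k)"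
    using w by (auto simp: ring_of_integers_def algebraic_int_iff_power)
  define c where "c = 1 + of_int m * w"
  have cO: "c \<in> \<O> E" using w by (auto simp: c_def)
  have "\<exists>g\<in>\<O> E. (of_int m * w) ^ k = (- 1) ^ k + c * g" for k
  proof (induction k)
    case 0
    show ?case by (intro bexI[of _ 0]) auto
  next
    case (Suc k)
    then obtain g where g: "g \<in> \<O> E" "(of_int m * w) ^ k = (- 1) ^ k + c * g" by blast
    have "(of_int m * w) ^ Suc k = (c - 1) * ((- 1) ^ k + c * g)"
      using g by (simp add: c_def)
    also have "\<dots> = (- 1) ^ Suc k + c * ((- 1) ^ k + c * g - g)" by (simp add: algebra_simps)
    finally show ?case
      using g cO O_uminus[OF O_one] by (intro bexI[of _ "(- 1) ^ k + c * g - g"]) auto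
  qed
  then obtain g where g: "\<And>k. g k \<in> \<O> E" "\<And>k. (of_int m * w) ^ k = (- 1) ^ k + c * g k" by metis
  define t :: int where "t = (- 1) ^ l - (\<Sum>k<l. a k * m ^ (l - k) * (- 1) ^ k)"
  define h where "h = (\<Sum>k<l. of_int (a k * m ^ (l - k)) * g k) - g l"
  have hO: "h \<in> \<O> E" unfolding h_def by (intro O_diff O_sum O_mult g O_of_int)
  have "(of_int m * w) ^ l = (\<Sum>k<l. of_int (m ^ l) * (of_int (a k) * w ^ k))"
    by (simp add: power_mult_distrib la sum_distrib_left)
  also have "\<dots> = (\<Sum>k<l. of_int (a k * m ^ (l - k)) * (of_int m * w) ^ k)"
  proof (rule sum.cong[OF refl])
    fix k assume "k \<in> {..<l}"
    then have "m ^ l = m ^ (l - k) * m ^ k" by (simp flip: power_add)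
    then show "of_int (m ^ l) * (of_int (a k) * w ^ k) = of_int (a k * m ^ (l - k)) * (of_int m * w) ^ k"
      by (simp add: power_mult_distrib)
  qed
  also have "\<dots> = (\<Sum>k<l. of_int (a k * m ^ (l - k)) * ((- 1) ^ k + c * g k))" by (simp only: g)
  also have "\<dots> = of_int (\<Sum>k<l. a k * m ^ (l - k) * (- 1) ^ k) + c * (h + g l)"
    by (simp add: h_def distrib_left sum.distrib sum_distrib_left mult_ac)
  finally have t: "of_int t = c * h"
    unfolding g(2) t_def by (simp add: algebra_simps)
  have "m dvd (\<Sum>k<l. a k * m ^ (l - k) * (- 1) ^ k)"
    by (intro dvd_sum dvd_mult2 dvd_mult dvd_power) auto
  then have "[t = (- 1) ^ l] (mod m)" by (simp add: t_def cong_iff_dvd_diff)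
  then have "[(- 1) ^ l * t = (- 1) ^ l * (- 1) ^ l] (mod m)" by (rule cong_scalar_left)
  then have "[(- 1) ^ l * t = 1] (mod m)" by (simp flip: power_mult_distrib)
  moreover have "of_int ((- 1) ^ l * t) = c * ((- 1) ^ l * h)" using t by simp
  moreover have "(- 1) ^ l * h \<in> \<O> E" using hO O_uminus[OF O_one] by auto
  ultimately show ?thesis unfolding c_def by blast
qed

text \<open>Modulo \<open>m\<close> some power \<open>e\<close> of \<open>b\<close>, where \<open>b + c * x = 1\<close>, is idempotent. On its component
  the ideal \<open>(1, x)\<close> is generated by \<open>1\<close>, on the complementary one by \<open>x\<close>, so that
  \<open>e + (1 - e) * x\<close> generates it modulo \<open>m\<close>.\<close>

lemma semilocal_generator_two:
  assumes m: "(m::int) > 0" and x: "x \<in> E"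
  shows "\<exists>u v s y. u \<in> \<O> E \<and> v \<in> \<O> E \<and> [s = 1] (mod m) \<and> y \<in> \<O> E \<and> y * x \<in> \<O> E \<and>
    of_int s = (u + v * x) * y"
proof -
  obtain b c where bE: "b \<in> E" "c \<in> E" and b: "algebraic_int b" "algebraic_int (b * x)"
    and c: "algebraic_int c" "algebraic_int (c * x)" and bc: "b + c * x = 1"
    using coprime_integral_multiplier[of E x] algebraic[OF x] x by auto
  have bO: "b \<in> \<O> E" "b * x \<in> \<O> E" "c \<in> \<O> E" "c * x \<in> \<O> E"
    using b c bE x by (auto simp: ring_of_integers_def)
  obtain k w where k: "k > 0" and w: "w \<in> \<O> E" "b ^ k - (b ^ k) ^ 2 = of_int m * w"
    using power_idempotent_mod[OF m bO(1)] by blast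
  define e where "e = b ^ k"
  define \<epsilon> where "\<epsilon> = e - e ^ 2"
  define \<sigma> where "\<sigma> = (\<Sum>i<k. b ^ i)"
  have eO: "e \<in> \<O> E" and \<sigma>O: "\<sigma> \<in> \<O> E" using bO by (auto simp: e_def \<sigma>_def)
  have exO: "e * x \<in> \<O> E"
  proof -
    have "e * x = b ^ (k - 1) * (b * x)" using k by (cases k) (auto simp: e_def)
    then show ?thesis using bO by (metis O_mult O_power)
  qed
  have \<sigma>: "(1 - b) * \<sigma> = 1 - e" unfolding \<sigma>_def e_def by (rule one_diff_power_eq[symmetric])
  have cx: "c * x = 1 - b" using bc by (simp add: algebra_simps)
  define z where "z = e + (1 - e) * x"
  \<comment> \<open>\<open>y\<close> inverts \<open>z\<close> on both components: where
    \<open>e\<close> is 1 so is \<open>z\<close>, and where \<open>e\<close> is 0 there is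
    \<open>z = x\<close>, with inverse \<open>c * \<sigma>\<close> because
    \<open>(c * x) * \<sigma> = 1 - e\<close>.\<close>
  define y where "y = e * e + (1 - e) * c * \<sigma>"
  have "y * x = e * (e * x) + (1 - e) * \<sigma> * (c * x)" by (simp add: y_def algebra_simps)
  then have yxO: "y * x \<in> \<O> E"
    using O_add[OF O_mult[OF eO exO] O_mult[OF O_mult[OF O_diff[OF O_one eO] \<sigma>O] bO(4)]] by simp
  have yO: "y \<in> \<O> E" unfolding y_def by (intro O_add O_mult O_diff O_one eO \<sigma>O bO)
  have "z * y = e * e * e + (1 - e) * e * (e * x) + (1 - e) * e * (c * \<sigma>) + (1 - e) * (1 - e) * ((c * x) * \<sigma>)"
    by (simp add: z_def y_def algebra_simps)
  \<comment> \<open>The constant 3 comes from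
    \<open>e ^ 3 + (1 - e) ^ 3 = 1 - 3 * (e - e ^ 2)\<close>.\<close>
  also have "\<dots> = 1 + \<epsilon> * (e * x + c * \<sigma> - 3)"
    unfolding cx \<sigma> \<epsilon>_def power2_eq_square by (simp add: algebra_simps)
  also have "\<epsilon> = of_int m * w" using w by (simp add: \<epsilon>_def e_def)
  finally have zy: "z * y = 1 + of_int m * (w * (e * x + c * \<sigma> - 3))" by (simp add: mult.assoc)
  have "w * (e * x + c * \<sigma> - 3) \<in> \<O> E"
    using O_mult[OF w(1) O_diff[OF O_add[OF exO O_mult[OF bO(3) \<sigma>O]] O_of_int[of 3]]] by simp
  then obtain s d where s: "[s = 1] (mod m)" "d \<in> \<O> E" "of_int s = z * y * d"
    unfolding zy using divides_int_cong_one[of "w * (e * x + c * \<sigma> - 3)" m] by blast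
  have "y * d \<in> \<O> E" "y * d * x \<in> \<O> E"
    using yO yxO s(2) O_mult[OF yxO s(2)] by (auto simp: mult_ac)
  moreover have "of_int s = (e + (1 - e) * x) * (y * d)" using s(3) by (simp add: z_def mult.assoc)
  moreover have "1 - e \<in> \<O> E" using eO by auto
  ultimately show ?thesis
    using eO s(1) by (intro exI[of _ e] exI[of _ "1 - e"] exI[of _ s] exI[of _ "y * d"]) auto
qed

text \<open>The two-element case for \<open>1\<close> and \<open>b / z\<close> absorbs one more
  generator \<open>b\<close>, and the multipliers, all 1 modulo \<open>m\<close>, are multiplied. If
  \<open>z = 0\<close>, the earlier bound reads \<open>s * c = 0\<close> and \<open>b\<close> itself
  becomes the generator.\<close>

lemma semilocal_generator_finite:
  assumes m: "(m::int) > 0" and S: "finite S" "S \<subseteq> E"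
  shows "\<exists>z s. z \<in> int_submodule E hull S \<and> [s = 1] (mod m) \<and>
    (\<forall>b\<in>S. \<exists>a\<in>\<O> E. of_int s * b = z * a)"
  using S
proof (induction S rule: finite_induct)
  case empty
  show ?case by (intro exI[of _ 0] exI[of _ 1]) (auto intro: submodule_zero[OF int_submodule_hull])
next
  case (insert b S)
  then obtain z s where zs: "z \<in> int_submodule E hull S" "[s = 1] (mod m)"
    "\<And>b. b \<in> S \<Longrightarrow> \<exists>a\<in>\<O> E. of_int s * b = z * a" by auto
  let ?H = "int_submodule E hull insert b S"
  have zH: "z \<in> ?H" using zs(1) hull_mono[of S "insert b S" "int_submodule E"] by auto
  have bH: "b \<in> ?H" by (rule hull_inc) simp
  have zE: "z \<in> E" using hull_induct_submodule[OF zs(1) submodule_field] insert.prems by auto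
  show ?case
  proof (cases "z = 0")
    case True
    have "\<exists>a\<in>\<O> E. of_int s * c = b * a" if "c \<in> insert b S" for c
    proof (cases "c = b")
      case True
      then show ?thesis by (intro bexI[of _ "of_int s"]) auto
    next
      case False
      then have "of_int s * c = 0" using that zs(3)[of c] \<open>z = 0\<close> by auto
      then show ?thesis by (intro bexI[of _ 0]) auto
    qed
    then show ?thesis using bH zs(2) by blast
  next
    case False
    have "b / z \<in> E" using zE insert.prems by auto
    then obtain u v t y where uv: "u \<in> \<O> E" "v \<in> \<O> E" "[t = 1] (mod m)" "y \<in> \<O> E"
      "y * (b / z) \<in> \<O> E" "of_int t = (u + v * (b / z)) * y"
      using semilocal_generator_two[OF m, of "b / z"] by blast
    define z' where "z' = u * z + v * b"
    have z': "z' = (u + v * (b / z)) * z" using False by (simp add: z'_def field_simps)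
    have "z' \<in> ?H" unfolding z'_def
      by (intro submodule_add[OF int_submodule_hull] submodule_mult[OF int_submodule_hull] uv zH bH)
    moreover have "[s * t = 1] (mod m)" using cong_mult[OF zs(2) uv(3)] by simp
    moreover have "\<exists>a\<in>\<O> E. of_int (s * t) * c = z' * a" if c: "c \<in> insert b S" for c
    proof (cases "c = b")
      case True
      have "of_int (s * t) * b = z' * (of_int s * (y * (b / z)))"
        using uv(6) False by (simp add: z')
      then show ?thesis using uv(5) True by blast
    next
      case False
      then obtain a where a: "a \<in> \<O> E" "of_int s * c = z * a" using zs(3) c by blast
      have "of_int (s * t) * c = of_int t * (z * a)" using a by (simp add: mult_ac flip: a(2))
      also have "\<dots> = z' * (y * a)" unfolding uv(6) z' by (simp add: mult_ac)
      finally show ?thesis using a(1) uv(4) by blast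
    qed
    ultimately show ?thesis by (intro exI[of _ z'] exI[of _ "s * t"]) auto
  qed
qed

abbreviation "fractional \<equiv> fractional_ideal E"

lemma fractional_sub: "fractional A \<Longrightarrow> A \<subseteq> E" and fractional_submodule: "fractional A \<Longrightarrow> int_submodule E A"
  by (auto simp: fractional_ideal_def)

lemma fractional_nonzero:
  assumes "fractional A"
  obtains a where "a \<in> A" "a \<noteq> 0" "a \<in> E"
  using assms submodule_zero[of E A] by (auto simp: fractional_ideal_def)

lemma O_divides_int:
  assumes "x \<in> E" "x \<noteq> 0"
  shows "\<exists>m::int. m > 0 \<and> of_int m / x \<in> \<O> E"
  using int_multiple_O[of "inverse x"] assms by (auto simp: field_simps)

lemma fractional_int_denominator:
  assumes "fractional A"
  shows "\<exists>m::int. m > 0 \<and> (\<forall>x\<in>A. of_int m * x \<in> \<O> E)"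
proof -
  obtain d where d: "d \<in> \<O> E" "d \<noteq> 0" "\<forall>x\<in>A. d * x \<in> \<O> E"
    using assms by (auto simp: fractional_ideal_def)
  then obtain m :: int where m: "m > 0" "of_int m / d \<in> \<O> E" using O_divides_int O_sub by blast
  have "of_int m * x \<in> \<O> E" if "x \<in> A" for x
  proof -
    have "of_int m * x = (of_int m / d) * (d * x)" using d(2) by simp
    then show ?thesis using m d that by (metis O_mult)
  qed
  then show ?thesis using m by blast
qed

lemma fractional_contains_int:
  assumes "fractional A"
  shows "\<exists>m::int. m > 0 \<and> of_int m \<in> A"
proof -
  obtain a where a: "a \<in> A" "a \<noteq> 0" "a \<in> E" using fractional_nonzero[OF assms] by blast
  then obtain m :: int where m: "m > 0" "of_int m / a \<in> \<O> E" using O_divides_int by blast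
  have "of_int m / a * a \<in> A" using m a by (intro submodule_mult[OF fractional_submodule[OF assms]])
  then show ?thesis using m a by auto
qed

lemma fractionalI:
  assumes "A \<subseteq> E" "int_submodule E A" "a \<in> A" "a \<noteq> 0" "(m::int) \<noteq> 0" "\<And>x. x \<in> A \<Longrightarrow> of_int m * x \<in> \<O> E"
  shows "fractional A"
  unfolding fractional_ideal_def using assms by (auto intro!: bexI[of _ "of_int m"])

text \<open>The ideal contains \<open>m * \<O> E\<close> and is finite modulo it:
  \<open>d * A\<close> lies in \<open>\<O> E\<close>, which has finitely many residues modulo
  \<open>d * m\<close>. One element of \<open>A\<close> for each residue, together with
  \<open>m\<close>, generates \<open>A\<close>.\<close>

lemma fractional_finitely_generated:
  assumes A: "fractional A"
  shows "\<exists>S. finite S \<and> S \<subseteq> A \<and> A = int_submodule E hull S"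
proof -
  note sub = fractional_submodule[OF A]
  obtain d :: int where d: "d > 0" "\<And>x. x \<in> A \<Longrightarrow> of_int d * x \<in> \<O> E"
    using fractional_int_denominator[OF A] by blast
  obtain m :: int where m: "m > 0" "of_int m \<in> A"
    using fractional_contains_int[OF A] by blast
  have dm: "d * m > 0" using d m by simp
  obtain \<kappa> :: "'a \<Rightarrow> int list" where fin: "finite (\<kappa> ` \<O> E)"
    and \<kappa>: "\<And>x y. x \<in> \<O> E \<Longrightarrow> y \<in> \<O> E \<Longrightarrow> \<kappa> x = \<kappa> y \<Longrightarrow> \<exists>z\<in>\<O> E. x - y = of_int (d * m) * z"
    using O_mod_finite[OF numfld_axioms dm] by blast
  define f where "f x = \<kappa> (of_int d * x)" for x
  have "f ` A \<subseteq> \<kappa> ` \<O> E" using d by (auto simp: f_def)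
  then have finf: "finite (f ` A)" using fin finite_subset by blast
  define S where "S = insert (of_int m) (inv_into A f ` (f ` A))"
  have SA: "S \<subseteq> A" using m by (auto simp: S_def inv_into_into)
  let ?H = "int_submodule E hull S"
  have "x \<in> ?H" if x: "x \<in> A" for x
  proof -
    let ?y = "inv_into A f (f x)"
    have y: "?y \<in> A" "f ?y = f x" using x by (auto simp: inv_into_into f_inv_into_f)
    then have "\<kappa> (of_int d * x) = \<kappa> (of_int d * ?y)" by (simp add: f_def)
    then obtain z where z: "z \<in> \<O> E" "of_int d * x - of_int d * ?y = of_int (d * m) * z"
      using \<kappa>[OF d(2)[OF x] d(2)[OF y(1)]] by blast
    have "of_int d * (x - ?y) = of_int d * (z * of_int m)" using z(2) by (simp add: algebra_simps)
    then have "x - ?y = z * of_int m" using d(1) by simp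
    then have "x = ?y + z * of_int m" by (simp add: algebra_simps)
    moreover have "?y \<in> ?H" "of_int m \<in> ?H" using x by (auto simp: S_def intro!: hull_inc)
    ultimately show ?thesis 
      using submodule_add[OF int_submodule_hull _ submodule_mult[OF int_submodule_hull z(1)], of ?y S "of_int m"]
      by simp
  qed
  moreover have "?H \<subseteq> A" using hull_minimal[of S A "int_submodule E"] SA sub by blast
  ultimately have "A = ?H" by blast
  moreover have "finite S" using finf by (simp add: S_def)
  ultimately show ?thesis using SA by blast
qed

lemma semilocal_generator:
  assumes A: "fractional A" and m: "(m::int) > 0"
  obtains z s where "z \<in> A" "[s = 1] (mod m)" "\<forall>x\<in>A. of_int s * x \<in> (*) z ` \<O> E"
proof -
  obtain S where S: "finite S" "S \<subseteq> A" "A = int_submodule E hull S"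
    using fractional_finitely_generated[OF A] by blast
  then have "S \<subseteq> E" using fractional_sub[OF A] by blast
  then obtain z s where z: "z \<in> A" "[s = 1] (mod m)" "\<forall>b\<in>S. \<exists>a\<in>\<O> E. of_int s * b = z * a"
    using semilocal_generator_finite[OF m S(1)] S(3) by blast
  have "S \<subseteq> {x. of_int s * x \<in> (*) z ` \<O> E}" using z(3) by auto
  then have "of_int s * x \<in> (*) z ` \<O> E" if "x \<in> A" for x
    using hull_induct_submodule[OF _ submodule_scaled[OF submodule_principal], of x S] that
    unfolding S(3)[symmetric] by blast
  then show ?thesis by (intro that[OF z(1,2)] ballI)
qed

end

section \<open>The group of fractional ideals\<close>

context subfld
begin

lemma ideal_mult_mem: "a \<in> A \<Longrightarrow> b \<in> B \<Longrightarrow> a * b \<in> ideal_mult E A B"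
  unfolding ideal_mult_def by (rule hull_inc) blast

lemma ideal_mult_submodule: "int_submodule E (ideal_mult E A B)"
  unfolding ideal_mult_def by (rule int_submodule_hull)

lemma ideal_mult_min:
  assumes M: "int_submodule E M" and AB: "\<And>a b. a \<in> A \<Longrightarrow> b \<in> B \<Longrightarrow> a * b \<in> M"
  shows "ideal_mult E A B \<subseteq> M"
  unfolding ideal_mult_def by (rule hull_minimal[where S = "int_submodule E", OF _ M]) (use AB in blast)

lemma ideal_mult_commute: "ideal_mult E A B = ideal_mult E B A"
proof -
  have "ideal_mult E A B \<subseteq> ideal_mult E B A" for A B
  proof (rule ideal_mult_min[OF ideal_mult_submodule])
    fix a b assume "a \<in> A" "b \<in> B"
    then have "b * a \<in> ideal_mult E B A" by (intro ideal_mult_mem)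
    then show "a * b \<in> ideal_mult E B A" by (simp add: mult.commute)
  qed
  then show ?thesis by blast
qed

lemma ideal_mult_assoc: "ideal_mult E (ideal_mult E A B) C = ideal_mult E A (ideal_mult E B C)"
proof -
  have *: "ideal_mult E (ideal_mult E A B) C \<subseteq> ideal_mult E A (ideal_mult E B C)" for A B C
  proof (rule ideal_mult_min[OF ideal_mult_submodule])
    fix x c assume x: "x \<in> ideal_mult E A B" and c: "c \<in> C"
    let ?M = "ideal_mult E A (ideal_mult E B C)"
    have "ideal_mult E A B \<subseteq> {x. c * x \<in> ?M}"
    proof (rule ideal_mult_min[OF submodule_scaled[OF ideal_mult_submodule]])
      fix a b assume "a \<in> A" "b \<in> B"
      then have "a * (b * c) \<in> ?M" using c by (intro ideal_mult_mem)
      then show "a * b \<in> {x. c * x \<in> ?M}" by (simp add: mult_ac)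
    qed
    then show "x * c \<in> ?M" using x by (auto simp: mult.commute)
  qed
  \<comment> \<open>The reverse inclusion follows from the first one, applied to the rotations
    \<open>B, C, A\<close> and \<open>C, A, B\<close>, and commutativity.\<close>
  have "ideal_mult E A (ideal_mult E B C) = ideal_mult E (ideal_mult E B C) A"
    by (rule ideal_mult_commute)
  also have "\<dots> \<subseteq> ideal_mult E B (ideal_mult E C A)" by (rule *)
  also have "\<dots> = ideal_mult E (ideal_mult E C A) B" by (rule ideal_mult_commute)
  also have "\<dots> \<subseteq> ideal_mult E C (ideal_mult E A B)" by (rule *)
  also have "\<dots> = ideal_mult E (ideal_mult E A B) C" by (rule ideal_mult_commute)
  finally show ?thesis using *[of A B C] by blast
qed

lemma ideal_mult_one:
  assumes "int_submodule E A"
  shows "ideal_mult E (\<O> E) A = A"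
proof
  show "ideal_mult E (\<O> E) A \<subseteq> A"
    by (rule ideal_mult_min[OF assms submodule_mult[OF assms]])
  show "A \<subseteq> ideal_mult E (\<O> E) A"
  proof
    fix x assume "x \<in> A"
    then have "1 * x \<in> ideal_mult E (\<O> E) A" by (intro ideal_mult_mem) auto
    then show "x \<in> ideal_mult E (\<O> E) A" by simp
  qed
qed

end

lemma ideal_group_simps [simp]:
  "carrier (ideal_group E) = {A. fractional_ideal E A}"
  "monoid.mult (ideal_group E) = ideal_mult E"
  "one (ideal_group E) = \<O> E"
  by (simp_all add: ideal_group_def)

context numfld
begin

lemma fractional_O: "fractional (\<O> E)"
  by (rule fractionalI[of _ 1 1]) (auto simp: O_sub[THEN subsetD] submodule_O)

lemma fractional_mult:
  assumes A: "fractional A" and B: "fractional B"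
  shows "fractional (ideal_mult E A B)"
proof -
  obtain a where a: "a \<in> A" "a \<noteq> 0" "a \<in> E" by (rule fractional_nonzero[OF A])
  obtain b where b: "b \<in> B" "b \<noteq> 0" "b \<in> E" by (rule fractional_nonzero[OF B])
  obtain m :: int where m: "m > 0" "\<And>x. x \<in> A \<Longrightarrow> of_int m * x \<in> \<O> E"
    using fractional_int_denominator[OF A] by blast
  obtain l :: int where l: "l > 0" "\<And>x. x \<in> B \<Longrightarrow> of_int l * x \<in> \<O> E"
    using fractional_int_denominator[OF B] by blast
  show ?thesis
  proof (rule fractionalI)
    show "ideal_mult E A B \<subseteq> E"
      using fractional_sub[OF A] fractional_sub[OF B] by (intro ideal_mult_min[OF submodule_field]) auto
    show "int_submodule E (ideal_mult E A B)" by (rule ideal_mult_submodule)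
    show "a * b \<in> ideal_mult E A B" using a b by (intro ideal_mult_mem)
    show "a * b \<noteq> 0" using a b by simp
    show "m * l \<noteq> 0" using m l by simp
    have "ideal_mult E A B \<subseteq> {x. of_int (m * l) * x \<in> \<O> E}"
    proof (rule ideal_mult_min[OF submodule_scaled[OF submodule_O]])
      fix a b assume "a \<in> A" "b \<in> B"
      then have "(of_int m * a) * (of_int l * b) \<in> \<O> E" by (intro O_mult[OF m(2) l(2)])
      then show "a * b \<in> {x. of_int (m * l) * x \<in> \<O> E}" by (simp add: mult_ac)
    qed
    then show "of_int (m * l) * x \<in> \<O> E" if "x \<in> ideal_mult E A B" for x using that by blast
  qed
qed

definition ideal_inverse :: "'a set \<Rightarrow> 'a set"
  where "ideal_inverse A = {y \<in> E. \<forall>a\<in>A. y * a \<in> \<O> E}"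

lemma fractional_ideal_inverse:
  assumes A: "fractional A"
  shows "fractional (ideal_inverse A)"
proof -
  obtain m :: int where m: "m > 0" "\<And>x. x \<in> A \<Longrightarrow> of_int m * x \<in> \<O> E"
    using fractional_int_denominator[OF A] by blast
  obtain l :: int where l: "l > 0" "of_int l \<in> A"
    using fractional_contains_int[OF A] by blast
  show ?thesis
  proof (rule fractionalI)
    show "ideal_inverse A \<subseteq> E" by (auto simp: ideal_inverse_def)
    show "int_submodule E (ideal_inverse A)"
      unfolding int_submodule_def ideal_inverse_def
      by (auto simp: distrib_right mult.assoc O_sub[THEN subsetD])
    show "of_int m \<in> ideal_inverse A" using m by (auto simp: ideal_inverse_def)
    show "of_int m \<noteq> (0 :: 'a)" "l \<noteq> 0" using m l by simp_all
    show "of_int l * x \<in> \<O> E" if "x \<in> ideal_inverse A" for x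
      using that l(2) by (auto simp: ideal_inverse_def mult.commute)
  qed
qed

text \<open>If \<open>s * A\<close> is contained in \<open>z * \<O> E\<close>, then
  \<open>s / z\<close> belongs to the inverse and \<open>(s / z) * z = s\<close>. So for every
  \<open>m\<close> the product contains an integer that is 1 modulo \<open>m\<close>, and hence it
  contains 1.\<close>

lemma ideal_inverse_mult:
  assumes A: "fractional A"
  shows "ideal_mult E (ideal_inverse A) A = \<O> E"
proof
  show "ideal_mult E (ideal_inverse A) A \<subseteq> \<O> E"
    by (rule ideal_mult_min[OF submodule_O]) (auto simp: ideal_inverse_def)
  let ?M = "ideal_mult E (ideal_inverse A) A"
  have "1 \<in> ?M"
  proof (rule submodule_member_if_local[OF ideal_mult_submodule])
    fix m :: int assume m: "m > 0"
    obtain z s where z: "z \<in> A" "[s = 1] (mod m)" "\<forall>x\<in>A. of_int s * x \<in> (*) z ` \<O> E"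
      by (rule semilocal_generator[OF A m]) 
    show "\<exists>s. [s = 1] (mod m) \<and> of_int s * 1 \<in> ?M"
    \<comment> \<open>\<open>s = 0\<close> can occur only for \<open>m = 1\<close>; division by
      \<open>z\<close> is then not justified, but 0 already lies in the product.\<close>
    proof (cases "s = 0")
      case True
      then show ?thesis using z(2) submodule_zero[OF ideal_mult_submodule] by (intro exI[of _ s]) auto
    next
      case False
      obtain l :: int where l: "l > 0" "of_int l \<in> A"
        using fractional_contains_int[OF A] by blast
      have z0: "z \<noteq> 0" using z(3)[rule_format, OF l(2)] l(1) False by auto
      have "of_int s / z \<in> ideal_inverse A"
        unfolding ideal_inverse_def
      proof (intro CollectI conjI ballI)
        show "of_int s / z \<in> E" using fractional_sub[OF A] z(1) by (intro divide of_int) auto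
        fix a assume "a \<in> A"
        then obtain b where "b \<in> \<O> E" "of_int s * a = z * b" using z(3)[rule_format] by blast
        then show "of_int s / z * a \<in> \<O> E" using z0 by (simp add: field_simps)
      qed
      from ideal_mult_mem[OF this z(1)] have "of_int s * 1 \<in> ?M" using z0 by simp
      then show ?thesis using z(2) by blast
    qed
  qed
  then show "\<O> E \<subseteq> ?M"
    using submodule_mult[OF ideal_mult_submodule, where x = 1] by fastforce
qed

lemma ideal_comm_group: "comm_group (ideal_group E)"
proof (rule comm_groupI)
  fix A assume "A \<in> carrier (ideal_group E)"
  then have A: "fractional A" by simp
  show "\<exists>B\<in>carrier (ideal_group E). B \<otimes>\<^bsub>ideal_group E\<^esub> A = \<one>\<^bsub>ideal_group E\<^esub>"
    using fractional_ideal_inverse[OF A] ideal_inverse_mult[OF A] by auto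
  show "\<one>\<^bsub>ideal_group E\<^esub> \<otimes>\<^bsub>ideal_group E\<^esub> A = A"
    using ideal_mult_one[OF fractional_submodule[OF A]] by simp
next
  fix A B assume "A \<in> carrier (ideal_group E)" "B \<in> carrier (ideal_group E)"
  then show "A \<otimes>\<^bsub>ideal_group E\<^esub> B \<in> carrier (ideal_group E)" by (simp add: fractional_mult)
  show "A \<otimes>\<^bsub>ideal_group E\<^esub> B = B \<otimes>\<^bsub>ideal_group E\<^esub> A" by (simp add: ideal_mult_commute)
next
  fix A B C
  show "A \<otimes>\<^bsub>ideal_group E\<^esub> B \<otimes>\<^bsub>ideal_group E\<^esub> C = A \<otimes>\<^bsub>ideal_group E\<^esub> (B \<otimes>\<^bsub>ideal_group E\<^esub> C)"
    by (simp add: ideal_mult_assoc)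
qed (simp add: fractional_O)

sublocale I: comm_group "ideal_group E"
  by (rule ideal_comm_group)

lemma ideal_pow_mem: "a \<in> A \<Longrightarrow> a ^ k \<in> A [^]\<^bsub>ideal_group E\<^esub> (k::nat)"
  by (induction k) (auto simp only: power_Suc2 I.nat_pow_Suc I.nat_pow_0 power_0 ideal_group_simps O_one
      intro: ideal_mult_mem)

lemma ideal_pow_submodule: "int_submodule E (A [^]\<^bsub>ideal_group E\<^esub> (k::nat))"
  by (cases k) (auto simp: submodule_O ideal_mult_submodule)

text \<open>Principal bounds multiply, which carries local generators over to products and, by
  iteration, to powers of ideals.\<close>

lemma ideal_mult_principal_bound:
  assumes A: "\<And>x. x \<in> A \<Longrightarrow> s * x \<in> (*) z ` \<O> E" and B: "\<And>x. x \<in> B \<Longrightarrow> t * x \<in> (*) w ` \<O> E"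
    and x: "x \<in> ideal_mult E A B"
  shows "(s * t) * x \<in> (*) (z * w) ` \<O> E"
proof -
  have "ideal_mult E A B \<subseteq> {x. (s * t) * x \<in> (*) (z * w) ` \<O> E}"
  proof (rule ideal_mult_min[OF submodule_scaled[OF submodule_principal]])
    fix a b assume "a \<in> A" "b \<in> B"
    then obtain c d where cd: "c \<in> \<O> E" "s * a = z * c" "d \<in> \<O> E" "t * b = w * d"
      using A B by blast
    have "s * t * (a * b) = (s * a) * (t * b)" by (simp add: mult_ac)
    also have "\<dots> = z * w * (c * d)" unfolding cd by (simp add: mult_ac)
    finally show "a * b \<in> {x. (s * t) * x \<in> (*) (z * w) ` \<O> E}" using cd by auto
  qed
  then show ?thesis using x by blast
qed

lemma ideal_pow_principal_bound:
  assumes A: "\<And>x. x \<in> A \<Longrightarrow> s * x \<in> (*) z ` \<O> E"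
    and "x \<in> A [^]\<^bsub>ideal_group E\<^esub> (k::nat)"
  shows "s ^ k * x \<in> (*) (z ^ k) ` \<O> E"
  using assms(2)
proof (induction k arbitrary: x)
  case 0
  then show ?case by simp
next
  case (Suc k)
  then have "x \<in> ideal_mult E (A [^]\<^bsub>ideal_group E\<^esub> k) A" by simp
  from ideal_mult_principal_bound[OF Suc.IH A this] show ?case by (simp add: mult.commute)
qed

end

section \<open>Extension of ideals\<close>

context numfld_ext
begin

lemma O_base_sub: "\<O> K \<subseteq> \<O> E"
  using sub by (auto simp: ring_of_integers_def)

lemma submodule_base: "int_submodule E M \<Longrightarrow> int_submodule K M"
  using O_base_sub by (auto simp: int_submodule_def)

abbreviation "ext \<equiv> ideal_extension E"

lemma ext_submodule: "int_submodule E (ext A)" and ext_inc: "A \<subseteq> ext A"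
  by (simp_all add: ideal_extension_def hull_subset)

lemma ext_min: "int_submodule E M \<Longrightarrow> A \<subseteq> M \<Longrightarrow> ext A \<subseteq> M"
  unfolding ideal_extension_def by (rule hull_minimal)

lemma ext_fractional:
  assumes A: "fractional_ideal K A"
  shows "fractional_ideal E (ext A)"
proof -
  obtain a where a: "a \<in> A" "a \<noteq> 0" "a \<in> K" by (rule K.fractional_nonzero[OF A])
  obtain m :: int where m: "m > 0" "\<And>x. x \<in> A \<Longrightarrow> of_int m * x \<in> \<O> K"
    using K.fractional_int_denominator[OF A] by blast
  show ?thesis
  proof (rule E.fractionalI)
    show "ext A \<subseteq> E" using K.fractional_sub[OF A] sub by (intro ext_min E.submodule_field) auto
    show "int_submodule E (ext A)" by (rule ext_submodule)
    show "a \<in> ext A" "a \<noteq> 0" using a ext_inc by auto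
    show "m \<noteq> 0" using m by simp
    have "ext A \<subseteq> {x. of_int m * x \<in> \<O> E}"
      using m(2) O_base_sub by (intro ext_min E.submodule_scaled E.submodule_O) auto
    then show "of_int m * x \<in> \<O> E" if "x \<in> ext A" for x using that by blast
  qed
qed

text \<open>For the second inclusion, products of elements of \<open>A\<close> and \<open>B\<close>
  are extended linearly first in the \<open>B\<close>-factor and then in the
  \<open>A\<close>-factor.\<close>

lemma ext_mult: "ext (ideal_mult K A B) = ideal_mult E (ext A) (ext B)"
proof
  show "ext (ideal_mult K A B) \<subseteq> ideal_mult E (ext A) (ext B)"
  proof (rule ext_min[OF E.ideal_mult_submodule])
    show "ideal_mult K A B \<subseteq> ideal_mult E (ext A) (ext B)"
      by (rule K.ideal_mult_min[OF submodule_base[OF E.ideal_mult_submodule]])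
        (rule E.ideal_mult_mem[OF subsetD[OF ext_inc] subsetD[OF ext_inc]])
  qed
  show "ideal_mult E (ext A) (ext B) \<subseteq> ext (ideal_mult K A B)"
  proof (rule E.ideal_mult_min[OF ext_submodule])
    fix x y assume x: "x \<in> ext A" and y: "y \<in> ext B"
    have "ext B \<subseteq> {y. a * y \<in> ext (ideal_mult K A B)}" if "a \<in> A" for a
    proof (rule ext_min[OF E.submodule_scaled[OF ext_submodule]])
      show "B \<subseteq> {y. a * y \<in> ext (ideal_mult K A B)}"
        using subsetD[OF ext_inc K.ideal_mult_mem[OF that]] by blast
    qed
    then have "a * y \<in> ext (ideal_mult K A B)" if "a \<in> A" for a using that y by blast
    then have "ext A \<subseteq> {x. y * x \<in> ext (ideal_mult K A B)}"
      by (intro ext_min E.submodule_scaled ext_submodule) (auto simp: mult.commute)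
    then show "x * y \<in> ext (ideal_mult K A B)" using x by (auto simp: mult.commute)
  qed
qed

lemma ext_one: "ext (\<O> K) = \<O> E"
proof
  show "ext (\<O> K) \<subseteq> \<O> E" by (rule ext_min[OF E.submodule_O O_base_sub])
  show "\<O> E \<subseteq> ext (\<O> K)"
  proof
    fix x assume "x \<in> \<O> E"
    moreover have "1 \<in> ext (\<O> K)" using ext_inc by blast
    ultimately have "x * 1 \<in> ext (\<O> K)" by (rule submodule_mult[OF ext_submodule])
    then show "x \<in> ext (\<O> K)" by simp
  qed
qed

lemma ext_hom: "ideal_extension E \<in> hom (ideal_group K) (ideal_group E)"
  by (rule homI) (simp_all add: ext_fractional ext_mult)

lemma ext_group_hom: "group_hom (ideal_group K) (ideal_group E) (ideal_extension E)"
  by (simp add: group_hom_def group_hom_axioms_def K.I.group_axioms E.I.group_axioms ext_hom)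

lemma extended_ideals_subgroup: "subgroup (extended_ideals E K) (ideal_group E)"
  unfolding extended_ideals_def by (rule group_hom.img_is_subgroup[OF ext_group_hom])

lemma extended_ideals_iff: "A \<in> extended_ideals E K \<longleftrightarrow> (\<exists>B. fractional_ideal K B \<and> A = ext B)"
  by (auto simp: extended_ideals_def)

section \<open>The relative norm of ideals\<close>

abbreviation "RN \<equiv> relative_norm E K"
abbreviation "nm \<equiv> field_norm E K"

lemma RN_submodule: "int_submodule K (RN A)"
  by (simp add: relative_norm_def)

lemma RN_mem: "a \<in> A \<Longrightarrow> nm a \<in> RN A"
  unfolding relative_norm_def by (rule hull_inc) blast

lemma RN_min: "int_submodule K M \<Longrightarrow> (\<And>a. a \<in> A \<Longrightarrow> nm a \<in> M) \<Longrightarrow> RN A \<subseteq> M"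
  unfolding relative_norm_def by (rule hull_minimal) auto

lemma norm_of_int_mult: "x \<in> E \<Longrightarrow> nm (of_int s * x) = of_int (s ^ deg) * nm x"
  by (simp add: norm_mult norm_base)

text \<open>The norm of the integer \<open>s\<close> is \<open>s ^ deg\<close>, which is 1 modulo
  \<open>m\<close> whenever \<open>s\<close> is; so a local generator of an ideal yields one of its
  norm.\<close>

lemma RN_principal_bound:
  assumes AE: "A \<subseteq> E" and z: "z \<in> E" and A: "\<And>x. x \<in> A \<Longrightarrow> of_int s * x \<in> (*) z ` \<O> E" and x: "x \<in> RN A"
  shows "of_int (s ^ deg) * x \<in> (*) (nm z) ` \<O> K"
proof -
  have "RN A \<subseteq> {x. of_int (s ^ deg) * x \<in> (*) (nm z) ` \<O> K}"
  proof (rule RN_min[OF K.submodule_scaled[OF K.submodule_principal]])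
    fix a assume a: "a \<in> A"
    then obtain c where c: "c \<in> \<O> E" "of_int s * a = z * c" using A by blast
    have "of_int (s ^ deg) * nm a = nm (of_int s * a)"
      using a AE by (intro norm_of_int_mult[symmetric]) auto
    also have "\<dots> = nm z * nm c" unfolding c(2) using c(1) E.O_sub z by (intro norm_mult) auto
    finally show "nm a \<in> {x. of_int (s ^ deg) * x \<in> (*) (nm z) ` \<O> K}" using norm_O[OF c(1)] by blast
  qed
  then show ?thesis using x by blast
qed

lemma RN_fractional:
  assumes A: "fractional_ideal E A"
  shows "fractional_ideal K (RN A)"
proof -
  obtain a where a: "a \<in> A" "a \<noteq> 0" "a \<in> E" by (rule E.fractional_nonzero[OF A])
  obtain m :: int where m: "m > 0" "\<And>x. x \<in> A \<Longrightarrow> of_int m * x \<in> \<O> E"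
    using E.fractional_int_denominator[OF A] by blast
  note AE = E.fractional_sub[OF A]
  show ?thesis
  proof (rule K.fractionalI)
    show "RN A \<subseteq> K" using AE by (intro RN_min K.submodule_field norm_in) auto
    show "int_submodule K (RN A)" by (rule RN_submodule)
    show "nm a \<in> RN A" using a by (intro RN_mem)
    show "nm a \<noteq> 0" using a by (intro norm_nonzero)
    show "m ^ deg \<noteq> 0" using m by simp
    show "of_int (m ^ deg) * x \<in> \<O> K" if "x \<in> RN A" for x
      using RN_principal_bound[OF AE E.one _ that, of m] m(2) by auto
  qed
qed

text \<open>Elements of the product ideal are sums and the norm is not additive, so the first
  inclusion goes through local generators \<open>z\<close>, \<open>w\<close> and the norm of
  \<open>z * w\<close>. The second follows from multiplicativity, extended linearly in one factor at
  a time.\<close>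

lemma RN_mult:
  assumes A: "fractional_ideal E A" and B: "fractional_ideal E B"
  shows "RN (ideal_mult E A B) = ideal_mult K (RN A) (RN B)"
proof
  note AE = E.fractional_sub[OF A] and BE = E.fractional_sub[OF B]
  have ABE: "ideal_mult E A B \<subseteq> E" by (rule E.fractional_sub[OF E.fractional_mult[OF A B]])
  show "RN (ideal_mult E A B) \<subseteq> ideal_mult K (RN A) (RN B)" (is "_ \<subseteq> ?M")
  proof (rule K.submodule_subset_if_local[OF K.ideal_mult_submodule])
    fix m :: int assume m: "m > 0"
    obtain z s where z: "z \<in> A" "[s = 1] (mod m)" "\<forall>x\<in>A. of_int s * x \<in> (*) z ` \<O> E"
      by (rule E.semilocal_generator[OF A m])
    obtain w t where w: "w \<in> B" "[t = 1] (mod m)" "\<forall>x\<in>B. of_int t * x \<in> (*) w ` \<O> E"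
      by (rule E.semilocal_generator[OF B m])
    have zw: "z \<in> E" "w \<in> E" using z(1) w(1) AE BE by auto
    have "of_int (s * t) * y \<in> (*) (z * w) ` \<O> E" if "y \<in> ideal_mult E A B" for y
      using E.ideal_mult_principal_bound[OF z(3)[rule_format] w(3)[rule_format] that] by simp
    then have "\<forall>x\<in>RN (ideal_mult E A B). of_int ((s * t) ^ deg) * x \<in> (*) (nm (z * w)) ` \<O> K"
      using RN_principal_bound[OF ABE E.mult[OF zw]] by blast
    moreover have "nm (z * w) \<in> ?M"
      unfolding norm_mult[OF zw] by (intro K.ideal_mult_mem RN_mem z w)
    moreover have "[(s * t) ^ deg = 1] (mod m)"
      using cong_pow[OF cong_mult[OF z(2) w(2)], of deg] by simp
    ultimately show "\<exists>s. \<exists>w\<in>?M. [s = 1] (mod m) \<and>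
        (\<forall>x\<in>RN (ideal_mult E A B). of_int s * x \<in> (*) w ` \<O> K)" by blast
  qed
  show "ideal_mult K (RN A) (RN B) \<subseteq> RN (ideal_mult E A B)"
  proof (rule K.ideal_mult_min[OF RN_submodule])
    fix x y assume x: "x \<in> RN A" and y: "y \<in> RN B"
    let ?M = "RN (ideal_mult E A B)"
    have "nm a * nm b \<in> ?M" if "a \<in> A" "b \<in> B" for a b
      using RN_mem[OF E.ideal_mult_mem[OF that]] norm_mult[OF subsetD[OF AE that(1)] subsetD[OF BE that(2)]]
      by simp
    then have "RN B \<subseteq> {y. nm a * y \<in> ?M}" if "a \<in> A" for a
      using that by (intro RN_min K.submodule_scaled RN_submodule) auto
    then have "nm a * y \<in> ?M" if "a \<in> A" for a using that y by blast
    then have "RN A \<subseteq> {x. y * x \<in> ?M}"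
      by (intro RN_min K.submodule_scaled RN_submodule) (auto simp: mult.commute)
    then show "x * y \<in> ?M" using x by (auto simp: mult.commute)
  qed
qed

lemma ext_principal_bound:
  assumes A: "\<And>x. x \<in> A \<Longrightarrow> s * x \<in> (*) z ` \<O> K" and x: "x \<in> ext A"
  shows "s * x \<in> (*) z ` \<O> E"
proof -
  have "ext A \<subseteq> {x. s * x \<in> (*) z ` \<O> E}"
    using A O_base_sub by (intro ext_min E.submodule_scaled E.submodule_principal) blast
  then show ?thesis using x by blast
qed

text \<open>A local generator \<open>z\<close> of \<open>A\<close> has norm \<open>z ^ deg\<close>,
  which lies in both sides and locally bounds both of them.\<close>

lemma RN_ext:
  assumes A: "fractional_ideal K A"
  shows "RN (ext A) = A [^]\<^bsub>ideal_group K\<^esub> deg"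
proof -
  note AK = K.fractional_sub[OF A] and eA = ext_fractional[OF A]
  let ?P = "A [^]\<^bsub>ideal_group K\<^esub> deg"
  have mem: "z ^ deg \<in> ?P" "z ^ deg \<in> RN (ext A)" if "z \<in> A" for z
    using K.ideal_pow_mem[OF that] RN_mem[OF subsetD[OF ext_inc that]] norm_base[OF subsetD[OF AK that]]
    by simp_all
  have loc: "\<exists>s. \<exists>z\<in>A. [s ^ deg = 1] (mod m) \<and>
      (\<forall>x\<in>RN (ext A) \<union> ?P. of_int (s ^ deg) * x \<in> (*) (z ^ deg) ` \<O> K)" if m: "(m::int) > 0" for m
  proof -
    obtain z s where z: "z \<in> A" "[s = 1] (mod m)" "\<forall>x\<in>A. of_int s * x \<in> (*) z ` \<O> K"
      by (rule K.semilocal_generator[OF A m])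
    have zK: "z \<in> K" by (rule subsetD[OF AK z(1)])
    have ez: "of_int s * y \<in> (*) z ` \<O> E" if "y \<in> ext A" for y
      by (rule ext_principal_bound[OF bspec[OF z(3)] that])
    have "of_int (s ^ deg) * x \<in> (*) (z ^ deg) ` \<O> K" if "x \<in> RN (ext A)" for x
      using RN_principal_bound[OF E.fractional_sub[OF eA] subsetD[OF sub zK] ez that] norm_base[OF zK]
      by simp
    moreover have "of_int (s ^ deg) * x \<in> (*) (z ^ deg) ` \<O> K" if "x \<in> ?P" for x
      using K.ideal_pow_principal_bound[OF z(3)[rule_format] that] by simp
    moreover have "[s ^ deg = 1] (mod m)" using cong_pow[OF z(2), of deg] by simp
    ultimately show ?thesis using z(1) by blast
  qed
  have "RN (ext A) \<subseteq> ?P"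
    by (rule K.submodule_subset_if_local[OF K.ideal_pow_submodule]) (use loc mem(1) in blast)
  moreover have "?P \<subseteq> RN (ext A)"
    by (rule K.submodule_subset_if_local[OF RN_submodule]) (use loc mem(2) in blast)
  ultimately show ?thesis by (rule antisym)
qed

lemma RN_hom: "relative_norm E K \<in> hom (ideal_group E) (ideal_group K)"
  by (rule homI) (simp_all add: RN_fractional RN_mult)

end

section \<open>The norm from a composite field\<close>

text \<open>The transition matrices are square, so \<open>P * Q = 1\<close> gives
  \<open>Q * P = 1\<close>. A relation among \<open>bs\<close> is a row annihilated by
  \<open>Q\<close>, hence zero.\<close>

lemma is_basis_if_spanning:
  fixes E :: "'a::field_char_0 set"
  assumes K: "subfld K" and cs: "is_basis K E cs" and len: "length cs = length bs" and bsE: "set bs \<subseteq> E"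
    and span: "\<forall>x\<in>E. \<exists>c. (\<forall>j<length bs. c j \<in> K) \<and> x = (\<Sum>j<length bs. c j * bs ! j)"
  shows "is_basis K E bs"
proof -
  interpret subfld K by (rule K)
  let ?q = "length bs"
  obtain P Q where P: "P \<in> carrier_mat ?q ?q" and Q: "Q \<in> carrier_mat ?q ?q" "elements_mat Q \<subseteq> K"
      "\<forall>i<?q. bs ! i = (\<Sum>j<?q. Q $$ (i, j) * cs ! j)" and PQ: "P * Q = 1\<^sub>m ?q"
    using spanning_change[OF K cs len bsE span] by (elim exE conjE)
  have QP: "Q * P = 1\<^sub>m ?q" by (rule mat_mult_left_right_inverse[OF P Q(1) PQ])
  have indep: "c j = 0" if c: "\<And>j. j < ?q \<Longrightarrow> c j \<in> K" "(\<Sum>j<?q. c j * bs ! j) = 0" and j: "j < ?q" for c j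
  proof -
    define C where "C = mat 1 ?q (\<lambda>(i, j). c j)"
    have C: "C \<in> carrier_mat 1 ?q" "elements_mat C \<subseteq> K"
      using c(1) by (auto simp: C_def elements_mat_subset_iff[of _ 1 ?q])
    have "C * Q = 0\<^sub>m 1 ?q"
    proof (rule basis_mat_unique[OF K cs])
      show "elements_mat (C * Q) \<subseteq> K"
        by (rule subfld_mat_mult[OF K C(1) Q(1) C(2) Q(2)])
      show "elements_mat (0\<^sub>m 1 ?q :: 'a mat) \<subseteq> K" by (subst elements_mat_subset_iff[of _ 1 ?q]) auto
      fix i :: nat assume i: "i < 1"
      have "(\<Sum>l<?q. (C * Q) $$ (i, l) * cs ! l) = (\<Sum>j<?q. C $$ (i, j) * bs ! j)"
        unfolding mult_mat_comb[OF C(1) Q(1) i, symmetric] by (rule sum.cong[OF refl]) (simp add: Q(3))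
      also have "\<dots> = 0" using c(2) i by (simp add: C_def)
      finally show "(\<Sum>l<length cs. (C * Q) $$ (i, l) * cs ! l) =
        (\<Sum>l<length cs. 0\<^sub>m 1 ?q $$ (i, l) * cs ! l)" using i by (simp add: len)
    qed (use C Q len in auto)
    then have "C * Q * P = 0\<^sub>m 1 ?q" using P by simp
    then have "C = 0\<^sub>m 1 ?q" using assoc_mult_mat[OF C(1) Q(1) P] QP C(1) by simp
    then have "C $$ (0, j) = 0" using j by simp
    then show "c j = 0" using j by (simp add: C_def)
  qed
  show ?thesis
    unfolding is_basis_def using bsE span indep by (intro conjI ballI allI impI) blast+
qed

text \<open>The \<open>L\<close>-combinations of an \<open>F\<close>-basis of \<open>K\<close> form
  a subfield containing \<open>L\<close> and \<open>K\<close>: products stay inside because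
  \<open>F \<subseteq> L\<close>, inverses because the elements are algebraic. So they exhaust the
  composite.\<close>

lemma composite_spanned:
  assumes NL: "numfld_ext L N q" and KF: "numfld_ext F K q" and N: "N = composite L K"
    and FL: "F \<subseteq> L" and KN: "K \<subseteq> N" and bs: "is_basis F K bs" "length bs = q"
    and x: "x \<in> N"
  shows "\<exists>c. (\<forall>j<q. c j \<in> L) \<and> x = (\<Sum>j<q. c j * bs ! j)"
proof -
  interpret NL: numfld_ext L N q by (rule NL)
  interpret KF: numfld_ext F K q by (rule KF)
  define S where "S = {\<Sum>j<q. c j * bs ! j | c. \<forall>j<q. c j \<in> L}"
  have bsN: "bs ! j \<in> N" if "j < q" for j using is_basis_nth[OF bs(1)] bs(2) that KN by auto
  have S_I: "(\<Sum>j<q. c j * bs ! j) \<in> S" if "\<And>j. j < q \<Longrightarrow> c j \<in> L" for c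
    using that unfolding S_def by blast
  have S_add: "x + y \<in> S" if xy: "x \<in> S" "y \<in> S" for x y
  proof -
    obtain c d where "\<forall>j<q. c j \<in> L" "x = (\<Sum>j<q. c j * bs ! j)"
      "\<forall>j<q. d j \<in> L" "y = (\<Sum>j<q. d j * bs ! j)" using xy unfolding S_def by blast
    then show ?thesis using S_I[of "\<lambda>j. c j + d j"] by (auto simp: distrib_right sum.distrib)
  qed
  have S_scale: "l * x \<in> S" if l: "l \<in> L" and x: "x \<in> S" for l x
  proof -
    obtain c where "\<forall>j<q. c j \<in> L" "x = (\<Sum>j<q. c j * bs ! j)" using x unfolding S_def by blast
    then show ?thesis using S_I[of "\<lambda>j. l * c j"] l by (auto simp: sum_distrib_left mult.assoc)
  qed
  have S_0: "0 \<in> S" using S_I[of "\<lambda>_. 0"] by simp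
  have S_sum: "(\<Sum>i\<in>I. f i) \<in> S" if "\<And>i. i \<in> I \<Longrightarrow> f i \<in> S" for I :: "nat set" and f
    using that by (induction I rule: infinite_finite_induct) (auto simp: S_0 S_add)
  have KS: "K \<subseteq> S"
  proof
    fix x assume "x \<in> K"
    then obtain c where "\<forall>j<q. c j \<in> F" "x = (\<Sum>j<q. c j * bs ! j)"
      using bs unfolding is_basis_def by blast
    then show "x \<in> S" using S_I[of c] FL by auto
  qed
  have S_K: "k * x \<in> S" if k: "k \<in> K" and x: "x \<in> S" for k x
  proof -
    obtain c where c: "\<forall>j<q. c j \<in> L" "x = (\<Sum>j<q. c j * bs ! j)" using x unfolding S_def by blast
    have "k * x = (\<Sum>j<q. c j * (k * bs ! j))" unfolding c(2) by (simp add: sum_distrib_left mult_ac)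
    also have "\<dots> \<in> S"
    proof (rule S_sum)
      fix j assume j: "j \<in> {..<q}"
      then have "k * bs ! j \<in> S" using is_basis_nth[OF bs(1)] bs(2) k KS by auto
      then show "c j * (k * bs ! j) \<in> S" using c(1) j by (intro S_scale[of "c j" "k * bs ! j"]) auto
    qed
    finally show ?thesis .
  qed
  have S_mult: "x * y \<in> S" if x: "x \<in> S" and y: "y \<in> S" for x y
  proof -
    obtain c where c: "\<forall>j<q. c j \<in> L" "x = (\<Sum>j<q. c j * bs ! j)" using x unfolding S_def by blast
    have "x * y = (\<Sum>j<q. c j * (bs ! j * y))" unfolding c(2) by (simp add: sum_distrib_right mult.assoc)
    also have "\<dots> \<in> S"
    proof (rule S_sum)
      fix j assume j: "j \<in> {..<q}"
      have "bs ! j * y \<in> S" using is_basis_nth[OF bs(1)] bs(2) j by (intro S_K y) auto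
      then show "c j * (bs ! j * y) \<in> S" using c(1) j by (intro S_scale[of "c j"]) auto
    qed
    finally show ?thesis .
  qed
  have S_1: "1 \<in> S" using KS by auto
  have LS: "L \<subseteq> S" using S_scale[OF _ S_1] by auto
  have SN: "S \<subseteq> N" using bsN NL.sub unfolding S_def by (auto intro!: NL.E.sum NL.E.mult)
  have S_inverse: "inverse x \<in> S" if x: "x \<in> S" for x
  proof (cases "x = 0")
    case True
    then show ?thesis by (simp add: S_0)
  next
    case False
    \<comment> \<open>Write the annihilating polynomial as \<open>c + X * r(X)\<close> with
      \<open>c \<noteq> 0\<close>; then \<open>inverse x\<close> is \<open>- r(x) / c\<close>, a
      polynomial expression in \<open>x\<close>.\<close>
    have "algebraic x" using x SN by (intro NL.E.algebraic) auto
    then obtain p where p: "poly.coeff p 0 \<noteq> 0" "poly (map_poly of_int p) x = 0"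
      using False by (rule algebraicE'_nonzero)
    obtain c r where cr: "p = pCons c r" by (cases p)
    have c0: "of_int c + x * poly (map_poly of_int r) x = 0" "c \<noteq> 0"
      using p unfolding cr by (simp_all add: map_poly_pCons)
    have "of_int i \<in> S" for i using LS by auto
    then have "poly (map_poly of_int r) x \<in> S"
      by (induction r) (simp_all add: map_poly_pCons S_0 S_add S_mult x)
    then have "(- inverse (of_int c)) * poly (map_poly of_int r) x \<in> S"
      by (intro S_scale NL.K.uminus NL.K.inverse) auto
    moreover have "(- inverse (of_int c)) * poly (map_poly of_int r) x = inverse x"
    proof -
      have "x * poly (map_poly of_int r) x = - of_int c"
        using c0(1) by (simp add: eq_neg_iff_add_eq_0 add.commute)
      then have "poly (map_poly of_int r) x = - of_int c / x" using False by (simp add: field_simps)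
      then show ?thesis using c0(2) False by (simp add: field_simps)
    qed
    ultimately show ?thesis by simp
  qed
  have S_uminus: "- x \<in> S" if "x \<in> S" for x
    using S_scale[OF NL.K.uminus[OF NL.K.one] that] by simp
  have "subfield S ambient"
    unfolding subfield_ambient_iff
    by (intro conjI ballI S_0 S_1 S_add S_mult S_inverse S_uminus)
  then have "N \<subseteq> S"
    unfolding N composite_def
    using LS KS by (intro field.generate_field_min_subfield1[OF field_from_type_algebra]) auto
  then show ?thesis using x unfolding S_def by blast
qed

lemma composite_basis:
  assumes NL: "numfld_ext L N q" and KF: "numfld_ext F K q" and N: "N = composite L K"
    and FL: "F \<subseteq> L" and KN: "K \<subseteq> N" and bs: "is_basis F K bs" "length bs = q"
  shows "is_basis L N bs"
proof -
  interpret NL: numfld_ext L N q by (rule NL)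
  obtain cs where cs: "is_basis L N cs" "length cs = q" by (rule NL.integral_basis)
  show ?thesis
  proof (rule is_basis_if_spanning[OF NL.K.subfld_axioms cs(1)])
    show "set bs \<subseteq> N" using bs(1) KN by (auto simp: is_basis_def)
  qed (use bs(2) cs(2) composite_spanned[OF NL KF N FL KN bs] in simp_all)
qed

text \<open>An \<open>F\<close>-basis of \<open>K\<close> is an \<open>L\<close>-basis of
  \<open>N\<close>, so one matrix over \<open>F\<close> represents multiplication by
  \<open>x\<close> in both extensions.\<close>

lemma composite_norm:
  assumes NL: "numfld_ext L N q" and KF: "numfld_ext F K q" and N: "N = composite L K"
    and FL: "F \<subseteq> L" and KN: "K \<subseteq> N" and x: "x \<in> K"
  shows "field_norm N L x = field_norm K F x"
proof -
  interpret NL: numfld_ext L N q by (rule NL)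
  interpret KF: numfld_ext F K q by (rule KF)
  obtain bs where bs: "is_basis F K bs" "length bs = q" "basis_ext F K bs" by (rule KF.integral_basis)
  have M: "mult_matrix F bs x (basis_ext.mmat F bs x)"
    by (rule basis_ext.mult_matrix_mmat[OF bs(3) x])
  then have "mult_matrix L bs x (basis_ext.mmat F bs x)" using FL by (auto simp: mult_matrix_def)
  then have "field_norm N L x = det (basis_ext.mmat F bs x)"
    using x KN by (intro NL.norm_eq_det[OF composite_basis[OF NL KF N FL KN bs(1,2)] bs(2)]) auto
  then show ?thesis using KF.norm_eq_det[OF bs(1,2) M x] by simp
qed

text \<open>Local generators of \<open>A\<close> lie in \<open>K\<close>, where the two norms agree.
  This is what makes the induced norm well defined on classes modulo ideals of
  \<open>K\<close>.\<close>

lemma relative_norm_ext_composite: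
  assumes NL: "numfld_ext L N q" and KF: "numfld_ext F K q" and NK: "numfld_ext K N p"
    and LF: "numfld_ext F L p" and N: "N = composite L K" and A: "fractional_ideal K A"
  shows "relative_norm N L (ideal_extension N A) = ideal_extension L (relative_norm K F A)"
proof
  interpret NL: numfld_ext L N q by (rule NL)
  interpret KF: numfld_ext F K q by (rule KF)
  interpret NK: numfld_ext K N p by (rule NK)
  interpret LF: numfld_ext F L p by (rule LF)
  note AK = KF.E.fractional_sub[OF A] and eA = NK.ext_fractional[OF A]
  have norm: "field_norm N L x = field_norm K F x" if "x \<in> K" for x
    by (rule composite_norm[OF NL KF N LF.sub NK.sub that])
  show "relative_norm N L (ideal_extension N A) \<subseteq> ideal_extension L (relative_norm K F A)"
    (is "?R \<subseteq> ?M")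
  proof (rule NL.K.submodule_subset_if_local[OF LF.ext_submodule])
    fix m :: int assume m: "m > 0"
    obtain z s where z: "z \<in> A" "[s = 1] (mod m)" "\<forall>x\<in>A. of_int s * x \<in> (*) z ` \<O> K"
      by (rule KF.E.semilocal_generator[OF A m])
    have zK: "z \<in> K" by (rule subsetD[OF AK z(1)])
    have ez: "of_int s * y \<in> (*) z ` \<O> N" if "y \<in> ideal_extension N A" for y
      by (rule NK.ext_principal_bound[OF bspec[OF z(3)] that])
    have "of_int (s ^ q) * x \<in> (*) (field_norm K F z) ` \<O> L" if "x \<in> ?R" for x
      using NL.RN_principal_bound[OF NL.E.fractional_sub[OF eA] subsetD[OF NK.sub zK] ez that] norm[OF zK]
      by simp
    moreover have "field_norm K F z \<in> ?M" by (rule subsetD[OF LF.ext_inc KF.RN_mem[OF z(1)]])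
    moreover have "[s ^ q = 1] (mod m)" using cong_pow[OF z(2), of q] by simp
    ultimately show "\<exists>s. \<exists>w\<in>?M. [s = 1] (mod m) \<and> (\<forall>x\<in>?R. of_int s * x \<in> (*) w ` \<O> L)" by blast
  qed
  show "?M \<subseteq> relative_norm N L (ideal_extension N A)"
  proof (rule LF.ext_min[OF NL.RN_submodule])
    show "relative_norm K F A \<subseteq> relative_norm N L (ideal_extension N A)"
    proof (rule KF.RN_min[OF LF.submodule_base[OF NL.RN_submodule]])
      fix a assume a: "a \<in> A"
      have "field_norm N L a \<in> relative_norm N L (ideal_extension N A)"
        by (rule NL.RN_mem[OF subsetD[OF NK.ext_inc a]])
      then show "field_norm K F a \<in> relative_norm N L (ideal_extension N A)"
        using norm[OF subsetD[OF AK a]] by simp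
    qed
  qed
qed

lemma ext_trans:
  assumes LN: "numfld_ext L N q" and FL: "numfld_ext F L p" and FN: "F \<subseteq> N"
  shows "ideal_extension N (ideal_extension L B) = ideal_extension N B"
proof -
  interpret LN: numfld_ext L N q by (rule LN)
  interpret FL: numfld_ext F L p by (rule FL)
  show ?thesis
  proof
    show "ideal_extension N (ideal_extension L B) \<subseteq> ideal_extension N B"
      by (intro LN.ext_min LN.ext_submodule FL.ext_min LN.submodule_base LN.ext_inc)
    show "ideal_extension N B \<subseteq> ideal_extension N (ideal_extension L B)"
      by (intro LN.ext_min LN.ext_submodule subset_trans[OF FL.ext_inc LN.ext_inc])
  qed
qed

section \<open>Finiteness of the space of primitive ambiguous ideals\<close>

text \<open>In the binomial expansion each product \<open>s ^ k * t ^ (p - k) * d\<close> has the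
  integral \<open>p\<close>-th power \<open>(s ^ p * d) ^ k * (t ^ p * d) ^ (p - k)\<close>, hence
  is integral. So integrality of \<open>x ^ p * d\<close>, the test for membership in an ambiguous
  ideal, passes to sums.\<close>

lemma algebraic_int_power_mult_add:
  fixes s t d :: "'b::field"
  assumes p: "p > 0" and s: "algebraic_int (s ^ p * d)" and t: "algebraic_int (t ^ p * d)"
  shows "algebraic_int ((s + t) ^ p * d)"
proof -
  have "algebraic_int (s ^ k * t ^ (p - k) * d)" if k: "k \<le> p" for k
  proof -
    have "(s ^ k * t ^ (p - k) * d) ^ p = (s ^ p) ^ k * (t ^ p) ^ (p - k) * d ^ p"
      by (simp add: power_mult_distrib power_mult[symmetric] mult.commute)
    also have "d ^ p = d ^ k * d ^ (p - k)" using k by (simp flip: power_add)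
    finally have "(s ^ k * t ^ (p - k) * d) ^ p = (s ^ p * d) ^ k * (t ^ p * d) ^ (p - k)"
      by (simp add: power_mult_distrib mult_ac)
    moreover have "algebraic_int ((s ^ p * d) ^ k * (t ^ p * d) ^ (p - k))"
      by (intro algebraic_int_mult algebraic_int_pow s t)
    ultimately have "algebraic_int ((s ^ k * t ^ (p - k) * d) ^ p)" by simp
    then show ?thesis using p by (rule algebraic_int_root')
  qed
  then have "algebraic_int (\<Sum>k\<le>p. of_int (int (p choose k)) * (s ^ k * t ^ (p - k) * d))"
    by (intro algebraic_int_sum algebraic_int_mult[OF algebraic_int_of_int']) auto
  also have "(\<Sum>k\<le>p. of_int (int (p choose k)) * (s ^ k * t ^ (p - k) * d)) = (s + t) ^ p * d"
    by (simp add: binomial_ring sum_distrib_right mult.assoc)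
  finally show ?thesis .
qed

text \<open>Since \<open>d\<close> lies in \<open>K\<close>, the integral equation of
  \<open>x ^ p * d\<close> is a polynomial equation for \<open>x\<close> over \<open>K\<close>, and
  every eigenvalue \<open>l\<close> of multiplication by \<open>x\<close> satisfies it. So each
  \<open>l ^ p * d\<close> is integral, and integrality passes to the sum of the
  eigenvalues.\<close>

lemma (in basis_ext) trace_power_algebraic_int:
  assumes x: "x \<in> E" and d: "d \<in> K" and p: "p > 0" and int: "algebraic_int (x ^ p * d)"
  shows "algebraic_int (trace x ^ p * d)"
proof -
  obtain ls where ls: "to_ac (trace x) = sum_list ls"
    "\<And>l. l \<in> set ls \<Longrightarrow> eigenvalue (map_mat to_ac (mmat x)) l"
    using trace_eigenvalues[of x] by blast
  obtain m c where mc: "(x ^ p * d) ^ m = (\<Sum>k<m. of_int (c k :: int) * (x ^ p * d) ^ k)"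
    using int by (auto simp: algebraic_int_iff_power)
  \<comment> \<open>The coefficients, in powers of \<open>X ^ p\<close>, of
    \<open>(d * X ^ p) ^ m - (\<Sum>k<m. c k * (d * X ^ p) ^ k)\<close>.\<close>
  define a where "a k = (if k = m then d ^ m else of_int (- c k) * d ^ k)" for k
  have aK: "a k \<in> K" for k using d by (auto simp: a_def intro!: K.mult K.power)
  define g where "g = (\<Sum>k<Suc m. Polynomial.monom (a k) (p * k))"
  have gK: "poly.coeff g k \<in> K" for k
    unfolding g_def coeff_sum by (intro K.sum) (simp add: aK)
  \<comment> \<open>The coefficient map \<open>h\<close> is abstract so that one computation serves
    for \<open>x\<close>, with the identity, and for the eigenvalues, with
    \<open>to_ac\<close>.\<close>
  have eval: "(\<Sum>k<Suc m. h (a k) * y ^ (p * k)) =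
      (y ^ p * h d) ^ m - (\<Sum>k<m. of_int (c k) * (y ^ p * h d) ^ k)"
    if h: "\<And>k. h (d ^ k) = h d ^ k" "\<And>i z. h (of_int i * z) = of_int i * h z" for h :: "'a \<Rightarrow> 'b::field" and y
  proof -
    have "(\<Sum>k<m. h (a k) * y ^ (p * k)) = (\<Sum>k<m. - (of_int (c k) * (y ^ p * h d) ^ k))"
    proof (rule sum.cong[OF refl])
      fix k assume "k \<in> {..<m}"
      then have "h (a k) = of_int (- c k) * h d ^ k"
        using h(2)[of "- c k" "d ^ k"] h(1)[of k] by (simp add: a_def)
      then show "h (a k) * y ^ (p * k) = - (of_int (c k) * (y ^ p * h d) ^ k)"
        by (simp only: power_mult power_mult_distrib of_int_minus) (simp add: mult_ac)
    qed
    moreover have "h (a m) * y ^ (p * m) = (y ^ p * h d) ^ m"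
      by (simp only: a_def h power_mult power_mult_distrib simp_thms if_True) (simp add: mult.commute)
    ultimately show ?thesis by (simp add: sum_negf)
  qed
  have "poly g x = (\<Sum>k<Suc m. a k * x ^ (p * k))"
    by (simp only: g_def poly_sum poly_monom)
  also have "\<dots> = 0" using eval[of "\<lambda>y. y" x] mc by simp
  finally have root: "poly g x = 0" .
  have "map_poly to_ac g = (\<Sum>k<Suc m. Polynomial.monom (to_ac (a k)) (p * k))"
    by (rule poly_eqI) (simp only: coeff_map_poly to_ac_0 g_def coeff_sum coeff_monom to_ac_sum if_distrib[of to_ac])
  then have mg: "poly (map_poly to_ac g) l = (l ^ p * to_ac d) ^ m - (\<Sum>k<m. of_int (c k) * (l ^ p * to_ac d) ^ k)" for l
    using eval[of to_ac l] by (simp only: poly_sum poly_monom to_ac_power to_ac_mult to_ac_of_int)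
  have "algebraic_int (l ^ p * to_ac d)" if "l \<in> set ls" for l
  proof -
    have "(l ^ p * to_ac d) ^ m = (\<Sum>k<m. of_int (c k) * (l ^ p * to_ac d) ^ k)"
      using eigenvalue_mmat_root[OF x ls(2)[OF that] gK root] mg by simp
    then show ?thesis unfolding algebraic_int_iff_power by blast
  qed
  then have "algebraic_int (sum_list ls ^ p * to_ac d)"
    using p by (induction ls) (simp_all add: zero_power algebraic_int_power_mult_add)
  then have "algebraic_int (to_ac (trace x ^ p * d))" by (simp add: ls(1))
  then show ?thesis by (simp only: algebraic_int_to_ac_iff)
qed

text \<open>Such a \<open>B\<close> is determined by the residues of \<open>d * B\<close> modulo
  \<open>d\<close>: if \<open>d * x\<close> and \<open>d * y\<close> agree there, then
  \<open>x - y\<close> is integral and lies in each of these modules.\<close>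

lemma (in numfld) finite_bounded_overmodules:
  assumes d: "(d::int) > 0"
  shows "finite {B. int_submodule E B \<and> \<O> E \<subseteq> B \<and> (\<forall>x\<in>B. of_int d * x \<in> \<O> E)}" (is "finite ?F")
proof -
  obtain \<kappa> :: "'a \<Rightarrow> int list" where fin: "finite (\<kappa> ` \<O> E)"
    and \<kappa>: "\<And>x y. x \<in> \<O> E \<Longrightarrow> y \<in> \<O> E \<Longrightarrow> \<kappa> x = \<kappa> y \<Longrightarrow> \<exists>z\<in>\<O> E. x - y = of_int d * z"
    using O_mod_finite[OF numfld_axioms d] by blast
  define f where "f B = (\<lambda>x. \<kappa> (of_int d * x)) ` B" for B
  have le: "B \<subseteq> B'" if B: "B \<in> ?F" and B': "B' \<in> ?F" and eq: "f B = f B'" for B B'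
  proof
    fix x assume x: "x \<in> B"
    then have "\<kappa> (of_int d * x) \<in> f B'" using eq by (auto simp: f_def)
    then obtain y where y: "y \<in> B'" "\<kappa> (of_int d * x) = \<kappa> (of_int d * y)" by (auto simp: f_def)
    have "of_int d * x \<in> \<O> E" "of_int d * y \<in> \<O> E" using B B' x y(1) by auto
    then obtain z where z: "z \<in> \<O> E" "of_int d * x - of_int d * y = of_int d * z"
      using \<kappa>[OF _ _ y(2)] by blast
    have "of_int d * (x - y) = of_int d * z" using z(2) by (simp only: right_diff_distrib)
    then have "x - y = z" using d by simp
    then have "x = y + z" by (simp add: diff_eq_eq add.commute)
    moreover have "z \<in> B'" using z(1) B' by auto
    ultimately show "x \<in> B'" using submodule_add[of E B' y z] y(1) B' by simp
  qed
  have "inj_on f ?F"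
  proof (rule inj_onI)
    fix B B' assume "B \<in> ?F" "B' \<in> ?F" "f B = f B'"
    then show "B = B'" using le[of B B'] le[of B' B] by auto
  qed
  moreover have "f ` ?F \<subseteq> Pow (\<kappa> ` \<O> E)" by (auto simp: f_def)
  ultimately show ?thesis using finite_imageD finite_subset fin by (metis (no_types, lifting) finite_Pow_iff)
qed

context numfld_ext
begin

text \<open>Dividing an ambiguous ideal \<open>A\<close> by \<open>A \<inter> K\<close> yields an ambiguous \<open>B \<supseteq> \<O> E\<close> with
  \<open>B \<inter> K = \<O> K\<close>. The trace maps \<open>B\<close> into \<open>B\<close>, hence into \<open>\<O> K\<close>, so \<open>B\<close> is
  contained in the inverse different.\<close>

lemma ambiguous_reduction:
  assumes A: "fractional_ideal E A" and p: "(p::nat) > 0"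
    and amb: "A [^]\<^bsub>ideal_group E\<^esub> p \<in> extended_ideals E K" and bas: "basis_ext K E bs"
  shows "\<exists>B b. fractional_ideal E B \<and> fractional_ideal K b \<and> A = ideal_mult E B (ext b) \<and>
    \<O> E \<subseteq> B \<and> (\<forall>x\<in>B. basis_ext.trace K bs x \<in> \<O> K)"
proof -
  interpret bas: basis_ext K E bs by (rule bas)
  note AE = E.fractional_sub[OF A] and As = E.fractional_submodule[OF A]
  obtain C where C: "fractional_ideal K C" "A [^]\<^bsub>ideal_group E\<^esub> p = ext C"
    using amb by (auto simp: extended_ideals_iff)
  define b where "b = A \<inter> K"
  have b: "fractional_ideal K b"
  proof -
    obtain m :: int where m: "m > 0" "\<And>x. x \<in> A \<Longrightarrow> of_int m * x \<in> \<O> E"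
      using E.fractional_int_denominator[OF A] by blast
    obtain l :: int where l: "l > 0" "of_int l \<in> A" using E.fractional_contains_int[OF A] by blast
    show ?thesis
    proof (rule K.fractionalI)
      show "b \<subseteq> K" by (simp add: b_def)
      show "int_submodule K b"
        unfolding b_def using int_submodule_Inter[of "{A, K}" K] submodule_base[OF As] K.submodule_field by auto
      show "of_int l \<in> b" "of_int l \<noteq> (0::'a)" using l by (auto simp: b_def)
      show "m \<noteq> 0" using m by simp
      fix x assume "x \<in> b"
      then have "of_int m * x \<in> \<O> E" "of_int m * x \<in> K" using m by (auto simp: b_def)
      then show "of_int m * x \<in> \<O> K" by (simp add: ring_of_integers_def)
    qed
  qed
  define D where "D = K.ideal_inverse b"
  have D: "fractional_ideal K D" unfolding D_def by (rule K.fractional_ideal_inverse[OF b])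
  have Db: "ideal_mult K D b = \<O> K" unfolding D_def by (rule K.ideal_inverse_mult[OF b])
  define B where "B = ideal_mult E A (ext D)"
  have B: "fractional_ideal E B" unfolding B_def by (rule E.fractional_mult[OF A ext_fractional[OF D]])
  note Bs = E.fractional_submodule[OF B] and BE = E.fractional_sub[OF B]
  have AB: "A = ideal_mult E B (ext b)"
  proof -
    have "ideal_mult E B (ext b) = ideal_mult E A (ext (ideal_mult K D b))"
      by (simp add: B_def E.ideal_mult_assoc ext_mult)
    also have "\<dots> = A"
      unfolding Db ext_one using E.ideal_mult_one[OF As] E.ideal_mult_commute by metis
    finally show ?thesis by simp
  qed
  have "ideal_mult K D b \<subseteq> B"
  proof (rule K.ideal_mult_min[OF submodule_base[OF Bs]])
    fix d t assume "d \<in> D" "t \<in> b"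
    then have "t * d \<in> B" unfolding B_def by (intro E.ideal_mult_mem subsetD[OF ext_inc]) (auto simp: b_def)
    then show "d * t \<in> B" by (simp add: mult.commute)
  qed
  then have "1 \<in> B" unfolding Db by auto
  then have OB: "\<O> E \<subseteq> B" using submodule_mult[OF Bs, where x = 1] by fastforce
  \<comment> \<open>For such \<open>y\<close> the product \<open>y * b\<close> stays in
    \<open>A \<inter> K = b\<close>; cancelling \<open>b\<close> by its inverse \<open>D\<close>
    shows that \<open>y\<close> is integral.\<close>
  have BK: "y \<in> \<O> K" if y: "y \<in> B" "y \<in> K" for y
  proof -
    have yt: "y * t \<in> b" if "t \<in> b" for t
    proof -
      have "y * t \<in> A"
        by (subst AB) (rule E.ideal_mult_mem[OF y(1) subsetD[OF ext_inc that]])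
      moreover have "t \<in> K" using that by (simp add: b_def)
      then have "y * t \<in> K" by (rule K.mult[OF y(2)])
      ultimately show ?thesis by (simp add: b_def)
    qed
    have "ideal_mult K D b \<subseteq> {x. y * x \<in> \<O> K}"
    proof (rule K.ideal_mult_min[OF K.submodule_scaled[OF K.submodule_O]])
      fix d t assume d: "d \<in> D" and t: "t \<in> b"
      have "d * (y * t) \<in> \<O> K" using d yt[OF t] by (simp add: D_def K.ideal_inverse_def)
      then show "d * t \<in> {x. y * x \<in> \<O> K}" by (simp add: mult_ac)
    qed
    then have "y * 1 \<in> \<O> K" unfolding Db by blast
    then show ?thesis by simp
  qed
  have "\<exists>c. fractional_ideal K c \<and> B [^]\<^bsub>ideal_group E\<^esub> p = ext c"
  proof (intro exI conjI)
    let ?c = "ideal_mult K C (D [^]\<^bsub>ideal_group K\<^esub> p)"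
    have Dp: "fractional_ideal K (D [^]\<^bsub>ideal_group K\<^esub> p)" using K.I.nat_pow_closed[of D p] D by simp
    show "fractional_ideal K ?c" by (rule K.fractional_mult[OF C(1) Dp])
    have "B [^]\<^bsub>ideal_group E\<^esub> p = ideal_mult E (ext C) (ext D [^]\<^bsub>ideal_group E\<^esub> p)"
      unfolding B_def using E.I.nat_pow_distrib[of A "ext D" p] A ext_fractional[OF D] C(2) by simp
    also have "ext D [^]\<^bsub>ideal_group E\<^esub> p = ext (D [^]\<^bsub>ideal_group K\<^esub> p)"
      using group_hom.hom_nat_pow[OF ext_group_hom, of D p] D by simp
    finally show "B [^]\<^bsub>ideal_group E\<^esub> p = ext ?c" by (simp add: ext_mult)
  qed
  then obtain c where c: "fractional_ideal K c" "B [^]\<^bsub>ideal_group E\<^esub> p = ext c" by blast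
  define c' where "c' = K.ideal_inverse c"
  have c': "fractional_ideal K c'" unfolding c'_def by (rule K.fractional_ideal_inverse[OF c(1)])
  have cc': "ideal_mult E (ext c') (ext c) = \<O> E"
    using K.ideal_inverse_mult[OF c(1)] ext_mult ext_one by (metis c'_def)
  define B' where "B' = E.ideal_inverse B"
  have B': "fractional_ideal E B'" unfolding B'_def by (rule E.fractional_ideal_inverse[OF B])
  have B'B: "ideal_mult E B' B = \<O> E" unfolding B'_def by (rule E.ideal_inverse_mult[OF B])
  have B'p: "B' [^]\<^bsub>ideal_group E\<^esub> p = ext c'"
  proof -
    have "ideal_mult E (B' [^]\<^bsub>ideal_group E\<^esub> p) (B [^]\<^bsub>ideal_group E\<^esub> p) = \<O> E"
      using E.I.nat_pow_distrib[of B' B p] B B' B'B E.I.nat_pow_one[of p] by simp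
    then have "ideal_mult E (B' [^]\<^bsub>ideal_group E\<^esub> p) (ext c) = ideal_mult E (ext c') (ext c)"
      using c(2) cc' by simp
    then show ?thesis
      using E.I.r_cancel[of "B' [^]\<^bsub>ideal_group E\<^esub> p" "ext c" "ext c'"] E.I.nat_pow_closed[of B' p]
        B' ext_fractional[OF c(1)] ext_fractional[OF c'] by simp
  qed
  have tr: "bas.trace x \<in> \<O> K" if x: "x \<in> B" for x
  proof -
    have xE: "x \<in> E" by (rule subsetD[OF BE x])
    have trK: "bas.trace x \<in> K" by (rule bas.trace_in[OF xE])
    \<comment> \<open>Here ambiguity enters: \<open>x ^ p\<close> lies in \<open>ext c\<close>, and
      the inverse of \<open>c\<close> consists of elements \<open>d\<close> of \<open>K\<close>, as
      the lemma on powers of the trace requires.\<close>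
    have trd: "bas.trace x ^ p * d \<in> \<O> E" if d: "d \<in> c'" for d
    proof -
      have dK: "d \<in> K" by (rule subsetD[OF K.fractional_sub[OF c'] d])
      have "x ^ p \<in> ext c" using E.ideal_pow_mem[OF x, of p] c(2) by simp
      then have "d * x ^ p \<in> \<O> E" using E.ideal_mult_mem[OF subsetD[OF ext_inc d]] cc' by blast
      then have "algebraic_int (x ^ p * d)" by (simp add: ring_of_integers_def mult.commute)
      then have "algebraic_int (bas.trace x ^ p * d)" by (rule bas.trace_power_algebraic_int[OF xE dK p])
      moreover have "bas.trace x ^ p * d \<in> E" by (rule subsetD[OF sub K.mult[OF K.power[OF trK] dK]])
      ultimately show ?thesis by (simp add: ring_of_integers_def)
    qed
    have trext: "ext c' \<subseteq> {w. bas.trace x ^ p * w \<in> \<O> E}"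
      by (rule ext_min[OF E.submodule_scaled[OF E.submodule_O]]) (use trd in blast)
    \<comment> \<open>The trace is placed in \<open>B\<close> by way of the inverse
      \<open>B'\<close>: its product with \<open>y\<close> in \<open>B'\<close> has an integral
      \<open>p\<close>-th power, hence is integral, and multiplying by \<open>B\<close> brings the
      trace itself into \<open>B\<close>.\<close>
    have tr_inverse: "bas.trace x * y \<in> \<O> E" if y: "y \<in> B'" for y
    proof -
      have "y ^ p \<in> ext c'" using E.ideal_pow_mem[OF y, of p] B'p by simp
      then have "bas.trace x ^ p * y ^ p \<in> \<O> E" using trext by blast
      then have "algebraic_int ((bas.trace x * y) ^ p)" by (simp add: ring_of_integers_def power_mult_distrib)
      then have "algebraic_int (bas.trace x * y)" using p by (rule algebraic_int_root')
      moreover have "bas.trace x * y \<in> E"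
        by (rule E.mult[OF subsetD[OF sub trK] subsetD[OF E.fractional_sub[OF B'] y]])
      ultimately show ?thesis by (simp add: ring_of_integers_def)
    qed
    have "ideal_mult E B' B \<subseteq> {w. bas.trace x * w \<in> B}"
    proof (rule E.ideal_mult_min[OF E.submodule_scaled[OF Bs]])
      fix y t assume "y \<in> B'" "t \<in> B"
      then have "(bas.trace x * y) * t \<in> B" by (intro submodule_mult[OF Bs] tr_inverse)
      then show "y * t \<in> {w. bas.trace x * w \<in> B}" by (simp add: mult.assoc)
    qed
    then have "bas.trace x * 1 \<in> B" unfolding B'B by blast
    then show ?thesis using BK trK by simp
  qed
  show ?thesis using B b AB OB tr by blast
qed

text \<open>A reduced \<open>B\<close> is a module over \<open>\<O> E\<close>, so the trace of
  \<open>x * y\<close> is integral for \<open>x\<close> in \<open>B\<close> and all integers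
  \<open>y\<close>. One \<open>d\<close>, the same for every \<open>A\<close>, therefore bounds the
  denominators of all reduced \<open>B\<close>.\<close>

lemma ambiguous_finite_representatives:
  assumes p: "(p::nat) > 0"
  shows "\<exists>S. finite S \<and> (\<forall>A. fractional_ideal E A \<longrightarrow> A [^]\<^bsub>ideal_group E\<^esub> p \<in> extended_ideals E K \<longrightarrow>
    (\<exists>B\<in>S. \<exists>D\<in>extended_ideals E K. fractional_ideal E B \<and> A = ideal_mult E D B))"
proof -
  obtain bs where bs: "is_basis K E bs" "set bs \<subseteq> \<O> E" "basis_ext K E bs" by (rule integral_basis)
  interpret bas: basis_ext K E bs by (rule bs(3))
  obtain d :: int where d: "d > 0" "\<And>x. x \<in> E \<Longrightarrow> \<forall>y\<in>\<O> E. bas.trace (x * y) \<in> \<O> K \<Longrightarrow>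
    \<exists>c. (\<forall>j<length bs. c j \<in> \<O> K) \<and> of_int d * x = (\<Sum>j<length bs. c j * bs ! j)"
    using bas.integral_coordinates[OF K.numfld_axioms bs(2)] by blast
  let ?S = "{B. int_submodule E B \<and> \<O> E \<subseteq> B \<and> (\<forall>x\<in>B. of_int d * x \<in> \<O> E)}"
  have "\<exists>B\<in>?S. \<exists>D\<in>extended_ideals E K. fractional_ideal E B \<and> A = ideal_mult E D B"
    if A: "fractional_ideal E A" "A [^]\<^bsub>ideal_group E\<^esub> p \<in> extended_ideals E K" for A
  proof -
    obtain B b where B: "fractional_ideal E B" "fractional_ideal K b" "A = ideal_mult E B (ext b)"
      "\<O> E \<subseteq> B" "\<forall>x\<in>B. bas.trace x \<in> \<O> K"
      using ambiguous_reduction[OF A(1) p A(2) bs(3)] by blast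
    have "of_int d * x \<in> \<O> E" if x: "x \<in> B" for x
    proof -
      have "bas.trace (x * y) \<in> \<O> K" if "y \<in> \<O> E" for y
        using submodule_mult[OF E.fractional_submodule[OF B(1)] that x] B(5) by (simp add: mult.commute)
      then obtain c where c: "\<forall>j<length bs. c j \<in> \<O> K" "of_int d * x = (\<Sum>j<length bs. c j * bs ! j)"
        using d(2) x E.fractional_sub[OF B(1)] by blast
      show ?thesis
        unfolding c(2) using c(1) bs(2) O_base_sub by (intro E.O_sum E.O_mult) auto
    qed
    then have "B \<in> ?S" using E.fractional_submodule[OF B(1)] B(4) by simp
    moreover have "ext b \<in> extended_ideals E K" using B(2) by (auto simp: extended_ideals_iff)
    ultimately show ?thesis using B(1,3) E.ideal_mult_commute by blast
  qed
  then show ?thesis using E.finite_bounded_overmodules[OF d(1)] by blast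
qed

end

section \<open>Groups of prime exponent as vector spaces\<close>

lemma (in group) int_pow_mod_exponent:
  assumes x: "x \<in> carrier G" and xp: "x [^] (p::nat) = \<one>"
  shows "x [^] (k mod int p) = x [^] (k::int)"
proof -
  have "x [^] k = x [^] (int p * (k div int p) + k mod int p)" by simp
  also have "\<dots> = (x [^] int p) [^] (k div int p) \<otimes> x [^] (k mod int p)"
    by (simp only: int_pow_mult[OF x] int_pow_pow[OF x])
  also have "x [^] int p = \<one>" using xp by (simp add: int_pow_int)
  finally show ?thesis using x by simp
qed

lemma exponent_space_simps [simp]:
  "carrier (exponent_space G) = carrier G" "ring.zero (exponent_space G) = \<one>\<^bsub>G\<^esub>"
  "add (exponent_space G) = monoid.mult G" "module.smult (exponent_space G) k x = x [^]\<^bsub>G\<^esub> k"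
  by (simp_all add: exponent_space_def)

lemma field_residue_ring: "Factorial_Ring.prime (p::nat) \<Longrightarrow> field (residue_ring (int p))"
  by (rule residues_prime.is_field) (simp add: residues_prime_def)

text \<open>The carrier is replaced because the kernel enters the direct sum as
  \<open>exponent_space V\<close> with an updated carrier.\<close>

lemma vectorspace_exponent_space_subgroup:
  assumes G: "comm_group G" and H: "subgroup H G" and p: "Factorial_Ring.prime (p::nat)"
    and exp: "\<And>x. x \<in> H \<Longrightarrow> x [^]\<^bsub>G\<^esub> p = \<one>\<^bsub>G\<^esub>"
  shows "vectorspace (residue_ring (int p)) ((exponent_space G)\<lparr>carrier := H\<rparr>)"
proof -
  interpret G: comm_group G by (rule G)
  interpret H: subgroup H G by (rule H)
  have H_pow: "x [^]\<^bsub>G\<^esub> (k::int) \<in> H" if "x \<in> H" for x k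
    using G.int_pow_consistent[OF H that] group.int_pow_closed[OF H.subgroup_is_group[OF G.group_axioms]] that
    by simp
  have "abelian_group ((exponent_space G)\<lparr>carrier := H\<rparr>)"
  proof (rule abelian_groupI; simp)
    show "x \<otimes>\<^bsub>G\<^esub> y = y \<otimes>\<^bsub>G\<^esub> x" if "x \<in> H" "y \<in> H" for x y
      using that by (intro G.m_comm) auto
    show "x \<otimes>\<^bsub>G\<^esub> y \<otimes>\<^bsub>G\<^esub> z = x \<otimes>\<^bsub>G\<^esub> (y \<otimes>\<^bsub>G\<^esub> z)" if "x \<in> H" "y \<in> H" "z \<in> H" for x y z
      using that by (intro G.m_assoc) auto
    show "\<exists>y\<in>H. y \<otimes>\<^bsub>G\<^esub> x = \<one>\<^bsub>G\<^esub>" if "x \<in> H" for x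
      using that by (intro bexI[of _ "inv\<^bsub>G\<^esub> x"]) auto
  qed
  moreover have "cring (residue_ring (int p))"
    using field_residue_ring[OF p] by (simp add: field_def domain_def)
  ultimately have "module (residue_ring (int p)) ((exponent_space G)\<lparr>carrier := H\<rparr>)"
  proof (intro moduleI; simp add: residue_ring_def H_pow)
    show "x [^]\<^bsub>G\<^esub> ((a + b) mod int p) = x [^]\<^bsub>G\<^esub> a \<otimes>\<^bsub>G\<^esub> x [^]\<^bsub>G\<^esub> b" if "x \<in> H" for a b x
      using that exp by (simp add: G.int_pow_mod_exponent G.int_pow_mult)
    show "x [^]\<^bsub>G\<^esub> (a * b mod int p) = (x [^]\<^bsub>G\<^esub> b) [^]\<^bsub>G\<^esub> a" if "x \<in> H" for a b x
      using that exp by (simp add: G.int_pow_mod_exponent G.int_pow_pow mult.commute)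
    show "(x \<otimes>\<^bsub>G\<^esub> y) [^]\<^bsub>G\<^esub> a = x [^]\<^bsub>G\<^esub> a \<otimes>\<^bsub>G\<^esub> y [^]\<^bsub>G\<^esub> a" if "x \<in> H" "y \<in> H" for a :: int and x y
      using that by (intro G.int_pow_distrib) auto
  qed
  then show ?thesis using field_residue_ring[OF p] by (simp add: vectorspace_def)
qed

lemma vectorspace_exponent_space:
  assumes "comm_group G" "Factorial_Ring.prime (p::nat)"
    "\<And>x. x \<in> carrier G \<Longrightarrow> x [^]\<^bsub>G\<^esub> p = \<one>\<^bsub>G\<^esub>"
  shows "vectorspace (residue_ring (int p)) (exponent_space G)"
proof -
  have "subgroup (carrier G) G"
    using assms(1) by (simp add: comm_group_def group.subgroup_self)
  from vectorspace_exponent_space_subgroup[OF assms(1) this assms(2,3)]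
  have "vectorspace (residue_ring (int p)) ((exponent_space G)\<lparr>carrier := carrier G\<rparr>)" .
  also have "(exponent_space G)\<lparr>carrier := carrier G\<rparr> = exponent_space G"
    by (simp add: exponent_space_def)
  finally show ?thesis .
qed

lemma linear_mapI:
  assumes "vectorspace K V" "vectorspace K W" "T \<in> module_hom K V W"
  shows "linear_map K V W T"
  using assms by (simp add: linear_map_def mod_hom_def mod_hom_axioms_def vectorspace_def)

lemma linear_map_exponent_space:
  assumes G: "comm_group G" "comm_group H" and p: "Factorial_Ring.prime (p::nat)"
    and exp: "\<And>x. x \<in> carrier G \<Longrightarrow> x [^]\<^bsub>G\<^esub> p = \<one>\<^bsub>G\<^esub>" "\<And>x. x \<in> carrier H \<Longrightarrow> x [^]\<^bsub>H\<^esub> p = \<one>\<^bsub>H\<^esub>"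
    and f: "f \<in> hom G H"
  shows "linear_map (residue_ring (int p)) (exponent_space G) (exponent_space H) f"
proof (rule linear_mapI)
  show "vectorspace (residue_ring (int p)) (exponent_space G)"
    by (rule vectorspace_exponent_space[OF G(1) p exp(1)])
  show "vectorspace (residue_ring (int p)) (exponent_space H)"
    by (rule vectorspace_exponent_space[OF G(2) p exp(2)])
  have "group G" "group H" using G by (simp_all add: comm_group_def)
  then show "f \<in> module_hom (residue_ring (int p)) (exponent_space G) (exponent_space H)"
    using f hom_int_pow[OF f] by (auto simp: module_hom_def hom_def)
qed

lemma exponent_FactGroup:
  assumes G: "comm_group G" and H: "subgroup H G" and exp: "\<And>x. x \<in> carrier G \<Longrightarrow> x [^]\<^bsub>G\<^esub> (p::nat) \<in> H"
    and C: "C \<in> carrier (G Mod H)"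
  shows "C [^]\<^bsub>G Mod H\<^esub> p = \<one>\<^bsub>G Mod H\<^esub>"
proof -
  interpret G: comm_group G by (rule G)
  interpret H: normal H G by (rule G.subgroup_imp_normal[OF H])
  obtain a where a: "a \<in> carrier G" "C = H #>\<^bsub>G\<^esub> a" using C by (auto simp: FactGroup_def RCOSETS_def)
  interpret h: group_hom G "G Mod H" "\<lambda>a. H #>\<^bsub>G\<^esub> a"
    using H.r_coset_hom_Mod H.factorgroup_is_group by (simp add: group_hom_def group_hom_axioms_def)
  have "C [^]\<^bsub>G Mod H\<^esub> p = H #>\<^bsub>G\<^esub> (a [^]\<^bsub>G\<^esub> p)" using h.hom_nat_pow[OF a(1)] a(2) by simp
  also have "\<dots> = H" using exp[OF a(1)] by (rule G.coset_join2[OF G.nat_pow_closed[OF a(1)] H])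
  finally show ?thesis by (simp add: FactGroup_def)
qed

text \<open>With \<open>q * r = 1 (mod p)\<close>, the \<open>r\<close>-th power of \<open>g\<close>
  is a section \<open>s\<close> of \<open>f\<close>, so \<open>f\<close> is onto. The splitting
  sends \<open>v\<close> to \<open>f v\<close> and to \<open>h v\<close>, the quotient of
  \<open>v\<close> by \<open>s (f v)\<close>, which is the projection to the kernel along the image
  of \<open>s\<close>.\<close>

lemma split_surjection_exponent_space:
  assumes V: "comm_group V" and W: "comm_group W" and p: "Factorial_Ring.prime (p::nat)"
    and expV: "\<And>x. x \<in> carrier V \<Longrightarrow> x [^]\<^bsub>V\<^esub> p = \<one>\<^bsub>V\<^esub>" and expW: "\<And>x. x \<in> carrier W \<Longrightarrow> x [^]\<^bsub>W\<^esub> p = \<one>\<^bsub>W\<^esub>"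
    and f: "f \<in> hom V W" and g: "g \<in> hom W V"
    and fg: "\<And>w. w \<in> carrier W \<Longrightarrow> f (g w) = w [^]\<^bsub>W\<^esub> (q::nat)" and cop: "Rings.coprime q p"
  shows "vs_isomorphic (residue_ring (int p)) (exponent_space (V Mod kernel V W f)) (exponent_space W)"
    and "vs_isomorphic (residue_ring (int p)) (exponent_space V)
      (direct_sum (exponent_space W) ((exponent_space V)\<lparr>carrier := kernel V W f\<rparr>))"
proof -
  interpret V: comm_group V by (rule V)
  interpret W: comm_group W by (rule W)
  interpret f: group_hom V W f using f by (simp add: group_hom_def group_hom_axioms_def V.group_axioms W.group_axioms)
  interpret g: group_hom W V g using g by (simp add: group_hom_def group_hom_axioms_def V.group_axioms W.group_axioms)
  let ?ker = "kernel V W f"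
  obtain r where r: "[q * r = 1] (mod p)" using cong_solve_coprime_nat[OF cop] by auto
  define s where "s w = g w [^]\<^bsub>V\<^esub> r" for w
  have s_closed: "s w \<in> carrier V" if "w \<in> carrier W" for w using that by (simp add: s_def)
  have s_mult: "s (v \<otimes>\<^bsub>W\<^esub> w) = s v \<otimes>\<^bsub>V\<^esub> s w" if "v \<in> carrier W" "w \<in> carrier W" for v w
    using that by (simp add: s_def V.nat_pow_distrib)
  have fs: "f (s w) = w" if w: "w \<in> carrier W" for w
  proof -
    have "f (s w) = w [^]\<^bsub>W\<^esub> (q * r)" using w by (simp add: s_def f.hom_nat_pow fg W.nat_pow_pow)
    also have "\<dots> = w [^]\<^bsub>W\<^esub> (int (q * r) mod int p)"
      using W.int_pow_mod_exponent[OF w expW[OF w], of "int (q * r)"] by (simp only: int_pow_int)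
    also have "int (q * r) mod int p = int (q * r mod p)" by (simp only: zmod_int)
    also have "q * r mod p = 1" using r prime_gt_1_nat[OF p] by (simp add: cong_def)
    finally show ?thesis using w by simp
  qed
  have surj: "f ` carrier V = carrier W" using fs s_closed by force
  have ker: "subgroup ?ker V" by (rule f.subgroup_kernel)
  show "vs_isomorphic (residue_ring (int p)) (exponent_space (V Mod ?ker)) (exponent_space W)"
  proof -
    let ?T = "\<lambda>C. the_elem (f ` C)"
    have iso: "?T \<in> iso (V Mod ?ker) W" by (rule f.FactGroup_iso_set[OF surj])
    have "x [^]\<^bsub>V\<^esub> p \<in> ?ker" if "x \<in> carrier V" for x
      using expV[OF that] subgroup.one_closed[OF ker] by simp
    then have "linear_map (residue_ring (int p)) (exponent_space (V Mod ?ker)) (exponent_space W) ?T"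
      using iso by (intro linear_map_exponent_space V.abelian_FactGroup ker W p expW
          exponent_FactGroup[OF V ker]) (auto simp: iso_def)
    then show ?thesis using iso by (auto simp: vs_isomorphic_def iso_def)
  qed
  define h where "h v = v \<otimes>\<^bsub>V\<^esub> inv\<^bsub>V\<^esub> (s (f v))" for v
  have sf: "s (f v) \<in> carrier V" if "v \<in> carrier V" for v using that s_closed by simp
  have h_ker: "h v \<in> ?ker" if v: "v \<in> carrier V" for v
    using v sf[OF v] fs[of "f v"] by (simp add: kernel_def h_def)
  have h_hom: "h \<in> hom V V"
  proof (rule homI)
    show "h v \<in> carrier V" if "v \<in> carrier V" for v using that sf by (simp add: h_def)
    show "h (v \<otimes>\<^bsub>V\<^esub> w) = h v \<otimes>\<^bsub>V\<^esub> h w" if vw: "v \<in> carrier V" "w \<in> carrier V" for v w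
      using vw sf by (simp add: h_def s_mult V.inv_mult V.m_ac)
  qed
  have h_split: "h v \<otimes>\<^bsub>V\<^esub> s (f v) = v" if "v \<in> carrier V" for v
    using that sf by (simp add: h_def V.m_assoc)
  let ?T = "\<lambda>v. (f v, h v)"
  let ?D = "direct_sum (exponent_space W) ((exponent_space V)\<lparr>carrier := ?ker\<rparr>)"
  have vsV: "vectorspace (residue_ring (int p)) (exponent_space V)"
    by (rule vectorspace_exponent_space[OF V p expV])
  have vsD: "vectorspace (residue_ring (int p)) ?D"
  proof -
    have "vectorspace (residue_ring (int p)) (exponent_space W)"
      by (rule vectorspace_exponent_space[OF W p expW])
    moreover have "vectorspace (residue_ring (int p)) ((exponent_space V)\<lparr>carrier := ?ker\<rparr>)"
      by (rule vectorspace_exponent_space_subgroup[OF V ker p]) (simp add: expV kernel_def)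
    ultimately show ?thesis by (simp add: vectorspace_def direct_sum_is_module)
  qed
  have T: "?T \<in> module_hom (residue_ring (int p)) (exponent_space V) ?D"
    using h_ker h_hom hom_int_pow[OF h_hom] V.group_axioms
    by (auto simp: module_hom_def direct_sum_def hom_def f.hom_int_pow)
  have lin: "linear_map (residue_ring (int p)) (exponent_space V) ?D ?T"
    by (rule linear_mapI[OF vsV vsD T])
  have "inj_on ?T (carrier V)"
  proof (rule inj_onI)
    fix v w assume v: "v \<in> carrier V" and w: "w \<in> carrier V" and "?T v = ?T w"
    then have "h v \<otimes>\<^bsub>V\<^esub> s (f v) = h w \<otimes>\<^bsub>V\<^esub> s (f w)" by simp
    then show "v = w" by (simp only: h_split[OF v] h_split[OF w])
  qed
  moreover have "?T ` carrier V = carrier ?D"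
  proof
    show "?T ` carrier V \<subseteq> carrier ?D" using h_ker by (auto simp: direct_sum_def)
    show "carrier ?D \<subseteq> ?T ` carrier V"
    proof
      fix y assume "y \<in> carrier ?D"
      then obtain w k where y: "y = (w, k)" "w \<in> carrier W" "k \<in> carrier V" "f k = \<one>\<^bsub>W\<^esub>"
        by (auto simp: kernel_def direct_sum_def)
      have "f (k \<otimes>\<^bsub>V\<^esub> s w) = w" using y s_closed fs by simp
      moreover from this have "h (k \<otimes>\<^bsub>V\<^esub> s w) = k" using y s_closed by (simp add: h_def V.m_assoc)
      ultimately show "y \<in> ?T ` carrier V"
        using y s_closed by (intro image_eqI[of _ _ "k \<otimes>\<^bsub>V\<^esub> s w"]) auto
    qed
  qed
  ultimately have "bij_betw ?T (carrier (exponent_space V)) (carrier ?D)"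
    by (simp add: bij_betw_def)
  then show "vs_isomorphic (residue_ring (int p)) (exponent_space V) ?D"
    unfolding vs_isomorphic_def using lin by (intro exI[of _ ?T] conjI)
qed

text \<open>\<open>f\<close> maps \<open>H\<close> into \<open>H'\<close>, so all members of a coset
  yield the same coset of \<open>H'\<close> and \<open>the_elem\<close> is applied to a singleton.
  Serves for the relative norm and for extension of ideals alike.\<close>

lemma
  assumes H: "H \<lhd> G" and H': "H' \<lhd> G'" and f: "f \<in> hom G G'" and fH: "\<And>h. h \<in> H \<Longrightarrow> f h \<in> H'"
  defines "\<phi> \<equiv> \<lambda>C. the_elem ((\<lambda>a. H' #>\<^bsub>G'\<^esub> f a) ` C)"
  shows induced_hom_coset: "a \<in> carrier G \<Longrightarrow> \<phi> (H #>\<^bsub>G\<^esub> a) = H' #>\<^bsub>G'\<^esub> f a"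
    and induced_hom: "\<phi> \<in> hom (G Mod H) (G' Mod H')"
proof -
  interpret H: normal H G by (rule H)
  interpret H': normal H' G' by (rule H')
  interpret f: group_hom G G' f
    using f by (simp add: group_hom_def group_hom_axioms_def H.is_group H'.is_group)
  show coset: "\<phi> (H #>\<^bsub>G\<^esub> a) = H' #>\<^bsub>G'\<^esub> f a" if a: "a \<in> carrier G" for a
  proof -
    have "H' #>\<^bsub>G'\<^esub> f b = H' #>\<^bsub>G'\<^esub> f a" if "b \<in> H #>\<^bsub>G\<^esub> a" for b
    proof -
      from that obtain h where h: "h \<in> H" "b = h \<otimes>\<^bsub>G\<^esub> a" by (auto simp: r_coset_def)
      have "f b = f h \<otimes>\<^bsub>G'\<^esub> f a" using h a H.mem_carrier by simp
      then have "f b \<in> H' #>\<^bsub>G'\<^esub> f a" using fH[OF h(1)] by (auto simp: r_coset_def)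
      then show ?thesis using H'.repr_independence[OF _ f.hom_closed[OF a] H'.subgroup_axioms] by simp
    qed
    moreover have "a \<in> H #>\<^bsub>G\<^esub> a" by (rule H.rcos_self[OF a H.subgroup_axioms])
    ultimately have "(\<lambda>a. H' #>\<^bsub>G'\<^esub> f a) ` (H #>\<^bsub>G\<^esub> a) = {H' #>\<^bsub>G'\<^esub> f a}" by blast
    then show ?thesis by (simp add: \<phi>_def)
  qed
  show "\<phi> \<in> hom (G Mod H) (G' Mod H')"
  proof (rule homI)
    fix C assume "C \<in> carrier (G Mod H)"
    then obtain a where a: "a \<in> carrier G" "C = H #>\<^bsub>G\<^esub> a" by (auto simp: FactGroup_def RCOSETS_def)
    then show "\<phi> C \<in> carrier (G' Mod H')" using coset f.hom_closed by (auto simp: FactGroup_def RCOSETS_def)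
    fix D assume "D \<in> carrier (G Mod H)"
    then obtain b where b: "b \<in> carrier G" "D = H #>\<^bsub>G\<^esub> b" by (auto simp: FactGroup_def RCOSETS_def)
    show "\<phi> (C \<otimes>\<^bsub>G Mod H\<^esub> D) = \<phi> C \<otimes>\<^bsub>G' Mod H'\<^esub> \<phi> D"
      using a b coset by (simp add: FactGroup_def H.rcos_sum H'.rcos_sum)
  qed
qed

section \<open>Primitive ambiguous ideals\<close>

context numfld_ext
begin

lemma ambiguous_subgroup:
  "subgroup {A \<in> carrier (ideal_group E). A [^]\<^bsub>ideal_group E\<^esub> (p::nat) \<in> extended_ideals E K} (ideal_group E)"
proof -
  interpret H: subgroup "extended_ideals E K" "ideal_group E" by (rule extended_ideals_subgroup)
  define S where "S = {A \<in> carrier (ideal_group E). A [^]\<^bsub>ideal_group E\<^esub> (p::nat) \<in> extended_ideals E K}"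
  have mem: "A \<in> S \<longleftrightarrow> A \<in> carrier (ideal_group E) \<and> A [^]\<^bsub>ideal_group E\<^esub> p \<in> extended_ideals E K" for A
    unfolding S_def by (rule mem_Collect_eq)
  have "subgroup S (ideal_group E)"
  proof (rule subgroup.intro)
    show "S \<subseteq> carrier (ideal_group E)" using mem by blast
    show "\<one>\<^bsub>ideal_group E\<^esub> \<in> S"
      unfolding mem using E.I.one_closed H.one_closed by (simp only: E.I.nat_pow_one simp_thms)
    show "inv\<^bsub>ideal_group E\<^esub> A \<in> S" if "A \<in> S" for A
      using that E.I.inv_closed[of A] H.m_inv_closed unfolding mem by (metis E.I.nat_pow_inv)
    show "A \<otimes>\<^bsub>ideal_group E\<^esub> B \<in> S" if "A \<in> S" "B \<in> S" for A B
      using that E.I.m_closed[of A B] H.m_closed unfolding mem by (metis E.I.nat_pow_distrib)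
  qed
  then show ?thesis by (simp only: S_def)
qed

lemma ambiguous_group_simps:
  "carrier (ambiguous_group p E K) = {A \<in> carrier (ideal_group E). A [^]\<^bsub>ideal_group E\<^esub> p \<in> extended_ideals E K}"
  "monoid.mult (ambiguous_group p E K) = monoid.mult (ideal_group E)"
  "one (ambiguous_group p E K) = one (ideal_group E)"
  by (simp_all add: ambiguous_group_def)

lemma ambiguous_comm_group: "comm_group (ambiguous_group p E K)"
proof (rule group.group_comm_groupI)
  show "group (ambiguous_group p E K)"
    unfolding ambiguous_group_def
    by (rule subgroup.subgroup_is_group[OF ambiguous_subgroup E.I.group_axioms])
qed (simp add: ambiguous_group_simps E.ideal_mult_commute)

lemma ambiguous_pow: "A [^]\<^bsub>ambiguous_group p E K\<^esub> (k::nat) = A [^]\<^bsub>ideal_group E\<^esub> k"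
  by (simp add: ambiguous_group_def nat_pow_def)

lemma extended_in_ambiguous: "extended_ideals E K \<subseteq> carrier (ambiguous_group p E K)"
proof
  fix A assume A: "A \<in> extended_ideals E K"
  interpret H: subgroup "extended_ideals E K" "ideal_group E" by (rule extended_ideals_subgroup)
  have "A [^]\<^bsub>ideal_group E\<^esub> p \<in> extended_ideals E K"
    by (induction p) (use A H.one_closed H.m_closed in auto)
  then show "A \<in> carrier (ambiguous_group p E K)"
    using H.mem_carrier[OF A] by (simp add: ambiguous_group_simps)
qed

lemma extended_subgroup_ambiguous: "subgroup (extended_ideals E K) (ambiguous_group p E K)"
  using E.I.subgroup_incl[OF extended_ideals_subgroup ambiguous_subgroup] extended_in_ambiguous
  unfolding ambiguous_group_def by simp

lemma extended_normal: "extended_ideals E K \<lhd> ambiguous_group p E K"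
  by (rule comm_group.subgroup_imp_normal[OF ambiguous_comm_group extended_subgroup_ambiguous])

lemma primitive_comm_group: "comm_group (primitive_ambiguous p E K)"
  unfolding primitive_ambiguous_def
  by (rule comm_group.abelian_FactGroup[OF ambiguous_comm_group extended_subgroup_ambiguous])

lemma primitive_exponent:
  "C \<in> carrier (primitive_ambiguous p E K) \<Longrightarrow>
    C [^]\<^bsub>primitive_ambiguous p E K\<^esub> p = \<one>\<^bsub>primitive_ambiguous p E K\<^esub>"
  unfolding primitive_ambiguous_def
  by (rule exponent_FactGroup[OF ambiguous_comm_group extended_subgroup_ambiguous])
    (simp_all add: ambiguous_pow ambiguous_group_simps)

lemma primitive_finite:
  assumes p: "p > 0"
  shows "finite (carrier (primitive_ambiguous p E K))"
proof -
  let ?G = "ambiguous_group p E K" and ?H = "extended_ideals E K"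
  interpret G: comm_group ?G by (rule ambiguous_comm_group)
  interpret H: subgroup ?H ?G by (rule extended_subgroup_ambiguous)
  obtain S where S: "finite S" "\<And>A. fractional_ideal E A \<Longrightarrow> A [^]\<^bsub>ideal_group E\<^esub> p \<in> ?H \<Longrightarrow>
    \<exists>B\<in>S. \<exists>D\<in>?H. fractional_ideal E B \<and> A = ideal_mult E D B"
    using ambiguous_finite_representatives[OF p] by blast
  \<comment> \<open>Cosets are taken in the full ideal group, since a representative from
    \<open>S\<close> is known to be fractional but not stated to be ambiguous.\<close>
  have "carrier (primitive_ambiguous p E K) \<subseteq> (\<lambda>B. ?H #>\<^bsub>ideal_group E\<^esub> B) ` S"
  proof
    fix C assume "C \<in> carrier (primitive_ambiguous p E K)"
    then obtain A where A: "A \<in> carrier ?G" "C = ?H #>\<^bsub>?G\<^esub> A"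
      by (auto simp: primitive_ambiguous_def FactGroup_def RCOSETS_def)
    then obtain B D where BD: "B \<in> S" "D \<in> ?H" "fractional_ideal E B" "A = ideal_mult E D B"
      using S(2)[of A] by (auto simp: ambiguous_group_simps)
    have "C = ?H #>\<^bsub>ideal_group E\<^esub> A" unfolding A(2) by (simp add: r_coset_def ambiguous_group_simps)
    also have "\<dots> = ?H #>\<^bsub>ideal_group E\<^esub> B"
    proof (rule E.I.repr_independence[OF _ _ extended_ideals_subgroup, symmetric])
      show "A \<in> ?H #>\<^bsub>ideal_group E\<^esub> B" using BD by (auto simp: r_coset_def)
    qed (use BD in simp)
    finally show "C \<in> (\<lambda>B. ?H #>\<^bsub>ideal_group E\<^esub> B) ` S" using BD(1) by blast
  qed
  then show ?thesis using S(1) finite_subset by blast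
qed

end

text \<open>\<open>f\<close> commutes with \<open>p\<close>-th powers, so respecting extended ideals
  is enough to respect ambiguity.\<close>

lemma ambiguous_group_hom:
  assumes EK: "numfld_ext K E m" and EK': "numfld_ext K' E' m'"
    and f: "f \<in> hom (ideal_group E) (ideal_group E')"
    and ext: "\<And>A. A \<in> extended_ideals E K \<Longrightarrow> f A \<in> extended_ideals E' K'"
  shows "f \<in> hom (ambiguous_group p E K) (ambiguous_group p E' K')"
proof -
  interpret EK: numfld_ext K E m by (rule EK)
  interpret EK': numfld_ext K' E' m' by (rule EK')
  interpret f: group_hom "ideal_group E" "ideal_group E'" f
    by (intro group_hom.intro group_hom_axioms.intro EK.E.I.group_axioms EK'.E.I.group_axioms f)
  show ?thesis
  proof (rule homI)
    fix A assume "A \<in> carrier (ambiguous_group p E K)"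
    then have A: "A \<in> carrier (ideal_group E)" "A [^]\<^bsub>ideal_group E\<^esub> p \<in> extended_ideals E K"
      by (simp_all only: EK.ambiguous_group_simps mem_Collect_eq)
    then show "f A \<in> carrier (ambiguous_group p E' K')"
      unfolding EK'.ambiguous_group_simps using f.hom_closed[OF A(1)] f.hom_nat_pow[OF A(1)] ext[OF A(2)]
      by (simp only: mem_Collect_eq simp_thms)
  next
    fix A B assume "A \<in> carrier (ambiguous_group p E K)" "B \<in> carrier (ambiguous_group p E K)"
    then show "f (A \<otimes>\<^bsub>ambiguous_group p E K\<^esub> B) = f A \<otimes>\<^bsub>ambiguous_group p E' K'\<^esub> f B"
      by (simp only: EK.ambiguous_group_simps EK'.ambiguous_group_simps mem_Collect_eq f.hom_mult)
  qed
qed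

theorem theorem3p3:
  fixes p q :: nat
    and N K L F :: "'a::field_char_0 set"
    and V W :: "'a set set monoid"
    and \<nu> :: "'a set set \<Rightarrow> 'a set set"
    and ker :: "'a set set set"
  assumes "Factorial_Ring.prime p"
    and "number_field N" and "number_field K" and "has_degree N K p"
    and "subfield L ambient" and "L \<subseteq> N" and "N = composite L K"
    and "has_degree N L q" and "Rings.coprime q p"
    and "F = L \<inter> K" and "has_degree L F p" and "has_degree K F q"
    and V: "V = primitive_ambiguous p N K"
    and W: "W = primitive_ambiguous p L F"
    and \<nu>: "\<nu> = induced_norm p N K L F"
    and ker: "ker = kernel V W \<nu>"
  shows
    "(\<forall>A\<in>carrier (ambiguous_group p N K).
        relative_norm N L A \<in> carrier (ambiguous_group p L F) \<and>
        \<nu> (extended_ideals N K #>\<^bsub>ambiguous_group p N K\<^esub> A) =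
          extended_ideals L F #>\<^bsub>ambiguous_group p L F\<^esub> relative_norm N L A) \<and>
     linear_map (residue_ring (int p)) (exponent_space V) (exponent_space W) \<nu> \<and>
     finite (carrier V) \<and> finite (carrier W) \<and>
     vs_isomorphic (residue_ring (int p))
       (exponent_space (V Mod ker)) (exponent_space W) \<and>
     vs_isomorphic (residue_ring (int p))
       (exponent_space V)
       (direct_sum (exponent_space W) ((exponent_space V)\<lparr>carrier := ker\<rparr>))"
proof -
  note p = assms(1)
  have p0: "p > 0" using p by (rule prime_gt_0_nat)
  have nN: "numfld N" and nK: "numfld K" using assms(2,3) by (simp_all only: number_field_iff)
  have nL: "numfld L" by (rule numfld_subfield[OF nN _ assms(6)]) (simp add: subfld_def assms(5))
  have "subfield F ambient"
    using assms(5) subfld.subfield[OF numfld.axioms(1)[OF nK]]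
    unfolding assms(10) subfield_ambient_iff by simp
  then have nF: "numfld F" by (intro numfld_subfield[OF nL]) (simp_all add: subfld_def assms(10))
  have NK: "numfld_ext K N p" by (rule numfld_ext.intro[OF nK nN numfld_ext_axioms.intro[OF assms(4)]])
  have NL: "numfld_ext L N q" by (rule numfld_ext.intro[OF nL nN numfld_ext_axioms.intro[OF assms(8)]])
  have LF: "numfld_ext F L p" by (rule numfld_ext.intro[OF nF nL numfld_ext_axioms.intro[OF assms(11)]])
  have KF: "numfld_ext F K q" by (rule numfld_ext.intro[OF nF nK numfld_ext_axioms.intro[OF assms(12)]])
  let ?GN = "ambiguous_group p N K" and ?GL = "ambiguous_group p L F"
  let ?HN = "extended_ideals N K" and ?HL = "extended_ideals L F"
  have norm_ext: "relative_norm N L A \<in> ?HL" if A: "A \<in> ?HN" for A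
  proof -
    obtain a where a: "fractional_ideal K a" "A = ideal_extension N a"
      using A unfolding numfld_ext.extended_ideals_iff[OF NK] by blast
    have "relative_norm N L A = ideal_extension L (relative_norm K F a)"
      unfolding a(2) by (rule relative_norm_ext_composite[OF NL KF NK LF assms(7) a(1)])
    then show ?thesis
      using numfld_ext.RN_fractional[OF KF a(1)] unfolding numfld_ext.extended_ideals_iff[OF LF] by blast
  qed
  have ext_ext: "ideal_extension N B \<in> ?HN" if B: "B \<in> ?HL" for B
  proof -
    obtain b where b: "fractional_ideal F b" "B = ideal_extension L b"
      using B unfolding numfld_ext.extended_ideals_iff[OF LF] by blast
    have FN: "F \<subseteq> N" using assms(6,10) by blast
    \<comment> \<open>An ideal of \<open>F\<close> can be extended to \<open>N\<close> through
      \<open>L\<close> or through \<open>K\<close>; the second route shows that the result comes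
      from \<open>K\<close>.\<close>
    have "ideal_extension N B = ideal_extension N (ideal_extension K b)"
      unfolding b(2) by (simp only: ext_trans[OF NL LF FN] ext_trans[OF NK KF FN])
    then show ?thesis
      using numfld_ext.ext_fractional[OF KF b(1)] unfolding numfld_ext.extended_ideals_iff[OF NK] by blast
  qed
  note norm_hom = ambiguous_group_hom[OF NK LF numfld_ext.RN_hom[OF NL] norm_ext]
  note ext_hom = ambiguous_group_hom[OF LF NK numfld_ext.ext_hom[OF NL] ext_ext]
  note HN = numfld_ext.extended_normal[OF NK, of p] and HL = numfld_ext.extended_normal[OF LF, of p]
  have \<nu>_eq: "\<nu> = (\<lambda>C. the_elem ((\<lambda>A. ?HL #>\<^bsub>?GL\<^esub> relative_norm N L A) ` C))"
    by (rule HOL.ext) (simp only: \<nu> induced_norm_def)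
  have \<nu>_coset: "\<nu> (?HN #>\<^bsub>?GN\<^esub> A) = ?HL #>\<^bsub>?GL\<^esub> relative_norm N L A" if "A \<in> carrier ?GN" for A
    unfolding \<nu>_eq by (rule induced_hom_coset[OF HN HL norm_hom norm_ext that])
  have \<nu>_hom: "\<nu> \<in> hom V W"
    unfolding \<nu>_eq V W primitive_ambiguous_def by (rule induced_hom[OF HN HL norm_hom norm_ext])
  \<comment> \<open>Induced by extension of ideals from \<open>L\<close> to \<open>N\<close>. The
    norm of an extended ideal is its \<open>q\<close>-th power, so \<open>\<tau>\<close> is the
    homomorphism in the opposite direction from which the section is made.\<close>
  define \<tau> where "\<tau> = (\<lambda>C. the_elem ((\<lambda>B. ?HN #>\<^bsub>?GN\<^esub> ideal_extension N B) ` C))"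
  have \<tau>_coset: "\<tau> (?HL #>\<^bsub>?GL\<^esub> B) = ?HN #>\<^bsub>?GN\<^esub> ideal_extension N B" if "B \<in> carrier ?GL" for B
    unfolding \<tau>_def by (rule induced_hom_coset[OF HL HN ext_hom ext_ext that])
  have \<tau>_hom: "\<tau> \<in> hom W V"
    unfolding \<tau>_def V W primitive_ambiguous_def by (rule induced_hom[OF HL HN ext_hom ext_ext])
  have cV: "comm_group V" and cW: "comm_group W"
    unfolding V W by (rule numfld_ext.primitive_comm_group[OF NK], rule numfld_ext.primitive_comm_group[OF LF])
  have expV: "x [^]\<^bsub>V\<^esub> p = \<one>\<^bsub>V\<^esub>" if "x \<in> carrier V" for x
    using numfld_ext.primitive_exponent[OF NK] that unfolding V by blast
  have expW: "x [^]\<^bsub>W\<^esub> p = \<one>\<^bsub>W\<^esub>" if "x \<in> carrier W" for x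
    using numfld_ext.primitive_exponent[OF LF] that unfolding W by blast
  have \<nu>\<tau>: "\<nu> (\<tau> w) = w [^]\<^bsub>W\<^esub> q" if w: "w \<in> carrier W" for w
  proof -
    obtain B where B: "B \<in> carrier ?GL" "w = ?HL #>\<^bsub>?GL\<^esub> B"
      using w by (auto simp: W primitive_ambiguous_def FactGroup_def RCOSETS_def)
    have "fractional_ideal L B" using B(1) by (simp add: numfld_ext.ambiguous_group_simps[OF LF])
    then have "relative_norm N L (ideal_extension N B) = B [^]\<^bsub>?GL\<^esub> q"
      using numfld_ext.RN_ext[OF NL] numfld_ext.ambiguous_pow[OF LF] by metis
    then have "\<nu> (\<tau> w) = ?HL #>\<^bsub>?GL\<^esub> (B [^]\<^bsub>?GL\<^esub> q)"
      using \<nu>_coset[OF hom_in_carrier[OF ext_hom B(1)]] \<tau>_coset[OF B(1)] B(2) by simp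
    also have "group_hom ?GL W (\<lambda>B. ?HL #>\<^bsub>?GL\<^esub> B)"
      using normal.r_coset_hom_Mod[OF HL] cW numfld_ext.ambiguous_comm_group[OF LF, of p]
      unfolding group_hom_def group_hom_axioms_def comm_group_def W primitive_ambiguous_def by blast
    from group_hom.hom_nat_pow[OF this B(1)]
    have "?HL #>\<^bsub>?GL\<^esub> (B [^]\<^bsub>?GL\<^esub> q) = w [^]\<^bsub>W\<^esub> q" unfolding B(2) .
    finally show ?thesis .
  qed
  have part1: "\<forall>A\<in>carrier ?GN. relative_norm N L A \<in> carrier ?GL \<and>
      \<nu> (?HN #>\<^bsub>?GN\<^esub> A) = ?HL #>\<^bsub>?GL\<^esub> relative_norm N L A"
    using hom_in_carrier[OF norm_hom] \<nu>_coset by blast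
  have part2: "linear_map (residue_ring (int p)) (exponent_space V) (exponent_space W) \<nu>"
    by (rule linear_map_exponent_space[OF cV cW p expV expW \<nu>_hom])
  have part3: "finite (carrier V)" "finite (carrier W)"
    unfolding V W using numfld_ext.primitive_finite[OF NK p0] numfld_ext.primitive_finite[OF LF p0] by auto
  note split = split_surjection_exponent_space[OF cV cW p expV expW \<nu>_hom \<tau>_hom \<nu>\<tau> assms(9)]
  show ?thesis
    unfolding ker by (intro conjI part1 part2 part3 split)
qed

end
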